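(* Let $\delta$ be a codifferential on $W$ and $\mu$ a codifferential on $M$. The equivalence classes of extensions of $\delta$ by $\mu$ under the action of the group $G^{\text{gen}}_{\delta,\mu}$ are classified by the following data: 1. Equivalence classes of $D_\mu$-cohomology classes $\bar\lambda\in H_\mu^{1,1}$ which satisfy the MC-equation $$\overline{[\delta+\lambda,\delta+\lambda]}=0\in H_\mu^{1,2}(\ker(D_{\delta+\lambda}))$$ under the action of the group $G_{\delta,\mu}$ on $H_\mu$. 2. Equivalence classes of $D_{\bar\delta+\bar\lambda}$-cohomology classes $[\bar\tau]\in H^{0,2}_{\mu,\delta+\lambda}$ under the action of the group $G_{\delta,\mu,\lambda}$. That is: choose one representative $\bar\lambda$ of each orbit in 1, a cochain $\lambda\in\bar\lambda$, and a $\psi$ such that $\delta+\mu+\lambda+\psi$ is an extension (such $\psi$ exists). Then every extension of $\delta$ by $\mu$ is $G^{\text{gen}}_{\delta,\mu}$-equivalent to $\delta+\mu+\lambda+\psi+\tau$ for exactly one of the chosen $\bar\lambda$ and exactly one $G_{\delta,\mu,\lambda}$-orbit of classes $[\bar\tau]\in H^{0,2}_{\mu,\delta+\lambda}$, and every such choice occurs.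
   Context: Work over a field $\mathbb K$ of characteristic different from 2 and 3. $M,W$ are $\mathbb Z_2$-graded vector spaces and $V=M\oplus W$ (parity-reversed convention: an ordinary ungraded algebra corresponds to a completely odd space). Let $C(V)=\operatorname{Hom}(T(V),V)$, $T(V)=\bigoplus_n V^{\otimes n}$. For $\varphi\in\operatorname{Hom}(V^{\otimes k},V)$ and $\chi\in\operatorname{Hom}(V^{\otimes l},V)$ put $$(\varphi\circ\chi)(v_1,\dots,v_{k+l-1})=\sum_i(-1)^{|\chi|(|v_1|+\dots+|v_{i-1}|)}\varphi(v_1,\dots,v_{i-1},\chi(v_i,\dots,v_{i+l-1}),\dots,v_{k+l-1}),$$ and $[\varphi,\chi]=\varphi\circ\chi-(-1)^{|\varphi||\chi|}\chi\circ\varphi$ (the graded Lie bracket of coderivations of $T(V)$). Maps defined on a summand of $T(V)$ are extended by zero. Here "codifferential" on a space $U$ means an odd $d\in\operatorname{Hom}(U^{\otimes2},U)$ with $[d,d]=0$, i.e. an associative algebra structure. Let $T^{k,l}(M,W)\subseteq V^{\otimes(k+l)}$ be spanned by tensors of $k$ elements of $M$ and $l$ elements of $W$ in any order, $C^{k,l}=\operatorname{Hom}(T^{k,l}(M,W),M)$, and $C^k=\operatorname{Hom}(W^{\otimes k},W)$. Thus $\delta\in C^2$, $\mu\in C^{2,0}$. An extension of $\delta$ by $\mu$ is a codifferential $d=\delta+\mu+\lambda+\psi$ on $V$ with odd $\lambda\in C^{1,1}$, $\psi\in C^{0,2}$; equivalently $[\delta,\lambda]+\tfrac12[\lambda,\lambda]+[\mu,\psi]=0$,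 $[\mu,\lambda]=0$, $[\delta+\lambda,\psi]=0$. Groups (all automorphisms are even linear maps; $g^*(\varphi)=g^{-1}\circ\varphi\circ g^{\otimes n}$ for $\varphi\in\operatorname{Hom}(V^{\otimes n},V)$): - $G_{M,W}=\mathbf{GL}(M)\times\mathbf{GL}(W)$, acting block-diagonally on $V$. - $G_{\delta,\mu}=\{g\in G_{M,W}:g^*(\delta)=\delta,\ g^*(\mu)=\mu\}$, acting on $H_\mu$ by $g^*(\bar\varphi)=\overline{g^*(\varphi)}$. - $G^{\text{rest}}=\{\exp(\beta):\beta\in C^{0,1}=\operatorname{Hom}(W,M)\text{ even}\}$, $\exp(\beta)(m,w)=(m+\beta(w),w)$. - $G^{\text{gen}}_{\delta,\mu}=G_{\delta,\mu}\rtimes G^{\text{rest}}=\{g\exp(\beta):g\in G_{\delta,\mu},\ \exp(\beta)\in G^{\text{rest}}\}$, acting on extensions of $\delta$ by $\mu$ by $d\mapsto h^*(d)$. - $G_{\delta,\mu,\lambda}=\{h=g\exp(\beta)\in G^{\text{gen}}_{\delta,\mu}:\lambda=g^*(\lambda)+[\mu,\beta]\}$. Given $\psi$ such that $\delta+\mu+\lambda+\psi$ is an extension, it acts on $H^{0,2}_{\mu,\delta+\lambda}$ by $$[\bar\tau]\mapsto\Big[\overline{g^*(\psi)-\psi+g^*(\tau)+[\delta+\lambda-\tfrac12[\mu,\beta],\beta]}\Big].$$ Cohomology. For $\alpha\in C(V)$ put $D_\alpha=[\alpha,\cdot\,]$. - $D_\mu:C^{k,l}\to C^{k+1,l}$ squares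 to zero; $H_\mu^{k,l}=\ker(D_\mu|_{C^{k,l}})/D_\mu(C^{k-1,l})$ (with $C^{-1,l}=0$), the class of $\varphi$ being $\bar\varphi$. - For $\lambda\in C^{1,1}$ odd with $[\mu,\lambda]=0$, $D_{\delta+\lambda}:C^{k,l}\to C^{k,l+1}$ anticommutes with $D_\mu$, and $H_\mu^{1,2}(\ker(D_{\delta+\lambda}))=\{\varphi\in C^{1,2}:D_\mu\varphi=0,\ D_{\delta+\lambda}\varphi=0\}/D_\mu\{\psi\in C^{0,2}:D_{\delta+\lambda}\psi=0\}$. The element $[\delta+\lambda,\delta+\lambda]=2[\delta,\lambda]+[\lambda,\lambda]$ lies in the numerator; vanishing of its class depends only on $\bar\lambda$. - If it vanishes, $D_{\bar\delta+\bar\lambda}:H_\mu^{k,l}\to H_\mu^{k,l+1}$, $\bar\varphi\mapsto\overline{[\delta+\lambda,\varphi]}$, squares to zero, and $H_{\mu,\delta+\lambda}^{0,2}=\ker(D_{\bar\delta+\bar\lambda}:H_\mu^{0,2}\to H_\mu^{0,3})/D_{\bar\delta+\bar\lambda}(H_\mu^{0,1})$; the class of $\bar\tau$ is $[\bar\tau]$. Convention: in $H_\mu^{1,1}$ and $H_{\mu,\delta+\lambda}^{0,2}$ only classes of odd cochains are considered (automatic when $V$ is completely odd). *)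

theory Defs
  imports Complex_Main
    "HOL-Library.Function_Algebras"
    "HOL-Library.Product_Plus"
    "HOL-Library.Set_Algebras"
begin

section \<open>Graded vector spaces and cochains\<close>

record ('k, 'u) graded =
  smul :: "'k \<Rightarrow> 'u \<Rightarrow> 'u"
  even_part :: "'u set"
  odd_part :: "'u set"

definition graded_space :: "('k::field, 'u::ab_group_add) graded \<Rightarrow> bool" where
  "graded_space U \<longleftrightarrow>
     vector_space (smul U) \<and>
     module.subspace (smul U) (even_part U) \<and>
     module.subspace (smul U) (odd_part U) \<and>
     even_part U \<inter> odd_part U = {0} \<and>
     even_part U + odd_part U = UNIV"

text \<open>Degrees are natural numbers read modulo 2.\<close>

definition part :: "('k, 'u) graded \<Rightarrow> nat \<Rightarrow> 'u set" where
  "part U p = (if even p then even_part U else odd_part U)"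

definition dsum ::
    "('k, 'm) graded \<Rightarrow> ('k, 'w) graded \<Rightarrow> ('k, 'm \<times> 'w) graded" where
  "dsum M W = \<lparr> smul = (\<lambda>c (m, w). (smul M c m, smul W c w)),
                even_part = even_part M \<times> even_part W,
                odd_part = odd_part M \<times> odd_part W \<rparr>"

text \<open>An element of \<open>C(U) = Hom(T(U), U)\<close> is a function on lists, the list
  \<open>[v\<^sub>1, \<dots>, v\<^sub>n]\<close> standing for the tensor \<open>v\<^sub>1 \<otimes> \<dots> \<otimes> v\<^sub>n\<close>. An element of
  \<open>Hom(U\<^sup>\<otimes>\<^sup>n, U)\<close> is extended by zero to lists of other lengths.\<close>

type_synonym 'u cochain = "'u list \<Rightarrow> 'u"

definition multilinear :: "('k::field, 'u::ab_group_add) graded \<Rightarrow> 'u cochain \<Rightarrow> bool" where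
  "multilinear U \<phi> \<longleftrightarrow>
     (\<forall>xs ys. Vector_Spaces.linear (smul U) (smul U) (\<lambda>v. \<phi> (xs @ v # ys)))"

definition Hom :: "('k::field, 'u::ab_group_add) graded \<Rightarrow> nat \<Rightarrow> 'u cochain set" where
  "Hom U n = {\<phi>. multilinear U \<phi> \<and> (\<forall>vs. length vs \<noteq> n \<longrightarrow> \<phi> vs = 0)}"

definition scale_cochain :: "('k, 'u) graded \<Rightarrow> 'k \<Rightarrow> 'u cochain \<Rightarrow> 'u cochain" where
  "scale_cochain U c \<phi> = (\<lambda>vs. smul U c (\<phi> vs))"

definition homogeneous :: "('k, 'u) graded \<Rightarrow> nat \<Rightarrow> 'u cochain \<Rightarrow> bool" where
  "homogeneous U p \<phi> \<longleftrightarrow>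
     (\<forall>vs ps. list_all2 (\<lambda>v q. v \<in> part U q) vs ps \<longrightarrow> \<phi> vs \<in> part U (p + sum_list ps))"

abbreviation even_cochain :: "('k, 'u) graded \<Rightarrow> 'u cochain \<Rightarrow> bool" where
  "even_cochain U \<equiv> homogeneous U 0"

abbreviation odd_cochain :: "('k, 'u) graded \<Rightarrow> 'u cochain \<Rightarrow> bool" where
  "odd_cochain U \<equiv> homogeneous U 1"

section \<open>The bracket\<close>

text \<open>The parity involution \<open>v \<mapsto> (-1)\<^bsup>|v|\<^esup> v\<close> on homogeneous \<open>v\<close>, extended linearly.\<close>

definition pinv :: "('k, 'u::ab_group_add) graded \<Rightarrow> 'u \<Rightarrow> 'u" where
  "pinv U v = (THE u. \<exists>a\<in>even_part U. \<exists>b\<in>odd_part U. v = a + b \<and> u = a - b)"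

text \<open>\<open>\<phi> \<circ> \<chi>\<close> for \<open>\<chi>\<close> of degree \<open>q\<close>. The sign \<open>(-1)\<^bsup>q (|v\<^sub>1| + \<dots> + |v\<^sub>i|)\<^esup>\<close> comes from
  applying \<open>pinv\<close> \<open>q\<close> times to each of \<open>v\<^sub>1, \<dots>, v\<^sub>i\<close>. The sum runs over all arities \<open>l\<close> of \<open>\<chi>\<close>;
  for \<open>\<chi> \<in> Hom(U\<^sup>\<otimes>\<^sup>l, U)\<close> the terms of the other arities vanish.\<close>

definition comp_deg ::
    "('k, 'u::ab_group_add) graded \<Rightarrow> nat \<Rightarrow> 'u cochain \<Rightarrow> 'u cochain \<Rightarrow> 'u cochain" where
  "comp_deg U q \<phi> \<chi> = (\<lambda>vs. \<Sum>i\<le>length vs. \<Sum>l\<le>length vs - i.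
     \<phi> (map (pinv U ^^ q) (take i vs) @ \<chi> (take l (drop i vs)) # drop (i + l) vs))"

text \<open>The component of degree \<open>p\<close> of a cochain; the characteristic is not 2.\<close>

definition hpart :: "('k::field, 'u::ab_group_add) graded \<Rightarrow> nat \<Rightarrow> 'u cochain \<Rightarrow> 'u cochain" where
  "hpart U p \<phi> = (\<lambda>vs. smul U (1/2)
     (\<phi> vs + smul U ((-1) ^ p) (pinv U (\<phi> (map (pinv U) vs)))))"

text \<open>\<open>[\<phi>, \<chi>] = \<phi> \<circ> \<chi> - (-1)\<^bsup>|\<phi>||\<chi>|\<^esup> \<chi> \<circ> \<phi>\<close> on homogeneous cochains, extended bilinearly.\<close>

definition bracket ::
    "('k::field, 'u::ab_group_add) graded \<Rightarrow> 'u cochain \<Rightarrow> 'u cochain \<Rightarrow> 'u cochain" where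
  "bracket U \<phi> \<chi> = (\<Sum>p\<in>{0, 1::nat}. \<Sum>q\<in>{0, 1::nat}.
     comp_deg U q (hpart U p \<phi>) (hpart U q \<chi>)
     - scale_cochain U ((-1) ^ (p * q)) (comp_deg U p (hpart U q \<chi>) (hpart U p \<phi>)))"

definition codifferential :: "('k::field, 'u::ab_group_add) graded \<Rightarrow> 'u cochain \<Rightarrow> bool" where
  "codifferential U d \<longleftrightarrow> d \<in> Hom U 2 \<and> odd_cochain U d \<and> bracket U d d = 0"

section \<open>Cochains on a direct sum\<close>

text \<open>Extension by zero of cochains of \<open>M\<close> and of \<open>W\<close>. By multilinearity \<open>ext_M \<mu>\<close>
  vanishes on a tensor having a factor in \<open>W\<close>, and \<open>ext_W \<delta>\<close> on one having a factor in \<open>M\<close>.\<close>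

definition ext_M :: "'m cochain \<Rightarrow> ('m \<times> 'w::zero) cochain" where
  "ext_M \<mu> = (\<lambda>vs. (\<mu> (map fst vs), 0))"

definition ext_W :: "'w cochain \<Rightarrow> ('m::zero \<times> 'w) cochain" where
  "ext_W \<delta> = (\<lambda>vs. (0, \<delta> (map snd vs)))"

definition incl :: "'m::zero + 'w::zero \<Rightarrow> 'm \<times> 'w" where
  "incl x = (case x of Inl m \<Rightarrow> (m, 0) | Inr w \<Rightarrow> (0, w))"

text \<open>\<open>C\<^sup>k\<^sup>,\<^sup>l\<close>: the words \<open>map incl xs\<close> with \<open>k\<close> letters from \<open>M\<close> and \<open>l\<close> from \<open>W\<close> span
  \<open>T\<^sup>k\<^sup>,\<^sup>l(M, W)\<close>, and cochains vanish on all other words.\<close>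

definition C ::
    "('k::field, 'm::ab_group_add) graded \<Rightarrow> ('k, 'w::ab_group_add) graded \<Rightarrow> nat \<Rightarrow> nat
     \<Rightarrow> ('m \<times> 'w) cochain set" where
  "C M W k l = {\<phi> \<in> Hom (dsum M W) (k + l).
     (\<forall>vs. snd (\<phi> vs) = 0) \<and>
     (\<forall>xs. length (filter isl xs) \<noteq> k \<longrightarrow> \<phi> (map incl xs) = 0)}"

definition is_extension ::
    "('k::field, 'm::ab_group_add) graded \<Rightarrow> ('k, 'w::ab_group_add) graded
     \<Rightarrow> ('m \<times> 'w) cochain \<Rightarrow> ('m \<times> 'w) cochain \<Rightarrow> ('m \<times> 'w) cochain \<Rightarrow> ('m \<times> 'w) cochain \<Rightarrow> bool"
  where
  "is_extension M W \<delta> \<mu> l \<psi> \<longleftrightarrow>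
     l \<in> C M W 1 1 \<and> odd_cochain (dsum M W) l \<and>
     \<psi> \<in> C M W 0 2 \<and> odd_cochain (dsum M W) \<psi> \<and>
     codifferential (dsum M W) (\<delta> + \<mu> + l + \<psi>)"

definition extensions ::
    "('k::field, 'm::ab_group_add) graded \<Rightarrow> ('k, 'w::ab_group_add) graded
     \<Rightarrow> ('m \<times> 'w) cochain \<Rightarrow> ('m \<times> 'w) cochain \<Rightarrow> ('m \<times> 'w) cochain set" where
  "extensions M W \<delta> \<mu> = {\<delta> + \<mu> + l + \<psi> | l \<psi>. is_extension M W \<delta> \<mu> l \<psi>}"

section \<open>Cohomology\<close>

text \<open>In the following \<open>\<delta>\<close> and \<open>\<mu>\<close> are the cochains on \<open>dsum M W\<close>, and \<open>\<alpha>\<close> stands for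
  \<open>\<delta> + \<lambda>\<close>. Cohomology classes are cosets \<open>\<phi> +o B\<close> of the group \<open>B\<close> of coboundaries.\<close>

definition Z ::
    "('k::field, 'm::ab_group_add) graded \<Rightarrow> ('k, 'w::ab_group_add) graded
     \<Rightarrow> ('m \<times> 'w) cochain \<Rightarrow> nat \<Rightarrow> nat \<Rightarrow> ('m \<times> 'w) cochain set" where
  "Z M W \<mu> k l = {\<phi> \<in> C M W k l. bracket (dsum M W) \<mu> \<phi> = 0}"

definition B ::
    "('k::field, 'm::ab_group_add) graded \<Rightarrow> ('k, 'w::ab_group_add) graded
     \<Rightarrow> ('m \<times> 'w) cochain \<Rightarrow> nat \<Rightarrow> nat \<Rightarrow> ('m \<times> 'w) cochain set" where
  "B M W \<mu> k l = (case k of 0 \<Rightarrow> {0} | Suc j \<Rightarrow> bracket (dsum M W) \<mu> ` C M W j l)"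

definition H ::
    "('k::field, 'm::ab_group_add) graded \<Rightarrow> ('k, 'w::ab_group_add) graded
     \<Rightarrow> ('m \<times> 'w) cochain \<Rightarrow> nat \<Rightarrow> nat \<Rightarrow> ('m \<times> 'w) cochain set set" where
  "H M W \<mu> k l = {\<phi> +o B M W \<mu> k l | \<phi>. \<phi> \<in> Z M W \<mu> k l}"

text \<open>Vanishing of the class of \<open>[\<alpha>, \<alpha>]\<close> in \<open>H\<^sub>\<mu>\<^sup>1\<^sup>,\<^sup>2(ker D\<^sub>\<alpha>)\<close>.\<close>

definition MC ::
    "('k::field, 'm::ab_group_add) graded \<Rightarrow> ('k, 'w::ab_group_add) graded
     \<Rightarrow> ('m \<times> 'w) cochain \<Rightarrow> ('m \<times> 'w) cochain \<Rightarrow> bool" where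
  "MC M W \<mu> \<alpha> \<longleftrightarrow>
     (let V = dsum M W; Bker = bracket V \<mu> ` {\<psi> \<in> C M W 0 2. bracket V \<alpha> \<psi> = 0}
      in bracket V \<alpha> \<alpha> +o Bker = 0 +o Bker)"

definition MC_cochains ::
    "('k::field, 'm::ab_group_add) graded \<Rightarrow> ('k, 'w::ab_group_add) graded
     \<Rightarrow> ('m \<times> 'w) cochain \<Rightarrow> ('m \<times> 'w) cochain \<Rightarrow> ('m \<times> 'w) cochain set" where
  "MC_cochains M W \<delta> \<mu> =
     {l \<in> Z M W \<mu> 1 1. odd_cochain (dsum M W) l \<and> MC M W \<mu> (\<delta> + l)}"

definition MC_classes ::
    "('k::field, 'm::ab_group_add) graded \<Rightarrow> ('k, 'w::ab_group_add) graded
     \<Rightarrow> ('m \<times> 'w) cochain \<Rightarrow> ('m \<times> 'w) cochain \<Rightarrow> ('m \<times> 'w) cochain set set" where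
  "MC_classes M W \<delta> \<mu> = (\<lambda>l. l +o B M W \<mu> 1 1) ` MC_cochains M W \<delta> \<mu>"

text \<open>The map \<open>\<phi>\<close>-class to \<open>[\<alpha>, \<phi>]\<close>-class from \<open>H\<^sub>\<mu>\<^sup>k\<^sup>,\<^sup>l\<close> to \<open>H\<^sub>\<mu>\<^sup>k\<^sup>,\<^sup>l\<^sup>+\<^sup>1\<close>;
  as usual for quotients, the union is over equal sets.\<close>

definition Dbar ::
    "('k::field, 'm::ab_group_add) graded \<Rightarrow> ('k, 'w::ab_group_add) graded
     \<Rightarrow> ('m \<times> 'w) cochain \<Rightarrow> ('m \<times> 'w) cochain \<Rightarrow> nat \<Rightarrow> nat
     \<Rightarrow> ('m \<times> 'w) cochain set \<Rightarrow> ('m \<times> 'w) cochain set" where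
  "Dbar M W \<mu> \<alpha> k l X = (\<Union>\<phi>\<in>X. bracket (dsum M W) \<alpha> \<phi> +o B M W \<mu> k (Suc l))"

text \<open>Odd cochains \<open>\<tau>\<close> representing elements of \<open>H\<^bsub>\<mu>,\<alpha>\<^esub>\<^sup>0\<^sup>,\<^sup>2\<close>, and the class they represent, a
  coset in \<open>H\<^sub>\<mu>\<^sup>0\<^sup>,\<^sup>2\<close>.\<close>

definition Z02 ::
    "('k::field, 'm::ab_group_add) graded \<Rightarrow> ('k, 'w::ab_group_add) graded
     \<Rightarrow> ('m \<times> 'w) cochain \<Rightarrow> ('m \<times> 'w) cochain \<Rightarrow> ('m \<times> 'w) cochain set" where
  "Z02 M W \<mu> \<alpha> = {\<tau> \<in> Z M W \<mu> 0 2. odd_cochain (dsum M W) \<tau> \<and>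
     Dbar M W \<mu> \<alpha> 0 2 (\<tau> +o B M W \<mu> 0 2) = 0 +o B M W \<mu> 0 3}"

definition cls02 ::
    "('k::field, 'm::ab_group_add) graded \<Rightarrow> ('k, 'w::ab_group_add) graded
     \<Rightarrow> ('m \<times> 'w) cochain \<Rightarrow> ('m \<times> 'w) cochain \<Rightarrow> ('m \<times> 'w) cochain
     \<Rightarrow> ('m \<times> 'w) cochain set set" where
  "cls02 M W \<mu> \<alpha> \<tau> = (\<tau> +o B M W \<mu> 0 2) +o (Dbar M W \<mu> \<alpha> 0 1 ` H M W \<mu> 0 1)"

definition H02 ::
    "('k::field, 'm::ab_group_add) graded \<Rightarrow> ('k, 'w::ab_group_add) graded
     \<Rightarrow> ('m \<times> 'w) cochain \<Rightarrow> ('m \<times> 'w) cochain \<Rightarrow> ('m \<times> 'w) cochain set set set" where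
  "H02 M W \<mu> \<alpha> = cls02 M W \<mu> \<alpha> ` Z02 M W \<mu> \<alpha>"

section \<open>Groups and their actions\<close>

definition GL :: "('k::field, 'u::ab_group_add) graded \<Rightarrow> ('u \<Rightarrow> 'u) set" where
  "GL U = {f. Vector_Spaces.linear (smul U) (smul U) f \<and> bij f \<and>
     f ` even_part U \<subseteq> even_part U \<and> f ` odd_part U \<subseteq> odd_part U}"

definition pull :: "('u \<Rightarrow> 'u) \<Rightarrow> 'u cochain \<Rightarrow> 'u cochain" where
  "pull g \<phi> = (\<lambda>vs. inv g (\<phi> (map g vs)))"

definition G_MW ::
    "('k::field, 'm::ab_group_add) graded \<Rightarrow> ('k, 'w::ab_group_add) graded
     \<Rightarrow> ('m \<times> 'w \<Rightarrow> 'm \<times> 'w) set" where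
  "G_MW M W = {map_prod f g | f g. f \<in> GL M \<and> g \<in> GL W}"

definition G_dm ::
    "('k::field, 'm::ab_group_add) graded \<Rightarrow> ('k, 'w::ab_group_add) graded
     \<Rightarrow> ('m \<times> 'w) cochain \<Rightarrow> ('m \<times> 'w) cochain \<Rightarrow> ('m \<times> 'w \<Rightarrow> 'm \<times> 'w) set" where
  "G_dm M W \<delta> \<mu> = {g \<in> G_MW M W. pull g \<delta> = \<delta> \<and> pull g \<mu> = \<mu>}"

definition rest ::
    "('k::field, 'm::ab_group_add) graded \<Rightarrow> ('k, 'w::ab_group_add) graded
     \<Rightarrow> ('m \<times> 'w) cochain set" where
  "rest M W = {\<beta> \<in> C M W 0 1. even_cochain (dsum M W) \<beta>}"

text \<open>As \<open>\<beta> \<in> C\<^sup>0\<^sup>,\<^sup>1\<close> is extended by zero to \<open>M\<close>, this is \<open>(m, w) \<mapsto> (m + \<beta>(w), w)\<close>.\<close>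

definition expc :: "'u::ab_group_add cochain \<Rightarrow> 'u \<Rightarrow> 'u" where
  "expc \<beta> v = v + \<beta> [v]"

definition G_gen ::
    "('k::field, 'm::ab_group_add) graded \<Rightarrow> ('k, 'w::ab_group_add) graded
     \<Rightarrow> ('m \<times> 'w) cochain \<Rightarrow> ('m \<times> 'w) cochain \<Rightarrow> ('m \<times> 'w \<Rightarrow> 'm \<times> 'w) set" where
  "G_gen M W \<delta> \<mu> = {g \<circ> expc \<beta> | g \<beta>. g \<in> G_dm M W \<delta> \<mu> \<and> \<beta> \<in> rest M W}"

definition gen_equiv ::
    "('k::field, 'm::ab_group_add) graded \<Rightarrow> ('k, 'w::ab_group_add) graded
     \<Rightarrow> ('m \<times> 'w) cochain \<Rightarrow> ('m \<times> 'w) cochain \<Rightarrow> ('m \<times> 'w) cochain \<Rightarrow> ('m \<times> 'w) cochain \<Rightarrow> bool"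
  where
  "gen_equiv M W \<delta> \<mu> d d' \<longleftrightarrow> (\<exists>h\<in>G_gen M W \<delta> \<mu>. d' = pull h d)"

definition actH ::
    "('k::field, 'm::ab_group_add) graded \<Rightarrow> ('k, 'w::ab_group_add) graded
     \<Rightarrow> ('m \<times> 'w) cochain \<Rightarrow> nat \<Rightarrow> nat \<Rightarrow> ('m \<times> 'w \<Rightarrow> 'm \<times> 'w)
     \<Rightarrow> ('m \<times> 'w) cochain set \<Rightarrow> ('m \<times> 'w) cochain set" where
  "actH M W \<mu> k l g X = (\<Union>\<phi>\<in>X. pull g \<phi> +o B M W \<mu> k l)"

definition MC_orbits ::
    "('k::field, 'm::ab_group_add) graded \<Rightarrow> ('k, 'w::ab_group_add) graded
     \<Rightarrow> ('m \<times> 'w) cochain \<Rightarrow> ('m \<times> 'w) cochain \<Rightarrow> ('m \<times> 'w) cochain set set set" where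
  "MC_orbits M W \<delta> \<mu> =
     (\<lambda>X. (\<lambda>g. actH M W \<mu> 1 1 g X) ` G_dm M W \<delta> \<mu>) ` MC_classes M W \<delta> \<mu>"

definition G_dml ::
    "('k::field, 'm::ab_group_add) graded \<Rightarrow> ('k, 'w::ab_group_add) graded
     \<Rightarrow> ('m \<times> 'w) cochain \<Rightarrow> ('m \<times> 'w) cochain \<Rightarrow> ('m \<times> 'w) cochain
     \<Rightarrow> ('m \<times> 'w \<Rightarrow> 'm \<times> 'w) set" where
  "G_dml M W \<delta> \<mu> l = {g \<circ> expc \<beta> | g \<beta>. g \<in> G_dm M W \<delta> \<mu> \<and> \<beta> \<in> rest M W \<and>
     l = pull g l + bracket (dsum M W) \<mu> \<beta>}"

text \<open>The action of \<open>h = g exp(\<beta>)\<close> on \<open>H\<^bsub>\<mu>,\<delta>+\<lambda>\<^esub>\<^sup>0\<^sup>,\<^sup>2\<close>. Here \<open>g\<close> and \<open>\<beta>\<close> are determined by \<open>h\<close>,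
  and the union is over the odd representatives \<open>\<tau>\<close> of the class \<open>T\<close>, all giving the same set.\<close>

definition act02 ::
    "('k::field, 'm::ab_group_add) graded \<Rightarrow> ('k, 'w::ab_group_add) graded
     \<Rightarrow> ('m \<times> 'w) cochain \<Rightarrow> ('m \<times> 'w) cochain \<Rightarrow> ('m \<times> 'w) cochain \<Rightarrow> ('m \<times> 'w) cochain
     \<Rightarrow> ('m \<times> 'w \<Rightarrow> 'm \<times> 'w) \<Rightarrow> ('m \<times> 'w) cochain set set \<Rightarrow> ('m \<times> 'w) cochain set set" where
  "act02 M W \<delta> \<mu> l \<psi> h T = (let V = dsum M W in
     \<Union>{cls02 M W \<mu> (\<delta> + l)
          (pull g \<psi> - \<psi> + pull g \<tau>
           + bracket V (\<delta> + l - scale_cochain V (1/2) (bracket V \<mu> \<beta>)) \<beta>)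
        | g \<beta> \<tau>. g \<in> G_dm M W \<delta> \<mu> \<and> \<beta> \<in> rest M W \<and> h = g \<circ> expc \<beta> \<and>
                 \<tau> \<in> Z02 M W \<mu> (\<delta> + l) \<and> cls02 M W \<mu> (\<delta> + l) \<tau> = T})"

definition orbits02 ::
    "('k::field, 'm::ab_group_add) graded \<Rightarrow> ('k, 'w::ab_group_add) graded
     \<Rightarrow> ('m \<times> 'w) cochain \<Rightarrow> ('m \<times> 'w) cochain \<Rightarrow> ('m \<times> 'w) cochain \<Rightarrow> ('m \<times> 'w) cochain
     \<Rightarrow> ('m \<times> 'w) cochain set set set set" where
  "orbits02 M W \<delta> \<mu> l \<psi> =
     (\<lambda>T. (\<lambda>h. act02 M W \<delta> \<mu> l \<psi> h T) ` G_dml M W \<delta> \<mu> l) ` H02 M W \<mu> (\<delta> + l)"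

end

theory Submission
  imports Defs
begin

text \<open>Write an extension as \<open>d = \<delta> + \<mu> + \<lambda> + \<psi>\<close>. Grading cochains by the number of letters from
  \<open>M\<close> they consume splits \<open>[d, d] = 0\<close> into the three equations for \<open>\<lambda>\<close> and \<open>\<psi>\<close>, the two
  involving \<open>\<psi>\<close> being solvable for \<open>\<psi>\<close> exactly when \<open>\<lambda>\<close> satisfies the Maurer-Cartan equation. An element
  \<open>h = g exp(\<beta>)\<close> of the group changes \<open>\<lambda>\<close> to \<open>g\<^sup>*(\<lambda>) + [\<mu>, \<beta>]\<close> and \<open>\<psi>\<close> to
  \<open>g\<^sup>*(\<psi>) + [\<delta> + g\<^sup>*(\<lambda>) + [\<mu>, \<beta>]/2, \<beta>]\<close>. Hence the class of \<open>\<lambda>\<close> moves within its orbit under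
  \<open>G\<^bsub>\<delta>,\<mu>\<^esub>\<close>, and once \<open>\<lambda>\<close> and \<open>\<psi>\<close> are fixed, the action on \<open>\<tau>\<close>-classes is the pull-back of
  \<open>\<delta> + \<mu> + \<lambda> + \<psi> + \<tau>\<close> by the stabilizer of \<open>\<lambda>\<close>: the orbits are the traces of the
  equivalence classes of extensions. Coboundaries \<open>[\<delta> + \<lambda>, \<beta>]\<close> with \<open>[\<mu>, \<beta>] = 0\<close> are themselves
  realized by \<open>exp(\<beta>)\<close>.\<close>

section \<open>Multilinear cochains and parity\<close>

text \<open>No Jacobi identity for the bracket is proved. Naturality takes its place: the bracket
  commutes with pull-back along even automorphisms, so \<open>[d, d] = 0\<close> survives every
  change of coordinates, and the equations for a transformed \<open>\<lambda>\<close> or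
  \<open>\<psi>\<close> follow from this invariance and the separation of weights. Degrees are
  handled the same way: signs are powers of the involution \<open>pinv\<close>, itself an even
  automorphism, so the parity of a cochain is read off from a special pull-back. The obstacle is a
  mismatch of parities. Coboundaries and the witnesses of the Maurer-Cartan condition range over
  cochains of any degree, whereas the group provides only even \<open>\<beta>\<close> and an
  extension needs an odd \<open>\<psi>\<close>. Passing to the even or odd part of a witness repairs
  this, at the price of dividing by 2. No exponential series is summed: \<open>\<beta>\<close> maps
  \<open>W\<close> to \<open>M\<close> and kills \<open>M\<close>, so \<open>exp(\<beta>)\<close> is
  the identity plus \<open>\<beta>\<close>. The constant 1/2 records that both surviving terms of
  \<open>[[\<mu>, \<beta>], \<beta>]\<close> equal
  \<open>\<mu>(\<beta> x, \<beta> y)\<close>.\<close>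

lemma linear_iff_add_scale:
  assumes "vector_space s" "vector_space t"
  shows "Vector_Spaces.linear s t f \<longleftrightarrow> (\<forall>x y. f (x + y) = f x + f y) \<and> (\<forall>c x. f (s c x) = t c (f x))"
  using assms by (simp add: linear_iff_module_hom module_hom_iff module_iff_vector_space)

text \<open>The codomain is an arbitrary abelian group, so that a single component of a cochain,
  such as its \<open>W\<close>-part, is covered as well.\<close>

definition slot_additive :: "('u::ab_group_add list \<Rightarrow> 'a::ab_group_add) \<Rightarrow> bool" where
  "slot_additive F \<longleftrightarrow> (\<forall>xs a b ys. F (xs @ (a + b) # ys) = F (xs @ a # ys) + F (xs @ b # ys))"

lemma slot_additiveD: "slot_additive F \<Longrightarrow> F (xs @ (a + b) # ys) = F (xs @ a # ys) + F (xs @ b # ys)"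
  by (simp add: slot_additive_def)

text \<open>The prefix \<open>pre\<close> already consists of generators. The next letter is split
  into two generators, each of which joins the prefix, so the induction ends at lists over
  \<open>S\<close>. Asking for sums of two elements avoids spans: \<open>S\<close> will be the
  homogeneous vectors, or the letters from \<open>M\<close> and \<open>W\<close>.\<close>

lemma slot_additive_eqI:
  assumes F: "slot_additive F" and G: "slot_additive G"
    and gen: "\<And>v. \<exists>a\<in>S. \<exists>b\<in>S. v = a + b"
    and eq: "\<And>vs. set vs \<subseteq> S \<Longrightarrow> F vs = G vs"
  shows "F = G"
proof -
  have "set pre \<subseteq> S \<Longrightarrow> F (pre @ vs) = G (pre @ vs)" for pre vs
  proof (induction vs arbitrary: pre)
    case Nil
    then show ?case by (simp add: eq)
  next
    case (Cons v vs)
    obtain a b where ab: "a \<in> S" "b \<in> S" "v = a + b"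
      using gen by blast
    have "F (pre @ c # vs) = G (pre @ c # vs)" if "c \<in> S" for c
      using Cons.IH[of "pre @ [c]"] Cons.prems that by simp
    then show ?case
      using ab by (simp add: slot_additiveD[OF F] slot_additiveD[OF G])
  qed
  from this[of "[]"] show ?thesis by auto
qed

locale gspace =
  fixes U :: "('k::field, 'u::ab_group_add) graded"
  assumes graded: "graded_space U" and char: "CHAR('k) \<noteq> 2"
begin

abbreviation sm where "sm \<equiv> smul U"

sublocale vs: vector_space "smul U"
  using graded by (simp add: graded_space_def)

lemma two_nonzero: "(2::'k) \<noteq> 0"
proof
  assume "(2::'k) = 0"
  then have "of_nat 2 = (0::'k)" by simp
  then have "CHAR('k) dvd 2" by (simp only: of_nat_eq_0_iff_char_dvd)
  then have "CHAR('k) \<le> 2" and "CHAR('k) \<noteq> 0"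
    using dvd_imp_le[of "CHAR('k)" 2] by (simp, intro notI, simp)
  moreover have "CHAR('k) \<noteq> 1" by simp
  ultimately show False using char by linarith
qed

lemma half_add_half: "sm (1/2) x + sm (1/2) x = x"
proof -
  have "(1/2 + 1/2 :: 'k) = 1" using two_nonzero by (simp add: field_simps)
  then show ?thesis by (metis vs.scale_left_distrib vs.scale_one)
qed

lemma half_double: "sm (1/2) (x + x) = x"
  by (simp add: vs.scale_right_distrib half_add_half)

lemma double_eq_zero: "x + x = 0 \<Longrightarrow> x = (0::'u)"
  by (subst half_double[symmetric], simp only: vs.scale_zero_right)

lemma double_inj: "x + x = y + y \<Longrightarrow> x = (y::'u)"
  by (subst (1 2) half_double[symmetric], simp only:)

lemma double_inj_fun: "f + f = g + g \<Longrightarrow> f = (g :: 'x \<Rightarrow> 'u)"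
  by (auto simp: fun_eq_iff intro: double_inj)

lemma multilinear_iff:
  "multilinear U \<phi> \<longleftrightarrow> slot_additive \<phi> \<and> (\<forall>xs c v ys. \<phi> (xs @ sm c v # ys) = sm c (\<phi> (xs @ v # ys)))"
  by (auto simp: multilinear_def slot_additive_def linear_iff_add_scale[OF vs.vector_space_axioms vs.vector_space_axioms])

lemma ml_additive: "multilinear U \<phi> \<Longrightarrow> slot_additive \<phi>"
  by (simp add: multilinear_iff)

lemma ml_add: "multilinear U \<phi> \<Longrightarrow> \<phi> (xs @ (a + b) # ys) = \<phi> (xs @ a # ys) + \<phi> (xs @ b # ys)"
  by (simp add: multilinear_iff slot_additive_def)

lemma ml_scale: "multilinear U \<phi> \<Longrightarrow> \<phi> (xs @ sm c v # ys) = sm c (\<phi> (xs @ v # ys))"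
  by (simp add: multilinear_iff)

lemma ml_zero: "multilinear U \<phi> \<Longrightarrow> \<phi> (xs @ 0 # ys) = 0"
  using ml_scale[of \<phi> xs 0 0 ys] by simp

lemma ml_plus: "multilinear U \<phi> \<Longrightarrow> multilinear U \<chi> \<Longrightarrow> multilinear U (\<phi> + \<chi>)"
  by (simp add: multilinear_iff slot_additive_def algebra_simps vs.scale_right_distrib)

lemma ml_uminus: "multilinear U \<phi> \<Longrightarrow> multilinear U (- \<phi>)"
  by (simp add: multilinear_iff slot_additive_def algebra_simps fun_Compl_def)

lemma ml_zero_cochain: "multilinear U 0"
  by (simp add: multilinear_iff slot_additive_def)

lemma ml_scale_cochain: "multilinear U \<phi> \<Longrightarrow> multilinear U (scale_cochain U c \<phi>)"
  by (simp add: multilinear_iff slot_additive_def scale_cochain_def vs.scale_right_distrib vs.scale_left_commute)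

lemma HomI: "multilinear U \<phi> \<Longrightarrow> (\<And>vs. length vs \<noteq> n \<Longrightarrow> \<phi> vs = 0) \<Longrightarrow> \<phi> \<in> Hom U n"
  by (simp add: Hom_def)

lemma Hom_ml: "\<phi> \<in> Hom U n \<Longrightarrow> multilinear U \<phi>"
  by (simp add: Hom_def)

lemma Hom_length: "\<phi> \<in> Hom U n \<Longrightarrow> length vs \<noteq> n \<Longrightarrow> \<phi> vs = 0"
  by (simp add: Hom_def)

lemma Hom_plus: "\<phi> \<in> Hom U n \<Longrightarrow> \<chi> \<in> Hom U n \<Longrightarrow> \<phi> + \<chi> \<in> Hom U n"
  by (simp add: Hom_def ml_plus)

lemma Hom_uminus: "\<phi> \<in> Hom U n \<Longrightarrow> - \<phi> \<in> Hom U n"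
  by (auto simp: Hom_def ml_uminus)

lemma Hom_diff: "\<phi> \<in> Hom U n \<Longrightarrow> \<chi> \<in> Hom U n \<Longrightarrow> \<phi> - \<chi> \<in> Hom U n"
  using Hom_plus[of \<phi> n "- \<chi>"] by (simp add: Hom_uminus)

lemma Hom_zero: "0 \<in> Hom U n"
  by (simp add: Hom_def ml_zero_cochain)

lemma Hom_scale: "\<phi> \<in> Hom U n \<Longrightarrow> scale_cochain U c \<phi> \<in> Hom U n"
  by (auto simp: Hom_def ml_scale_cochain) (simp add: scale_cochain_def)

section \<open>The parity involution and homogeneous vectors\<close>

lemma parity_parts:
  "x \<in> even_part U \<Longrightarrow> y \<in> even_part U \<Longrightarrow> x + y \<in> even_part U"
  "x \<in> even_part U \<Longrightarrow> sm c x \<in> even_part U" "0 \<in> even_part U"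
  "x \<in> odd_part U \<Longrightarrow> y \<in> odd_part U \<Longrightarrow> x + y \<in> odd_part U"
  "x \<in> odd_part U \<Longrightarrow> sm c x \<in> odd_part U" "0 \<in> odd_part U"
  "x \<in> even_part U \<Longrightarrow> y \<in> even_part U \<Longrightarrow> x - y \<in> even_part U"
  "x \<in> odd_part U \<Longrightarrow> y \<in> odd_part U \<Longrightarrow> x - y \<in> odd_part U"
  using graded unfolding graded_space_def
  by (auto intro: vs.subspace_add vs.subspace_scale vs.subspace_0 vs.subspace_diff)

lemma parity_decomp: "\<exists>a\<in>even_part U. \<exists>b\<in>odd_part U. v = a + b"
proof -
  have "v \<in> even_part U + odd_part U" using graded by (simp add: graded_space_def)
  then show ?thesis by (elim set_plus_elim) blast
qed

lemma parity_disjoint: "x \<in> even_part U \<Longrightarrow> x \<in> odd_part U \<Longrightarrow> x = 0"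
  using graded by (auto simp: graded_space_def)

lemma pinv_eq: "a \<in> even_part U \<Longrightarrow> b \<in> odd_part U \<Longrightarrow> pinv U (a + b) = a - b"
proof -
  assume ab: "a \<in> even_part U" "b \<in> odd_part U"
  have "a' = a \<and> b' = b" if "a' \<in> even_part U" "b' \<in> odd_part U" "a + b = a' + b'" for a' b'
  proof -
    have "a - a' = b' - b" using that by (simp add: algebra_simps)
    then have "a - a' = 0"
      using parity_disjoint[of "a - a'"] parity_parts(7,8) ab that by metis
    then show ?thesis using that by simp
  qed
  then show ?thesis
    unfolding pinv_def using ab by (intro the_equality) blast+
qed

lemma pinv_add: "pinv U (x + y) = pinv U x + pinv U y"
proof -
  obtain a b a' b' where *: "a \<in> even_part U" "b \<in> odd_part U" "x = a + b"
     "a' \<in> even_part U" "b' \<in> odd_part U" "y = a' + b'"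
    using parity_decomp by metis
  have "pinv U (x + y) = pinv U ((a + a') + (b + b'))" using * by (simp add: algebra_simps)
  also have "\<dots> = (a + a') - (b + b')" using * by (intro pinv_eq parity_parts)
  finally show ?thesis using * by (simp add: pinv_eq algebra_simps)
qed

lemma pinv_scale: "pinv U (sm c x) = sm c (pinv U x)"
proof -
  obtain a b where *: "a \<in> even_part U" "b \<in> odd_part U" "x = a + b"
    using parity_decomp by metis
  have "pinv U (sm c x) = pinv U (sm c a + sm c b)" using * by (simp add: vs.scale_right_distrib)
  also have "\<dots> = sm c a - sm c b" using * by (intro pinv_eq parity_parts)
  finally show ?thesis using * by (simp add: pinv_eq vs.scale_right_diff_distrib)
qed

lemma pinv_even: "a \<in> even_part U \<Longrightarrow> pinv U a = a"
  using pinv_eq[of a 0] parity_parts by simp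

lemma pinv_odd: "b \<in> odd_part U \<Longrightarrow> pinv U b = - b"
  using pinv_eq[of 0 b] parity_parts by simp

lemma pinv_0 [simp]: "pinv U 0 = 0"
  by (simp add: pinv_even parity_parts)

lemma pinv_neg: "pinv U (- x) = - pinv U x"
  using pinv_add[of x "-x"] by (simp add: eq_neg_iff_add_eq_0 add.commute)

lemma pinv_pinv [simp]: "pinv U (pinv U v) = v"
proof -
  obtain a b where *: "a \<in> even_part U" "b \<in> odd_part U" "v = a + b"
    using parity_decomp by metis
  then show ?thesis
    by (simp add: pinv_eq pinv_add diff_conv_add_uminus pinv_neg pinv_even pinv_odd del: add_uminus_conv_diff)
qed

text \<open>The two parts are the eigenspaces of \<open>pinv\<close>: if
  \<open>a - b = a + b\<close>, the double of \<open>b\<close> vanishes, and 2 is invertible.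
  Membership in a part thus becomes an equation.\<close>

lemma even_iff_pinv: "v \<in> even_part U \<longleftrightarrow> pinv U v = v"
proof
  assume v: "pinv U v = v"
  obtain a b where *: "a \<in> even_part U" "b \<in> odd_part U" "v = a + b"
    using parity_decomp by metis
  have "b + b = 0"
    using v * by (simp add: pinv_eq algebra_simps)
  then show "v \<in> even_part U" using * double_eq_zero[of b] by simp
qed (rule pinv_even)

lemma odd_iff_pinv: "v \<in> odd_part U \<longleftrightarrow> pinv U v = - v"
proof
  assume v: "pinv U v = - v"
  obtain a b where *: "a \<in> even_part U" "b \<in> odd_part U" "v = a + b"
    using parity_decomp by metis
  have "a + a = 0"
    using v * by (simp add: pinv_eq algebra_simps eq_neg_iff_add_eq_0)
  then show "v \<in> odd_part U" using * double_eq_zero[of a] by simp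
qed (rule pinv_odd)

lemma part_iff_pinv: "v \<in> part U q \<longleftrightarrow> pinv U v = sm ((-1) ^ q) v"
  by (cases "even q") (auto simp: part_def even_iff_pinv odd_iff_pinv)

lemma bij_pinv: "bij (pinv U)"
  by (rule o_bij[of "pinv U"]) (simp_all add: fun_eq_iff)

lemma inv_pinv: "inv (pinv U) = pinv U"
  by (rule inv_equality) simp_all

text \<open>Preserving both parts amounts to commuting with \<open>pinv\<close>. The definition of
  \<open>GL\<close> asks only for inclusions; the commutation relation passes to the inverse and so
  yields the inclusions for \<open>inv g\<close>.\<close>

lemma GL_iff:
  "f \<in> GL U \<longleftrightarrow> Vector_Spaces.linear sm sm f \<and> bij f \<and> (\<forall>v. f (pinv U v) = pinv U (f v))"
proof -
  have "f ` even_part U \<subseteq> even_part U \<and> f ` odd_part U \<subseteq> odd_part U \<longleftrightarrow>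
    (\<forall>v. f (pinv U v) = pinv U (f v))" if lin: "Vector_Spaces.linear sm sm f"
  proof -
    have add: "f (x + y) = f x + f y" and scale: "f (sm c x) = sm c (f x)" for x y c
      using lin by (simp_all add: linear_iff_add_scale vs.vector_space_axioms)
    have neg: "f (- x) = - f x" for x using scale[of "-1" x] by simp
    show ?thesis
    proof safe
      fix v
      assume *: "f ` even_part U \<subseteq> even_part U" "f ` odd_part U \<subseteq> odd_part U"
      obtain a b where ab: "a \<in> even_part U" "b \<in> odd_part U" "v = a + b"
        using parity_decomp by metis
      with * have "f a \<in> even_part U" "f b \<in> odd_part U" by auto
      then show "f (pinv U v) = pinv U (f v)"
        using ab neg[of b] add[of a "- b"] by (simp add: pinv_eq add)
    next
      fix x
      assume *: "\<forall>v. f (pinv U v) = pinv U (f v)"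
      show "x \<in> even_part U \<Longrightarrow> f x \<in> even_part U"
        using * by (metis even_iff_pinv)
      show "x \<in> odd_part U \<Longrightarrow> f x \<in> odd_part U"
        using * by (metis odd_iff_pinv neg)
    qed
  qed
  then show ?thesis unfolding GL_def by blast
qed

lemma GL_bij: "g \<in> GL U \<Longrightarrow> bij g"
  by (simp add: GL_iff)

lemma GL_add: "g \<in> GL U \<Longrightarrow> g (x + y) = g x + g y"
  by (simp add: GL_iff linear_iff_add_scale vs.vector_space_axioms)

lemma GL_scale: "g \<in> GL U \<Longrightarrow> g (sm c x) = sm c (g x)"
  by (simp add: GL_iff linear_iff_add_scale vs.vector_space_axioms)

lemma GL_pinv: "g \<in> GL U \<Longrightarrow> g (pinv U x) = pinv U (g x)"
  by (simp add: GL_iff)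

lemma GL_inv: "g \<in> GL U \<Longrightarrow> inv g \<in> GL U"
proof -
  assume g: "g \<in> GL U"
  have "inv g (x + y) = inv g x + inv g y" "inv g (sm c x) = sm c (inv g x)"
    "inv g (pinv U x) = pinv U (inv g x)" for x y c
    by (metis GL_bij[OF g] bij_inv_eq_iff GL_add[OF g] GL_scale[OF g] GL_pinv[OF g])+
  then show ?thesis
    using g by (simp add: GL_iff bij_imp_bij_inv linear_iff_add_scale vs.vector_space_axioms)
qed

lemma GL_comp: "g \<in> GL U \<Longrightarrow> h \<in> GL U \<Longrightarrow> g \<circ> h \<in> GL U"
  by (simp add: GL_iff bij_comp linear_iff_add_scale vs.vector_space_axioms)

lemma GL_id: "id \<in> GL U"
  by (simp add: GL_iff linear_iff_add_scale vs.vector_space_axioms)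

lemma GL_zero: "g \<in> GL U \<Longrightarrow> g 0 = 0"
  using GL_scale[of g 0 0] by simp

lemma GL_neg: "g \<in> GL U \<Longrightarrow> g (- x) = - g x"
  using GL_scale[of g "-1" x] by simp

lemma pinv_GL: "pinv U \<in> GL U"
  by (simp add: GL_iff linear_iff_add_scale vs.vector_space_axioms pinv_add pinv_scale bij_pinv)

section \<open>Pull-back of cochains and the parity operator\<close>

lemma pull_ml:
  assumes "g \<in> GL U" "multilinear U \<phi>"
  shows "multilinear U (pull g \<phi>)"
  using assms GL_inv[OF assms(1)]
  by (simp add: pull_def multilinear_iff slot_additive_def GL_add GL_scale)

lemma pull_Hom: "g \<in> GL U \<Longrightarrow> \<phi> \<in> Hom U n \<Longrightarrow> pull g \<phi> \<in> Hom U n"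
  by (simp add: Hom_def pull_ml) (simp add: pull_def GL_zero GL_inv)

lemma pull_plus: "g \<in> GL U \<Longrightarrow> pull g (\<phi> + \<chi>) = pull g \<phi> + pull g \<chi>"
  by (simp add: pull_def fun_eq_iff GL_add GL_inv)

lemma pull_uminus: "g \<in> GL U \<Longrightarrow> pull g (- \<phi>) = - pull g \<phi>"
  by (simp add: pull_def fun_eq_iff GL_neg GL_inv fun_Compl_def)

lemma pull_diff: "g \<in> GL U \<Longrightarrow> pull g (\<phi> - \<chi>) = pull g \<phi> - pull g \<chi>"
  by (metis pull_plus diff_add_cancel add_diff_cancel)

lemma pull_scale: "g \<in> GL U \<Longrightarrow> pull g (scale_cochain U c \<phi>) = scale_cochain U c (pull g \<phi>)"
  by (simp add: pull_def fun_eq_iff GL_scale GL_inv scale_cochain_def)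

lemma pull_zero: "g \<in> GL U \<Longrightarrow> pull g 0 = 0"
  by (simp add: pull_def fun_eq_iff GL_zero GL_inv)

text \<open>Pull-back is a right action, so \<open>g \<circ> expc \<beta>\<close> acts by
  \<open>g\<close> first and by the exponential second.\<close>

lemma pull_pull: "bij g \<Longrightarrow> bij h \<Longrightarrow> pull h (pull g \<phi>) = pull (g \<circ> h) \<phi>"
  by (simp add: pull_def fun_eq_iff o_inv_distrib)

lemma pull_id: "pull id \<phi> = \<phi>"
  by (simp add: pull_def fun_eq_iff)

lemma pull_inv_pull: "bij g \<Longrightarrow> pull (inv g) (pull g \<phi>) = \<phi>"
  by (simp add: pull_pull bij_imp_bij_inv bij_is_surj[THEN surj_iff[THEN iffD1]] pull_id)

text \<open>On a multilinear cochain of degree \<open>p\<close> this is multiplication by (-1)^p. As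
  \<open>pinv\<close> lies in \<open>GL U\<close>, its linearity and its compatibility with arities
  are instances of the facts on pull-backs.\<close>

definition parity :: "'u cochain \<Rightarrow> 'u cochain" where
  "parity = pull (pinv U)"

lemma parity_apply: "parity \<phi> vs = pinv U (\<phi> (map (pinv U) vs))"
  by (simp add: parity_def pull_def inv_pinv)

lemma parity_parity [simp]: "parity (parity \<phi>) = \<phi>"
  by (simp add: parity_apply fun_eq_iff o_def)

lemma parity_pull: "g \<in> GL U \<Longrightarrow> parity (pull g \<phi>) = pull g (parity \<phi>)"
  by (simp add: parity_apply pull_def fun_eq_iff o_def GL_pinv GL_inv)

lemmas parity_plus = pull_plus[OF pinv_GL, folded parity_def]
  and parity_uminus = pull_uminus[OF pinv_GL, folded parity_def]
  and parity_diff = pull_diff[OF pinv_GL, folded parity_def]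
  and parity_zero = pull_zero[OF pinv_GL, folded parity_def]
  and parity_scale = pull_scale[OF pinv_GL, folded parity_def]
  and parity_ml = pull_ml[OF pinv_GL, folded parity_def]
  and parity_Hom = pull_Hom[OF pinv_GL, folded parity_def]

text \<open>Applying \<open>pinv\<close> to all arguments multiplies the value by the product of
  their signs, and the degree condition puts the value into a definite eigenspace of
  \<open>pinv\<close>. On homogeneous arguments the two sides therefore agree; additivity in each
  slot carries the equation to all arguments.\<close>

lemma homogeneous_iff_parity:
  assumes ml: "multilinear U \<phi>"
  shows "homogeneous U p \<phi> \<longleftrightarrow> parity \<phi> = scale_cochain U ((-1) ^ p) \<phi>"
proof -
  have sgn: "sm ((-1) ^ q) (sm ((-1) ^ q) x) = x" for q x
    by (cases "even q") simp_all
  have sgn_inj: "sm ((-1) ^ q) x = sm ((-1) ^ q) y \<longleftrightarrow> x = y" for q x y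
    using sgn by metis
  \<comment> \<open>The letters of \<open>pre\<close> stay untouched, so the induction takes the
    sign out of one slot at a time.\<close>
  have signs: "\<phi> (pre @ map (pinv U) vs) = sm ((-1) ^ sum_list ps) (\<phi> (pre @ vs))"
    if "list_all2 (\<lambda>v q. v \<in> part U q) vs ps" for pre vs ps
    using that
  proof (induction arbitrary: pre rule: list_all2_induct)
    case (Cons v vs q ps)
    have "\<phi> (pre @ map (pinv U) (v # vs)) = sm ((-1) ^ q) (\<phi> (pre @ v # map (pinv U) vs))"
      using Cons.hyps by (simp add: part_iff_pinv ml_scale[OF ml])
    also have "\<phi> (pre @ v # map (pinv U) vs) = sm ((-1) ^ sum_list ps) (\<phi> (pre @ v # vs))"
      using Cons.IH[of "pre @ [v]"] by simp
    finally show ?case by (simp add: power_add)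
  qed simp
  have iff: "\<phi> vs \<in> part U (p + sum_list ps) \<longleftrightarrow> parity \<phi> vs = scale_cochain U ((-1) ^ p) \<phi> vs"
    if *: "list_all2 (\<lambda>v q. v \<in> part U q) vs ps" for vs ps
  proof -
    have "\<phi> vs \<in> part U (p + sum_list ps) \<longleftrightarrow> pinv U (\<phi> vs) = sm ((-1) ^ sum_list ps) (sm ((-1) ^ p) (\<phi> vs))"
      by (simp add: part_iff_pinv power_add mult.commute)
    also have "\<dots> \<longleftrightarrow> sm ((-1) ^ sum_list ps) (pinv U (\<phi> vs)) = sm ((-1) ^ p) (\<phi> vs)"
      using sgn by metis
    also have "sm ((-1) ^ sum_list ps) (pinv U (\<phi> vs)) = parity \<phi> vs"
      using signs[OF *, of "[]"] by (simp add: parity_apply pinv_scale)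
    finally show ?thesis by (simp add: scale_cochain_def)
  qed
  show ?thesis
  proof
    assume hom: "homogeneous U p \<phi>"
    show "parity \<phi> = scale_cochain U ((-1) ^ p) \<phi>"
    proof (rule slot_additive_eqI[where S = "even_part U \<union> odd_part U"])
      show "slot_additive (parity \<phi>)" "slot_additive (scale_cochain U ((-1) ^ p) \<phi>)"
        using ml by (simp_all add: ml_additive parity_ml ml_scale_cochain)
      show "\<exists>a\<in>even_part U \<union> odd_part U. \<exists>b\<in>even_part U \<union> odd_part U. v = a + b" for v
        using parity_decomp[of v] by blast
      fix vs assume "set vs \<subseteq> even_part U \<union> odd_part U"
      \<comment> \<open>A degree is picked for every letter; the vector 0 lies in both parts and
        gets degree 0.\<close>
      then have "list_all2 (\<lambda>v q. v \<in> part U q) vs (map (\<lambda>v. if v \<in> even_part U then 0 else 1) vs)"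
        by (auto simp: list.rel_map list.rel_refl_strong part_def intro!: list.rel_refl_strong)
      then show "parity \<phi> vs = scale_cochain U ((-1) ^ p) \<phi> vs"
        using iff hom unfolding homogeneous_def by blast
    qed
  next
    assume "parity \<phi> = scale_cochain U ((-1) ^ p) \<phi>"
    then show "homogeneous U p \<phi>"
      unfolding homogeneous_def using iff by simp
  qed
qed

lemma even_iff_parity: "multilinear U \<phi> \<Longrightarrow> even_cochain U \<phi> \<longleftrightarrow> parity \<phi> = \<phi>"
  by (simp add: homogeneous_iff_parity scale_cochain_def)

lemma odd_iff_parity: "multilinear U \<phi> \<Longrightarrow> odd_cochain U \<phi> \<longleftrightarrow> parity \<phi> = - \<phi>"
  by (simp add: homogeneous_iff_parity scale_cochain_def fun_Compl_def)

section \<open>Algebra of the bracket\<close>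

lemma hpart_eq: "hpart U p \<phi> = scale_cochain U (1/2) (\<phi> + scale_cochain U ((-1) ^ p) (parity \<phi>))"
  by (simp add: hpart_def scale_cochain_def parity_apply fun_eq_iff)

lemma scale_plus: "scale_cochain U c (\<phi> + \<chi>) = scale_cochain U c \<phi> + scale_cochain U c \<chi>"
  by (simp add: scale_cochain_def fun_eq_iff vs.scale_right_distrib)

lemma hpart_plus: "hpart U p (\<phi> + \<chi>) = hpart U p \<phi> + hpart U p \<chi>"
  by (simp add: hpart_eq parity_plus scale_plus algebra_simps)

lemma hpart_ml: "multilinear U \<phi> \<Longrightarrow> multilinear U (hpart U p \<phi>)"
  by (simp add: hpart_eq ml_scale_cochain ml_plus parity_ml)

lemma hpart_Hom: "\<phi> \<in> Hom U n \<Longrightarrow> hpart U p \<phi> \<in> Hom U n"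
  by (simp add: hpart_eq Hom_scale Hom_plus parity_Hom)

lemma hpart_pull: "g \<in> GL U \<Longrightarrow> hpart U p (pull g \<phi>) = pull g (hpart U p \<phi>)"
  by (simp add: hpart_eq pull_plus pull_scale parity_pull)

lemma hpart_of_even:
  assumes "parity \<phi> = \<phi>"
  shows "hpart U 0 \<phi> = \<phi>" "hpart U (Suc 0) \<phi> = 0"
  using assms by (simp_all add: hpart_eq scale_cochain_def fun_eq_iff half_double)

lemma hpart_of_odd:
  assumes "parity \<phi> = - \<phi>"
  shows "hpart U 0 \<phi> = 0" "hpart U (Suc 0) \<phi> = \<phi>"
  using assms by (simp_all add: hpart_eq scale_cochain_def fun_eq_iff half_double fun_Compl_def)

lemma parity_hpart: "parity (hpart U 0 \<phi>) = hpart U 0 \<phi>" "parity (hpart U (Suc 0) \<phi>) = - hpart U (Suc 0) \<phi>"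
  by (simp_all add: hpart_eq parity_scale parity_plus)
     (simp_all add: scale_cochain_def fun_eq_iff vs.scale_right_distrib vs.scale_right_diff_distrib fun_Compl_def)

section \<open>Signed insertion of one cochain into another\<close>

lemma comp_plus_left: "comp_deg U q (\<phi> + \<phi>') \<chi> = comp_deg U q \<phi> \<chi> + comp_deg U q \<phi>' \<chi>"
  by (simp add: comp_deg_def fun_eq_iff sum.distrib)

lemma comp_plus_right:
  "multilinear U \<phi> \<Longrightarrow> comp_deg U q \<phi> (\<chi> + \<chi>') = comp_deg U q \<phi> \<chi> + comp_deg U q \<phi> \<chi>'"
  by (simp add: comp_deg_def fun_eq_iff sum.distrib ml_add)

lemma comp_zero_left: "comp_deg U q 0 \<chi> = 0"
  by (simp add: comp_deg_def fun_eq_iff)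

lemma comp_zero_right: "multilinear U \<phi> \<Longrightarrow> comp_deg U q \<phi> 0 = 0"
  by (simp add: comp_deg_def fun_eq_iff ml_zero)

text \<open>The \<open>inv g\<close> coming out of the inner cochain cancels the \<open>g\<close>
  applied to the arguments of the outer one, and \<open>g\<close> passes through the signs because
  it commutes with \<open>pinv\<close>.\<close>

lemma comp_pull:
  assumes g: "g \<in> GL U"
  shows "comp_deg U q (pull g \<phi>) (pull g \<chi>) = pull g (comp_deg U q \<phi> \<chi>)"
proof
  fix vs
  have pw: "g ((pinv U ^^ q) v) = (pinv U ^^ q) (g v)" for v
    by (induction q) (simp_all add: GL_pinv[OF g])
  have sum: "inv g (sum f I) = (\<Sum>i\<in>I. inv g (f i))" for f and I :: "nat set"
    by (induction I rule: infinite_finite_induct) (simp_all add: GL_add GL_zero GL_inv g)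
  show "comp_deg U q (pull g \<phi>) (pull g \<chi>) vs = pull g (comp_deg U q \<phi> \<chi>) vs"
    by (simp add: comp_deg_def pull_def sum take_map drop_map o_def pw surj_f_inv_f bij_is_surj GL_bij g)
qed

lemma linear_pinv_pow: "(pinv U ^^ q) (x + y) = (pinv U ^^ q) x + (pinv U ^^ q) y"
  "(pinv U ^^ q) (sm c x) = sm c ((pinv U ^^ q) x)"
  by (induction q) (simp_all add: pinv_add pinv_scale)

text \<open>A slot lies before the inserted block, inside it or after it. The ranges of the two sums
  depend only on the length of the list, so additivity and homogeneity can be checked summand by
  summand.\<close>

lemma comp_ml:
  assumes \<phi>: "multilinear U \<phi>" and \<chi>: "multilinear U \<chi>"
  shows "multilinear U (comp_deg U q \<phi> \<chi>)"
proof -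
  define F where "F i l vs = \<phi> (map (pinv U ^^ q) (take i vs) @ \<chi> (take l (drop i vs)) # drop (i + l) vs)" for i l vs
  have F: "F i l (xs @ (a + b) # ys) = F i l (xs @ a # ys) + F i l (xs @ b # ys) \<and>
    F i l (xs @ sm c v # ys) = sm c (F i l (xs @ v # ys))" for i l xs a b c v ys
  proof -
    consider (pre) "length xs < i" | (mid) "i \<le> length xs" "length xs < i + l" | (post) "i + l \<le> length xs"
      by linarith
    then show ?thesis
    proof cases
      case pre
      then obtain j where j: "i - length xs = Suc j" by (metis Suc_diff_Suc)
      then have "(i + l) - length xs = Suc (j + l)" using pre by simp
      with j pre show ?thesis
        by (simp add: F_def linear_pinv_pow ml_add[OF \<phi>] ml_scale[OF \<phi>])
    next
      case mid
      then obtain j where j: "l - (length xs - i) = Suc j" by (metis Suc_diff_Suc add.commute less_diff_conv2)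
      then have "(i + l) - length xs = Suc j" using mid by simp
      with j mid show ?thesis
        by (simp add: F_def ml_add[OF \<phi>] ml_scale[OF \<phi>] ml_add[OF \<chi>] ml_scale[OF \<chi>])
    next
      case post
      let ?pre = "map (pinv U ^^ q) (take i xs) @ \<chi> (take l (drop i xs)) # drop (i + l) xs"
      have "F i l (xs @ v # ys) = \<phi> (?pre @ v # ys)" for v
        using post by (simp add: F_def)
      then show ?thesis
        using ml_add[OF \<phi>, of ?pre] ml_scale[OF \<phi>, of ?pre] by metis
    qed
  qed
  have "comp_deg U q \<phi> \<chi> = (\<lambda>vs. \<Sum>i\<le>length vs. \<Sum>l\<le>length vs - i. F i l vs)"
    by (simp add: comp_deg_def F_def)
  then show ?thesis
    using F by (simp add: multilinear_iff slot_additive_def sum.distrib vs.scale_sum_right vs.scale_right_distrib)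
qed

text \<open>A block of length other than \<open>l\<close> feeds 0 into \<open>\<phi>\<close>. For a
  block of length \<open>l\<close> the outer list has \<open>length vs - l + 1\<close> letters,
  which differs from \<open>k\<close> unless \<open>length vs = n\<close>.\<close>

lemma comp_Hom:
  assumes \<phi>: "\<phi> \<in> Hom U k" and \<chi>: "\<chi> \<in> Hom U l" and n: "k + l = Suc n"
  shows "comp_deg U q \<phi> \<chi> \<in> Hom U n"
proof (rule HomI)
  show "multilinear U (comp_deg U q \<phi> \<chi>)" using comp_ml Hom_ml \<phi> \<chi> by blast
  fix vs :: "'u list" assume len: "length vs \<noteq> n"
  have "\<phi> (map (pinv U ^^ q) (take i vs) @ \<chi> (take j (drop i vs)) # drop (i + j) vs) = 0"
    if "i \<le> length vs" "j \<le> length vs - i" for i j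
  proof (cases "j = l")
    case True
    then show ?thesis
      using that len n by (intro Hom_length[OF \<phi>]) auto
  next
    case False
    then have "\<chi> (take j (drop i vs)) = 0" using that by (intro Hom_length[OF \<chi>]) auto
    then show ?thesis by (simp add: ml_zero[OF Hom_ml[OF \<phi>]])
  qed
  then show "comp_deg U q \<phi> \<chi> vs = 0"
    by (simp add: comp_deg_def)
qed

abbreviation br where "br \<equiv> bracket U"

lemmas bracket_ml_simps = hpart_plus comp_plus_left comp_plus_right hpart_ml scale_plus ml_plus

lemma br_plus_left:
  "multilinear U \<phi> \<Longrightarrow> multilinear U \<phi>' \<Longrightarrow> multilinear U \<chi> \<Longrightarrow> br (\<phi> + \<phi>') \<chi> = br \<phi> \<chi> + br \<phi>' \<chi>"
  by (simp add: bracket_def bracket_ml_simps algebra_simps)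

lemma br_plus_right:
  "multilinear U \<phi> \<Longrightarrow> multilinear U \<chi> \<Longrightarrow> multilinear U \<chi>' \<Longrightarrow> br \<phi> (\<chi> + \<chi>') = br \<phi> \<chi> + br \<phi> \<chi>'"
  by (simp add: bracket_def bracket_ml_simps algebra_simps)

lemma br_zero_right: "multilinear U \<phi> \<Longrightarrow> br \<phi> 0 = 0"
  using br_plus_right[of \<phi> 0 0] by (simp add: ml_zero_cochain)

lemma br_uminus_right: "multilinear U \<phi> \<Longrightarrow> multilinear U \<chi> \<Longrightarrow> br \<phi> (- \<chi>) = - br \<phi> \<chi>"
  using br_plus_right[of \<phi> \<chi> "- \<chi>"] by (simp add: br_zero_right ml_uminus eq_neg_iff_add_eq_0 add.commute)

lemma br_diff_right:
  "multilinear U \<phi> \<Longrightarrow> multilinear U \<chi> \<Longrightarrow> multilinear U \<chi>' \<Longrightarrow> br \<phi> (\<chi> - \<chi>') = br \<phi> \<chi> - br \<phi> \<chi>'"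
  using br_plus_right[of \<phi> \<chi> "- \<chi>'"] by (simp add: br_uminus_right ml_uminus)

lemma br_Hom:
  assumes "\<phi> \<in> Hom U k" "\<chi> \<in> Hom U l" "k + l = Suc n"
  shows "br \<phi> \<chi> \<in> Hom U n"
proof -
  have "comp_deg U q (hpart U p \<phi>) (hpart U q \<chi>) \<in> Hom U n"
    "comp_deg U p (hpart U q \<chi>) (hpart U p \<phi>) \<in> Hom U n" for p q
    by (rule comp_Hom[OF hpart_Hom[OF assms(1)] hpart_Hom[OF assms(2)] assms(3)],
        rule comp_Hom[OF hpart_Hom[OF assms(2)] hpart_Hom[OF assms(1)]])
      (use assms(3) in simp)
  then show ?thesis by (simp add: bracket_def Hom_plus Hom_scale Hom_diff)
qed

text \<open>All ingredients, signs included, commute with even automorphisms. The instance at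
  \<open>pinv\<close> says that the bracket respects the grading.\<close>

lemma br_pull: "g \<in> GL U \<Longrightarrow> br (pull g \<phi>) (pull g \<chi>) = pull g (br \<phi> \<chi>)"
  by (simp add: bracket_def hpart_pull comp_pull pull_plus pull_diff pull_scale)

lemma parity_br: "parity (br \<phi> \<chi>) = br (parity \<phi>) (parity \<chi>)"
  by (simp add: parity_def br_pull pinv_GL)

lemma br_uminus_left: "multilinear U \<phi> \<Longrightarrow> multilinear U \<chi> \<Longrightarrow> br (- \<phi>) \<chi> = - br \<phi> \<chi>"
proof -
  assume *: "multilinear U \<phi>" "multilinear U \<chi>"
  have "br 0 \<chi> + br 0 \<chi> = br 0 \<chi>"
    using br_plus_left[of 0 0 \<chi>] * by (simp add: ml_zero_cochain)
  then show ?thesis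
    using br_plus_left[of \<phi> "- \<phi>" \<chi>] * by (simp add: ml_uminus eq_neg_iff_add_eq_0 add.commute)
qed

lemma br_odd_odd:
  assumes "multilinear U \<phi>" "multilinear U \<chi>" "parity \<phi> = - \<phi>" "parity \<chi> = - \<chi>"
  shows "br \<phi> \<chi> = comp_deg U 1 \<phi> \<chi> + comp_deg U 1 \<chi> \<phi>"
  using assms
  by (simp add: bracket_def hpart_of_odd comp_zero_left comp_zero_right)
    (simp add: scale_cochain_def fun_eq_iff)

lemma br_odd_even:
  assumes "multilinear U \<phi>" "multilinear U \<chi>" "parity \<phi> = - \<phi>" "parity \<chi> = \<chi>"
  shows "br \<phi> \<chi> = comp_deg U 0 \<phi> \<chi> - comp_deg U 1 \<chi> \<phi>"
  using assms
  by (simp add: bracket_def hpart_of_odd hpart_of_even comp_zero_left comp_zero_right)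
    (simp add: scale_cochain_def fun_eq_iff)

text \<open>Parity is an automorphism of the bracket, so an odd value of an odd coderivation \<open>[\<phi>, -]\<close>
  is already attained on the even part of the argument, and likewise for even values.\<close>

lemma br_hpart_even:
  assumes "multilinear U \<phi>" "multilinear U \<chi>" "parity \<phi> = - \<phi>" "parity (br \<phi> \<chi>) = - br \<phi> \<chi>"
  shows "br \<phi> (hpart U 0 \<chi>) = br \<phi> \<chi>"
proof -
  let ?h = "hpart U 0 \<chi>"
  have "?h + ?h = \<chi> + parity \<chi>"
    by (simp add: hpart_eq scale_cochain_def fun_eq_iff half_add_half)
  moreover have "br \<phi> (parity \<chi>) = br \<phi> \<chi>"
    using assms by (simp add: parity_br br_uminus_left parity_ml)
  ultimately have "br \<phi> ?h + br \<phi> ?h = br \<phi> \<chi> + br \<phi> \<chi>"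
    using assms by (metis br_plus_right hpart_ml parity_ml)
  then show ?thesis by (rule double_inj_fun)
qed

lemma br_hpart_odd:
  assumes "multilinear U \<phi>" "multilinear U \<chi>" "parity \<phi> = - \<phi>" "parity (br \<phi> \<chi>) = br \<phi> \<chi>"
  shows "br \<phi> (hpart U 1 \<chi>) = br \<phi> \<chi>"
proof -
  let ?h = "hpart U 1 \<chi>"
  have "?h + ?h = \<chi> - parity \<chi>"
    by (simp add: hpart_eq scale_cochain_def fun_eq_iff half_add_half)
  moreover have "br \<phi> (parity \<chi>) = - br \<phi> \<chi>"
    using assms by (simp add: parity_br br_uminus_left parity_ml) (metis minus_minus)
  ultimately have "br \<phi> ?h + br \<phi> ?h = br \<phi> \<chi> + br \<phi> \<chi>"
    using assms by (metis br_plus_right br_diff_right diff_minus_eq_add hpart_ml parity_ml)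
  then show ?thesis by (rule double_inj_fun)
qed

end

text \<open>All signs disappear: inserting the even \<open>\<beta>\<close> produces none, and
  \<open>\<phi>\<close> can enter \<open>\<beta>\<close> only in its single slot, with no letter in
  front of it.\<close>

lemma (in gspace) br_2_1:
  assumes \<phi>: "\<phi> \<in> Hom U 2" "parity \<phi> = - \<phi>" and \<beta>: "\<beta> \<in> Hom U 1" "parity \<beta> = \<beta>"
  shows "br \<phi> \<beta> [x, y] = \<phi> [\<beta> [x], y] + \<phi> [x, \<beta> [y]] - \<beta> [\<phi> [x, y]]"
proof -
  have "\<phi> vs = 0" if "length vs \<noteq> 2" for vs using Hom_length \<phi> that by blast
  moreover have "\<beta> vs = 0" if "length vs \<noteq> Suc 0" for vs using Hom_length[OF \<beta>(1)] that by simp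
  moreover have "\<phi> (xs @ 0 # ys) = 0" for xs ys using ml_zero[OF Hom_ml[OF \<phi>(1)]] .
  note this[of "[]"] this[of "[_]"]
  moreover have "\<beta> [0] = 0" using ml_zero[OF Hom_ml[OF \<beta>(1)], of "[]" "[]"] by simp
  ultimately show ?thesis
    using assms by (simp add: br_odd_even Hom_ml comp_deg_def eval_nat_numeral)
qed

section \<open>Weights on a direct sum\<close>

abbreviation letters :: "('m + 'w) list \<Rightarrow> nat" where
  "letters xs \<equiv> length (filter isl xs)"

text \<open>A cochain of weight \<open>r\<close> lowers the number of letters from \<open>M\<close> by \<open>r\<close>. Thus \<open>\<mu>\<close> has weight 1,
  \<open>\<delta>\<close> and \<open>\<lambda>\<close> have weight 0, and \<open>\<psi>\<close> and \<open>\<beta>\<close> have weight -1. The bracket adds weights.\<close>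

definition wt :: "int \<Rightarrow> ('m::zero \<times> 'w::zero) cochain \<Rightarrow> bool" where
  "wt r \<phi> \<longleftrightarrow> (\<forall>xs. (int (letters xs) \<noteq> r + 1 \<longrightarrow> fst (\<phi> (map incl xs)) = 0) \<and>
                   (int (letters xs) \<noteq> r \<longrightarrow> snd (\<phi> (map incl xs)) = 0))"

lemma wtD:
  "wt r \<phi> \<Longrightarrow> int (letters xs) \<noteq> r + 1 \<Longrightarrow> fst (\<phi> (map incl xs)) = 0"
  "wt r \<phi> \<Longrightarrow> int (letters xs) \<noteq> r \<Longrightarrow> snd (\<phi> (map incl xs)) = 0"
  by (simp_all add: wt_def)

lemma wt_plus: "wt r \<phi> \<Longrightarrow> wt r \<chi> \<Longrightarrow> wt r (\<phi> + (\<chi> :: ('m::ab_group_add \<times> 'w::ab_group_add) cochain))"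
  by (simp add: wt_def)

lemma wt_diff: "wt r \<phi> \<Longrightarrow> wt r \<chi> \<Longrightarrow> wt r (\<phi> - (\<chi> :: ('m::ab_group_add \<times> 'w::ab_group_add) cochain))"
  by (simp add: wt_def)

lemma wt_zero: "wt r 0"
  by (simp add: wt_def)

lemma incl_split: "v = incl (Inl (fst v)) + incl (Inr (snd (v :: 'm::ab_group_add \<times> 'w::ab_group_add)))"
  by (simp add: incl_def prod_eq_iff)

text \<open>Words span the tensors: each vector is a letter from \<open>M\<close> plus a letter from
  \<open>W\<close>.\<close>

lemma zero_on_words:
  fixes F :: "('m::ab_group_add \<times> 'w::ab_group_add) list \<Rightarrow> 'a::ab_group_add"
  assumes "slot_additive F" "\<And>xs. F (map incl xs) = 0"
  shows "F = 0"
proof (rule slot_additive_eqI[where S = "range incl"])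
  show "slot_additive F" "slot_additive 0" using assms by (simp_all add: slot_additive_def)
  show "\<exists>a\<in>range incl. \<exists>b\<in>range incl. v = a + b" for v :: "'m \<times> 'w"
    using incl_split by blast
  fix vs :: "('m \<times> 'w) list" assume "set vs \<subseteq> range incl"
  then obtain xs where "vs = map incl xs" by (metis ex_map_conv image_iff subset_iff)
  then show "F vs = 0 vs" using assms by simp
qed

lemma map_prod_words:
  assumes "f 0 = 0" "h 0 = 0"
  shows "map (map_prod f h) (map incl xs) = map incl (map (map_sum f h) xs)"
  using assms by (auto simp: incl_def split: sum.split)

lemma letters_map_sum: "letters (map (map_sum f h) xs) = letters xs"
  by (induction xs) (auto simp: isl_map_sum)

lemma inv_map_prod: "bij f \<Longrightarrow> bij h \<Longrightarrow> inv (map_prod f h) = map_prod (inv f) (inv h)"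
  by (rule inv_equality) (auto simp: bij_is_inj surj_f_inv_f bij_is_surj)

text \<open>On a word with \<open>n\<close> letters from \<open>M\<close>, the
  \<open>M\<close>-component of a cochain of weight \<open>r\<close> survives only for
  \<open>n = r + 1\<close>, the \<open>W\<close>-component only for \<open>n = r\<close>. Different
  weights never meet in the same component, so nothing can cancel.\<close>

lemma wt_unique:
  fixes a b c :: "('m::ab_group_add \<times> 'w::ab_group_add) cochain"
  assumes wt: "wt 1 a" "wt 0 b" "wt (-1) c" and sum: "a + b + c = 0"
    and add: "slot_additive a" "slot_additive b" "slot_additive c"
  shows "a = 0 \<and> b = 0 \<and> c = 0"
proof -
  have "a (map incl xs) = 0 \<and> b (map incl xs) = 0 \<and> c (map incl xs) = 0" for xs :: "('m + 'w) list"
  proof -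
    have s: "a (map incl xs) + b (map incl xs) + c (map incl xs) = 0"
      using sum by (metis plus_fun_apply zero_fun_apply)
    have "fst (a (map incl xs)) + fst (b (map incl xs)) + fst (c (map incl xs)) = 0"
      "snd (a (map incl xs)) + snd (b (map incl xs)) + snd (c (map incl xs)) = 0"
      using arg_cong[OF s, of fst] arg_cong[OF s, of snd] by simp_all
    then show ?thesis
      using wtD[OF wt(1), of xs] wtD[OF wt(2), of xs] wtD[OF wt(3), of xs]
      by (cases "letters xs = 0"; cases "letters xs = 1"; cases "letters xs = 2")
         (auto simp: prod_eq_iff)
  qed
  then show ?thesis using zero_on_words add by blast
qed

section \<open>The direct sum and its block-diagonal automorphisms\<close>

locale gpair = M: gspace M + W: gspace W
  for M :: "('k::field, 'm::ab_group_add) graded" and W :: "('k, 'w::ab_group_add) graded"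
begin

abbreviation V where "V \<equiv> dsum M W"

lemma smul_V: "smul V c v = (smul M c (fst v), smul W c (snd v))"
  by (simp add: dsum_def case_prod_beta)

lemma vector_space_V: "vector_space (smul V)"
  by unfold_locales
    (simp_all add: smul_V prod_eq_iff M.vs.scale_right_distrib M.vs.scale_left_distrib
      W.vs.scale_right_distrib W.vs.scale_left_distrib)

lemma graded_space_V: "graded_space V"
proof -
  interpret X: vector_space "smul V" by (rule vector_space_V)
  have p: "even_part V = even_part M \<times> even_part W" "odd_part V = odd_part M \<times> odd_part W"
    by (simp_all add: dsum_def)
  have "v \<in> even_part V + odd_part V" for v :: "'m \<times> 'w"
  proof -
    obtain a b where "a \<in> even_part M" "b \<in> odd_part M" "fst v = a + b"
      using M.parity_decomp by blast
    moreover obtain c d where "c \<in> even_part W" "d \<in> odd_part W" "snd v = c + d"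
      using W.parity_decomp by blast
    ultimately have "(a, c) \<in> even_part V" "(b, d) \<in> odd_part V" "v = (a, c) + (b, d)"
      by (simp_all add: p prod_eq_iff)
    then show ?thesis by (metis set_plus_intro)
  qed
  moreover have "even_part V \<inter> odd_part V = {0}"
    using M.parity_disjoint W.parity_disjoint M.parity_parts(3,6) W.parity_parts(3,6)
    by (auto simp: p zero_prod_def)
  moreover have "X.subspace (even_part V)" "X.subspace (odd_part V)"
    by (auto simp: X.subspace_def p smul_V zero_prod_def M.parity_parts W.parity_parts)
  ultimately show ?thesis
    by (auto simp: graded_space_def vector_space_V)
qed

sublocale V: gspace V
  by unfold_locales (rule graded_space_V, rule M.char)

lemma pinv_V: "pinv V = map_prod (pinv M) (pinv W)"
proof
  fix v :: "'m \<times> 'w"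
  obtain a b where 1: "a \<in> even_part M" "b \<in> odd_part M" "fst v = a + b"
    using M.parity_decomp by blast
  obtain c d where 2: "c \<in> even_part W" "d \<in> odd_part W" "snd v = c + d"
    using W.parity_decomp by blast
  have "pinv V ((a, c) + (b, d)) = (a, c) - (b, d)"
    using 1 2 by (intro V.pinv_eq) (simp_all add: dsum_def)
  moreover have "v = (a, c) + (b, d)" using 1 2 by (simp add: prod_eq_iff)
  ultimately show "pinv V v = map_prod (pinv M) (pinv W) v"
    using 1 2 by (simp add: M.pinv_eq W.pinv_eq)
qed

lemma G_MW_GL: "g \<in> G_MW M W \<Longrightarrow> g \<in> GL V"
  unfolding G_MW_def
  by (auto simp: V.GL_iff M.GL_iff W.GL_iff linear_iff_add_scale M.vs.vector_space_axioms
      W.vs.vector_space_axioms vector_space_V bij_betw_map_prod smul_V pinv_V UNIV_Times_UNIV[symmetric]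
      simp del: UNIV_Times_UNIV)

lemma pinv_G_MW: "pinv V \<in> G_MW M W"
  unfolding G_MW_def using pinv_V M.pinv_GL W.pinv_GL by blast

text \<open>All that weights see of a block-diagonal map: it sends words to words with equally many
  letters from \<open>M\<close>, and its inverse does not mix the components of a value.\<close>

lemma G_MW_pull_word:
  assumes "g \<in> G_MW M W"
  obtains f h ys where "map g (map incl xs) = map incl ys" "letters ys = letters xs"
    "\<And>v. fst (inv g v) = f (fst v)" "\<And>v. snd (inv g v) = h (snd v)" "f 0 = 0" "h 0 = 0"
proof -
  obtain f h where fh: "g = map_prod f h" "f \<in> GL M" "h \<in> GL W"
    using assms by (auto simp: G_MW_def)
  show ?thesis
  proof (rule that)
    show "map g (map incl xs) = map incl (map (map_sum f h) xs)"
      unfolding fh(1) by (rule map_prod_words) (simp_all add: fh M.GL_zero W.GL_zero)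
    show "letters (map (map_sum f h) xs) = letters xs" by (rule letters_map_sum)
    show "inv f 0 = 0" "inv h 0 = 0" using fh by (simp_all add: M.GL_zero W.GL_zero M.GL_inv W.GL_inv)
  qed (simp_all add: fh inv_map_prod M.GL_bij W.GL_bij)
qed

lemma wt_pull: "g \<in> G_MW M W \<Longrightarrow> wt r \<phi> \<Longrightarrow> wt r (pull g \<phi>)"
  unfolding wt_def pull_def by (metis G_MW_pull_word)

lemma snd_zero_pull: "g \<in> G_MW M W \<Longrightarrow> \<forall>vs. snd (\<phi> vs) = 0 \<Longrightarrow> snd (pull g \<phi> vs) = 0"
  unfolding pull_def by (metis G_MW_pull_word)

lemma wt_scale: "wt r \<phi> \<Longrightarrow> wt r (scale_cochain V c \<phi>)"
  by (simp add: wt_def scale_cochain_def smul_V)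

lemma wt_hpart: "wt r \<phi> \<Longrightarrow> wt r (hpart V p \<phi>)"
  unfolding V.hpart_eq V.parity_def
  by (intro wt_scale wt_plus wt_pull pinv_G_MW)

text \<open>The inserted value is split into two letters. Its \<open>M\<close>-part replaces
  \<open>s + 1\<close> letters from \<open>M\<close> by one, its \<open>W\<close>-part replaces
  \<open>s\<close> of them by none; either way \<open>\<phi>\<close> sees \<open>s\<close> letters
  from \<open>M\<close> fewer than the whole word has.\<close>

lemma wt_comp:
  assumes \<phi>: "wt r \<phi>" "multilinear V \<phi>" and \<chi>: "wt s \<chi>"
  shows "wt (r + s) (comp_deg V q \<phi> \<chi>)"
proof -
  \<comment> \<open>Signs act letter by letter and keep each letter in its summand, so the signed
    prefix is again a word with the same count.\<close>
  define P where "P = map_sum (pinv M ^^ q) (pinv W ^^ q)"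
  have P: "(pinv V ^^ q) (incl x) = incl (P x)" for x
  proof -
    have "(pinv V ^^ q) (m, w) = ((pinv M ^^ q) m, (pinv W ^^ q) w)" for m w
      by (induction q) (simp_all add: pinv_V)
    moreover have "(pinv M ^^ q) 0 = 0" "(pinv W ^^ q) 0 = 0"
      by (induction q) simp_all
    ultimately show ?thesis by (cases x) (simp_all add: P_def incl_def)
  qed
  have *: "(int (letters xs) \<noteq> r + s + 1 \<longrightarrow> fst (\<phi> (map (pinv V ^^ q) (take i (map incl xs)) @ \<chi> (take l (drop i (map incl xs))) # drop (i + l) (map incl xs))) = 0) \<and>
    (int (letters xs) \<noteq> r + s \<longrightarrow> snd (\<phi> (map (pinv V ^^ q) (take i (map incl xs)) @ \<chi> (take l (drop i (map incl xs))) # drop (i + l) (map incl xs))) = 0)" for xs i l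
  proof -
    define as bs cs where "as = take i xs" and "bs = take l (drop i xs)" and "cs = drop (i + l) xs"
    have xs: "xs = as @ bs @ cs"
      unfolding as_def bs_def cs_def by (metis append_take_drop_id drop_drop add.commute)
    then have len: "letters xs = letters as + letters bs + letters cs" by simp
    let ?pre = "map incl (map P as)"
    have "map (pinv V ^^ q) (take i (map incl xs)) = ?pre" by (simp add: take_map P o_def as_def)
    moreover have "take l (drop i (map incl xs)) = map incl bs" "drop (i + l) (map incl xs) = map incl cs"
      by (simp_all add: take_map drop_map bs_def cs_def)
    moreover define v where "v = \<chi> (map incl bs)"
    moreover have "\<phi> (?pre @ v # map incl cs) =
      \<phi> (?pre @ incl (Inl (fst v)) # map incl cs) + \<phi> (?pre @ incl (Inr (snd v)) # map incl cs)"
      using V.ml_add[OF \<phi>(2)] incl_split[of v] by metis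
    moreover have "letters (map P as) = letters as" unfolding P_def by (rule letters_map_sum)
    moreover have "\<phi> (?pre @ incl (Inl (fst v)) # map incl cs) = 0" if "int (letters bs) \<noteq> s + 1"
      using wtD(1)[OF \<chi> that] V.ml_zero[OF \<phi>(2)] by (simp add: v_def incl_def flip: zero_prod_def)
    moreover have "\<phi> (?pre @ incl (Inr (snd v)) # map incl cs) = 0" if "int (letters bs) \<noteq> s"
      using wtD(2)[OF \<chi> that] V.ml_zero[OF \<phi>(2)] by (simp add: v_def incl_def flip: zero_prod_def)
    moreover have "int (letters as + letters cs) \<noteq> r \<Longrightarrow> fst (\<phi> (?pre @ incl (Inl (fst v)) # map incl cs)) = 0"
      "int (letters as + letters cs) + 1 \<noteq> r \<Longrightarrow> snd (\<phi> (?pre @ incl (Inl (fst v)) # map incl cs)) = 0"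
      "int (letters as + letters cs) \<noteq> r + 1 \<Longrightarrow> fst (\<phi> (?pre @ incl (Inr (snd v)) # map incl cs)) = 0"
      "int (letters as + letters cs) \<noteq> r \<Longrightarrow> snd (\<phi> (?pre @ incl (Inr (snd v)) # map incl cs)) = 0"
      using wtD[OF \<phi>(1), of "map P as @ Inl (fst v) # cs"] wtD[OF \<phi>(1), of "map P as @ Inr (snd v) # cs"]
        \<open>letters (map P as) = letters as\<close> by simp_all
    ultimately show ?thesis unfolding len
      by (cases "int (letters bs) = s + 1"; cases "int (letters bs) = s") auto
  qed
  have fs: "fst (sum f I) = (\<Sum>i\<in>I. fst (f i))" "snd (sum f I) = (\<Sum>i\<in>I. snd (f i))"
    for f :: "nat \<Rightarrow> 'm \<times> 'w" and I
    by (induction I rule: infinite_finite_induct) simp_all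
  show ?thesis
    unfolding wt_def comp_deg_def fs using * by simp
qed

lemma wt_br: "wt r \<phi> \<Longrightarrow> wt s \<chi> \<Longrightarrow> multilinear V \<phi> \<Longrightarrow> multilinear V \<chi> \<Longrightarrow> wt (r + s) (bracket V \<phi> \<chi>)"
proof -
  assume *: "wt r \<phi>" "wt s \<chi>" "multilinear V \<phi>" "multilinear V \<chi>"
  have "wt (r + s) (comp_deg V q (hpart V p \<phi>) (hpart V q \<chi>))"
     "wt (r + s) (comp_deg V p (hpart V q \<chi>) (hpart V p \<phi>))" for p q
    using * wt_comp wt_hpart V.hpart_ml by (blast, metis add.commute)
  then show ?thesis
    by (simp add: bracket_def wt_plus wt_diff wt_scale)
qed

text \<open>Consuming \<open>k\<close> letters from \<open>M\<close> and returning one lowers their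
  number by \<open>k - 1\<close>. This is -1 for \<open>k = 0\<close>, which is why weights are
  integers.\<close>

lemma C_iff: "\<phi> \<in> C M W k l \<longleftrightarrow> \<phi> \<in> Hom V (k + l) \<and> (\<forall>vs. snd (\<phi> vs) = 0) \<and> wt (int k - 1) \<phi>"
  by (auto simp: C_def wt_def prod_eq_iff)

text \<open>A nonzero \<open>W\<close>-component of weight -1 would need -1 letters from
  \<open>M\<close>, so values in \<open>M\<close> are automatic here.\<close>

lemma C_0I:
  assumes "\<phi> \<in> Hom V n" "wt (-1) \<phi>"
  shows "\<phi> \<in> C M W 0 n"
proof -
  have "(\<lambda>vs. snd (\<phi> vs)) = 0"
  proof (rule zero_on_words)
    show "slot_additive (\<lambda>vs. snd (\<phi> vs))"
      using V.Hom_ml[OF assms(1)] by (simp add: slot_additive_def V.ml_add)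
    show "snd (\<phi> (map incl xs)) = 0" for xs
      using wtD(2)[OF assms(2), of xs] by simp
  qed
  then show ?thesis using assms by (simp add: C_iff fun_eq_iff)
qed

lemma C_Hom: "\<phi> \<in> C M W k l \<Longrightarrow> \<phi> \<in> Hom V (k + l)"
  by (simp add: C_iff)

lemma C_ml: "\<phi> \<in> C M W k l \<Longrightarrow> multilinear V \<phi>"
  using C_Hom V.Hom_ml by blast

lemma C_plus: "\<phi> \<in> C M W k l \<Longrightarrow> \<chi> \<in> C M W k l \<Longrightarrow> \<phi> + \<chi> \<in> C M W k l"
  by (simp add: C_iff V.Hom_plus wt_plus)

lemma C_diff: "\<phi> \<in> C M W k l \<Longrightarrow> \<chi> \<in> C M W k l \<Longrightarrow> \<phi> - \<chi> \<in> C M W k l"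
  by (simp add: C_iff V.Hom_diff wt_diff)

lemma C_zero: "0 \<in> C M W k l"
  by (simp add: C_iff V.Hom_zero wt_zero)

lemma C_uminus: "\<phi> \<in> C M W k l \<Longrightarrow> - \<phi> \<in> C M W k l"
  using C_diff[OF C_zero, of \<phi>] by simp

lemma C_scale: "\<phi> \<in> C M W k l \<Longrightarrow> scale_cochain V c \<phi> \<in> C M W k l"
  by (simp add: C_iff V.Hom_scale wt_scale) (simp add: scale_cochain_def smul_V)

lemma C_pull: "g \<in> G_MW M W \<Longrightarrow> \<phi> \<in> C M W k l \<Longrightarrow> pull g \<phi> \<in> C M W k l"
  by (simp add: C_iff V.pull_Hom G_MW_GL wt_pull snd_zero_pull)

lemma C_hpart: "\<phi> \<in> C M W k l \<Longrightarrow> hpart V p \<phi> \<in> C M W k l"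
  unfolding V.hpart_eq V.parity_def by (intro C_scale C_plus C_pull pinv_G_MW)

lemma C_01: "\<beta> \<in> C M W 0 1 \<Longrightarrow> snd v = 0 \<Longrightarrow> \<beta> [v] = 0"
  unfolding C_def using incl_split[of v]
  by (auto dest!: spec[of _ "[Inl (fst v)]"] simp: incl_def zero_prod_def)

lemma C_11: "\<phi> \<in> C M W 1 1 \<Longrightarrow> snd u = 0 \<Longrightarrow> snd v = 0 \<Longrightarrow> \<phi> [u, v] = 0"
  unfolding C_def
  by (auto dest!: spec[of _ "[Inl (fst u), Inl (fst v)]"] simp: incl_def) (metis prod.collapse)

lemma C_02:
  assumes \<phi>: "\<phi> \<in> C M W 0 2" and u: "snd u = 0"
  shows "\<phi> [u, v] = 0" "\<phi> [v, u] = 0"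
proof -
  have *: "\<phi> [u, incl x] = 0 \<and> \<phi> [incl x, u] = 0" for x
  proof -
    have "\<phi> (map incl [Inl (fst u), x]) = 0 \<and> \<phi> (map incl [x, Inl (fst u)]) = 0"
      using \<phi> by (simp add: C_def del: list.map)
    moreover have "incl (Inl (fst u)) = u" using u by (simp add: incl_def prod_eq_iff)
    ultimately show ?thesis by simp
  qed
  define a b :: "'m + 'w" where "a = Inl (fst v)" and "b = Inr (snd v)"
  have "\<phi> ([u] @ (incl a + incl b) # []) = 0" "\<phi> ([] @ (incl a + incl b) # [u]) = 0"
    using *[of a] *[of b] by (simp_all only: V.ml_add[OF C_ml[OF \<phi>]]) simp_all
  then show "\<phi> [u, v] = 0" "\<phi> [v, u] = 0"
    by (simp_all add: a_def b_def flip: incl_split)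
qed

lemma snd_C: "\<phi> \<in> C M W k l \<Longrightarrow> snd (\<phi> vs) = 0"
  by (simp add: C_def)

section \<open>The unipotent maps \<open>expc \<beta>\<close>\<close>

lemma rest_C: "\<beta> \<in> rest M W \<Longrightarrow> \<beta> \<in> C M W 0 1"
  by (simp add: rest_def)

lemma rest_iff: "\<beta> \<in> rest M W \<longleftrightarrow> \<beta> \<in> C M W 0 1 \<and> V.parity \<beta> = \<beta>"
  using V.even_iff_parity C_ml by (auto simp: rest_def)

lemma rest_plus: "\<alpha> \<in> rest M W \<Longrightarrow> \<beta> \<in> rest M W \<Longrightarrow> \<alpha> + \<beta> \<in> rest M W"
  by (simp add: rest_iff C_plus V.parity_plus)

lemma rest_uminus: "\<beta> \<in> rest M W \<Longrightarrow> - \<beta> \<in> rest M W"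
  by (simp add: rest_iff C_uminus V.parity_uminus)

lemma rest_zero: "0 \<in> rest M W"
  by (simp add: rest_iff C_zero V.parity_zero)

lemma rest_pull: "g \<in> G_MW M W \<Longrightarrow> \<beta> \<in> rest M W \<Longrightarrow> pull g \<beta> \<in> rest M W"
  by (simp add: rest_iff C_pull V.parity_pull G_MW_GL)

text \<open>Values of \<open>\<beta>\<close> lie in \<open>M\<close>, where \<open>\<alpha>\<close>
  vanishes. Hence exponentials end after the linear term, and composing them adds the
  exponents.\<close>

lemma rest_comp: "\<alpha> \<in> rest M W \<Longrightarrow> \<beta> \<in> rest M W \<Longrightarrow> \<alpha> [\<beta> vs] = 0"
  by (rule C_01[OF rest_C snd_C[OF rest_C]])

lemma rest_add: "\<beta> \<in> rest M W \<Longrightarrow> \<beta> [u + v] = \<beta> [u] + \<beta> [v]"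
  using V.ml_add[OF C_ml[OF rest_C], of \<beta> "[]" u v "[]"] by simp

lemma expc_zero: "expc 0 = id"
  by (simp add: expc_def fun_eq_iff)

lemma expc_comp: "\<alpha> \<in> rest M W \<Longrightarrow> \<beta> \<in> rest M W \<Longrightarrow> expc \<alpha> \<circ> expc \<beta> = expc (\<alpha> + \<beta>)"
  by (simp add: expc_def fun_eq_iff rest_add rest_comp algebra_simps)

lemma expc_neg:
  assumes "\<beta> \<in> rest M W"
  shows "expc (- \<beta>) \<circ> expc \<beta> = id" "expc \<beta> \<circ> expc (- \<beta>) = id"
  using assms expc_comp[OF rest_uminus[OF assms] assms] expc_comp[OF assms rest_uminus[OF assms]]
  by (simp_all add: expc_zero)

lemma bij_expc: "\<beta> \<in> rest M W \<Longrightarrow> bij (expc \<beta>)"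
  using o_bij expc_neg by blast

lemma inv_expc: "\<beta> \<in> rest M W \<Longrightarrow> inv (expc \<beta>) = expc (- \<beta>)"
  using expc_neg by (metis inv_unique_comp)

lemma expc_GL:
  assumes \<beta>: "\<beta> \<in> rest M W"
  shows "expc \<beta> \<in> GL V"
proof -
  have "pinv V (\<beta> [v]) = \<beta> [pinv V v]" for v
  proof -
    have "V.parity \<beta> [pinv V v] = pinv V (\<beta> [v])" by (simp add: V.parity_apply)
    then show ?thesis using \<beta> by (simp add: rest_iff)
  qed
  moreover have "\<beta> [smul V c v] = smul V c (\<beta> [v])" for c v
    using V.ml_scale[OF C_ml[OF rest_C[OF \<beta>]], of "[]" c v "[]"] by simp
  ultimately have "expc \<beta> (x + y) = expc \<beta> x + expc \<beta> y" "expc \<beta> (smul V c x) = smul V c (expc \<beta> x)"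
    "expc \<beta> (pinv V x) = pinv V (expc \<beta> x)" for x y c
    using \<beta> by (simp_all add: expc_def rest_add V.vs.scale_right_distrib V.pinv_add algebra_simps)
  then show ?thesis
    unfolding V.GL_iff linear_iff_add_scale[OF vector_space_V vector_space_V]
    using bij_expc[OF \<beta>] by blast
qed

text \<open>The conjugation rule behind the semidirect product: an exponential moves past
  \<open>g\<close> at the cost of pulling back its exponent.\<close>

lemma expc_conj:
  assumes g: "g \<in> GL V"
  shows "g \<circ> expc (pull g \<beta>) = expc \<beta> \<circ> g"
  using g by (simp add: fun_eq_iff expc_def pull_def V.GL_add surj_f_inv_f bij_is_surj V.GL_bij)

end

section \<open>Extensions\<close>

lemma (in gspace) ml_zero_mem: "multilinear U \<phi> \<Longrightarrow> 0 \<in> set vs \<Longrightarrow> \<phi> vs = 0"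
  by (metis split_list ml_zero)

lemma (in gspace) br_odd_sym:
  assumes "multilinear U \<phi>" "multilinear U \<chi>" "parity \<phi> = - \<phi>" "parity \<chi> = - \<chi>"
  shows "br \<phi> \<chi> = br \<chi> \<phi>"
  using assms by (simp add: br_odd_odd add.commute)

lemma ext_W_apply: "ext_W \<phi> vs = (0, \<phi> (map snd vs))"
  by (simp add: ext_W_def)

lemma ext_M_apply: "ext_M \<phi> vs = (\<phi> (map fst vs), 0)"
  by (simp add: ext_M_def)

section \<open>Extension by zero and odd binary cochains\<close>

context gpair
begin

lemma ext_W_ml: "multilinear W \<phi> \<Longrightarrow> multilinear V (ext_W \<phi>)"
  by (simp add: V.multilinear_iff W.multilinear_iff slot_additive_def ext_W_apply smul_V del: split_paired_All)

lemma ext_M_ml: "multilinear M \<phi> \<Longrightarrow> multilinear V (ext_M \<phi>)"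
  by (simp add: V.multilinear_iff M.multilinear_iff slot_additive_def ext_M_apply smul_V del: split_paired_All)

lemma ext_W_Hom: "\<phi> \<in> Hom W n \<Longrightarrow> ext_W \<phi> \<in> Hom V n"
  by (simp add: Hom_def ext_W_ml) (simp add: ext_W_apply zero_prod_def)

lemma ext_M_Hom: "\<phi> \<in> Hom M n \<Longrightarrow> ext_M \<phi> \<in> Hom V n"
  by (simp add: Hom_def ext_M_ml) (simp add: ext_M_apply zero_prod_def)

lemma ext_parity: "V.parity (ext_W \<phi>) = ext_W (W.parity \<phi>)" "V.parity (ext_M \<chi>) = ext_M (M.parity \<chi>)"
  by (simp_all add: fun_eq_iff V.parity_apply W.parity_apply M.parity_apply ext_W_apply ext_M_apply pinv_V o_def)

lemma pinv_V_pow: "(pinv V ^^ q) v = ((pinv M ^^ q) (fst v), (pinv W ^^ q) (snd v))"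
  by (induction q) (simp_all add: pinv_V)

lemma ext_M_hpart: "hpart V p (ext_M \<chi>) = ext_M (hpart M p \<chi>)"
  by (simp add: fun_eq_iff V.hpart_eq M.hpart_eq ext_parity scale_cochain_def smul_V ext_M_apply)

lemma ext_M_comp: "comp_deg V q (ext_M \<chi>) (ext_M \<chi>') = ext_M (comp_deg M q \<chi> \<chi>')"
  by (simp add: fun_eq_iff prod_eq_iff comp_deg_def ext_M_apply fst_sum snd_sum
      o_def pinv_V_pow take_map drop_map)

lemma ext_M_bracket: "bracket V (ext_M \<chi>) (ext_M \<chi>') = ext_M (bracket M \<chi> \<chi>')"
  by (simp add: bracket_def ext_M_hpart ext_M_comp fun_eq_iff ext_M_apply scale_cochain_def smul_V)

lemma wt_ext_W:
  assumes "multilinear W \<phi>"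
  shows "wt 0 (ext_W \<phi> :: ('m \<times> 'w) cochain)"
proof -
  have "\<phi> (map snd (map incl xs)) = 0" if letters: "letters xs \<noteq> 0" for xs :: "('m + 'w) list"
  proof (rule W.ml_zero_mem[OF assms])
    obtain m where "Inl m \<in> set xs"
      using letters by (auto simp: filter_empty_conv isl_def)
    then show "0 \<in> set (map snd (map incl xs))" by (force simp: incl_def)
  qed
  then show ?thesis by (simp add: wt_def ext_W_apply del: map_map)
qed

lemma wt_ext_M:
  assumes "\<phi> \<in> Hom M n"
  shows "wt (int n - 1) (ext_M \<phi> :: ('m \<times> 'w) cochain)"
proof -
  have "\<phi> (map fst (map incl xs)) = 0" if letters: "letters xs \<noteq> n" for xs :: "('m + 'w) list"
  proof (cases "length xs = n")
    case True
    have "\<exists>x\<in>set xs. \<not> isl x"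
    proof (rule ccontr)
      assume "\<not> (\<exists>x\<in>set xs. \<not> isl x)"
      then have "filter isl xs = xs" by (simp add: filter_id_conv)
      then show False using letters True by simp
    qed
    then obtain w where "Inr w \<in> set xs" by (metis sum.collapse(2))
    then have "0 \<in> set (map fst (map incl xs))" by (force simp: incl_def)
    then show ?thesis by (rule M.ml_zero_mem[OF M.Hom_ml[OF assms]])
  next
    case False
    then show ?thesis using M.Hom_length[OF assms] by simp
  qed
  then show ?thesis by (simp add: wt_def ext_M_apply del: map_map)
qed

text \<open>Oddness is an equation here instead of a condition on homogeneous arguments, so closure
  properties reduce to rewriting. Codifferentials on \<open>V\<close> and their components
  \<open>\<delta>\<close>, \<open>\<mu>\<close>, \<open>\<lambda>\<close>, \<open>\<psi>\<close> all
  lie in this space.\<close>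

definition odd2 :: "('m \<times> 'w) cochain set" where
  "odd2 = {\<phi> \<in> Hom V 2. V.parity \<phi> = - \<phi>}"

lemma odd2_Hom: "\<phi> \<in> odd2 \<Longrightarrow> \<phi> \<in> Hom V 2"
  by (simp add: odd2_def)

lemma odd2_ml: "\<phi> \<in> odd2 \<Longrightarrow> multilinear V \<phi>"
  by (auto simp: odd2_def intro: V.Hom_ml)

lemma odd2_parity: "\<phi> \<in> odd2 \<Longrightarrow> V.parity \<phi> = - \<phi>"
  by (simp add: odd2_def)

lemma odd2_iff: "\<phi> \<in> odd2 \<longleftrightarrow> \<phi> \<in> Hom V 2 \<and> odd_cochain V \<phi>"
  using V.odd_iff_parity V.Hom_ml by (auto simp: odd2_def)

lemma odd2_plus: "\<phi> \<in> odd2 \<Longrightarrow> \<chi> \<in> odd2 \<Longrightarrow> \<phi> + \<chi> \<in> odd2"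
  by (simp add: odd2_def V.Hom_plus V.parity_plus)

lemma odd2_diff: "\<phi> \<in> odd2 \<Longrightarrow> \<chi> \<in> odd2 \<Longrightarrow> \<phi> - \<chi> \<in> odd2"
  by (simp add: odd2_def V.Hom_diff V.parity_diff)

lemma odd2_zero: "0 \<in> odd2"
  by (simp add: odd2_def V.Hom_zero V.parity_zero)

lemma odd2_scale: "\<phi> \<in> odd2 \<Longrightarrow> scale_cochain V c \<phi> \<in> odd2"
  by (simp add: odd2_def V.Hom_scale V.parity_scale) (simp add: scale_cochain_def fun_Compl_def)

lemma odd2_pull: "g \<in> GL V \<Longrightarrow> \<phi> \<in> odd2 \<Longrightarrow> pull g \<phi> \<in> odd2"
  by (simp add: odd2_def V.pull_Hom V.parity_pull V.pull_uminus)

lemma odd2_br_rest: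
  assumes "\<phi> \<in> odd2" "\<beta> \<in> rest M W"
  shows "bracket V \<phi> \<beta> \<in> odd2"
proof -
  have "bracket V \<phi> \<beta> \<in> Hom V 2"
    using V.br_Hom[OF odd2_Hom[OF assms(1)] C_Hom[OF rest_C[OF assms(2)]], of 2] by simp
  moreover have "V.parity (bracket V \<phi> \<beta>) = - bracket V \<phi> \<beta>"
    using assms V.br_uminus_left[OF odd2_ml[OF assms(1)] C_ml[OF rest_C[OF assms(2)]]]
    by (simp add: V.parity_br odd2_parity rest_iff)
  ultimately show ?thesis by (simp add: odd2_def)
qed

lemma codifferential_V_iff: "codifferential V d \<longleftrightarrow> d \<in> odd2 \<and> bracket V d d = 0"
  by (auto simp: codifferential_def odd2_iff)

lemma br_odd2_commute: "\<phi> \<in> odd2 \<Longrightarrow> \<chi> \<in> odd2 \<Longrightarrow> bracket V \<phi> \<chi> = bracket V \<chi> \<phi>"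
  by (rule V.br_odd_sym) (simp_all add: odd2_ml odd2_parity)

lemma br_odd2_square:
  assumes "\<phi> \<in> odd2" "\<chi> \<in> odd2"
  shows "bracket V (\<phi> + \<chi>) (\<phi> + \<chi>) = bracket V \<phi> \<phi> + (bracket V \<phi> \<chi> + bracket V \<phi> \<chi>) + bracket V \<chi> \<chi>"
  using assms br_odd2_commute[OF assms]
  by (simp add: V.br_plus_left V.br_plus_right V.ml_plus odd2_ml algebra_simps)

definition lam_cochains :: "('m \<times> 'w) cochain set" where
  "lam_cochains = C M W 1 1 \<inter> odd2"

definition psi_cochains :: "('m \<times> 'w) cochain set" where
  "psi_cochains = C M W 0 2 \<inter> odd2"

lemma lam_cochains_iff: "l \<in> lam_cochains \<longleftrightarrow> l \<in> C M W 1 1 \<and> odd_cochain V l"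
  using C_Hom[of l 1 1] by (auto simp: lam_cochains_def odd2_iff numeral_2_eq_2)

lemma psi_cochains_iff: "p \<in> psi_cochains \<longleftrightarrow> p \<in> C M W 0 2 \<and> odd_cochain V p"
  using C_Hom[of p 0 2] by (auto simp: psi_cochains_def odd2_iff numeral_2_eq_2)

lemma lam_plus: "l \<in> lam_cochains \<Longrightarrow> l' \<in> lam_cochains \<Longrightarrow> l + l' \<in> lam_cochains"
  by (simp add: lam_cochains_def C_plus odd2_plus)

lemma psi_plus: "l \<in> psi_cochains \<Longrightarrow> l' \<in> psi_cochains \<Longrightarrow> l + l' \<in> psi_cochains"
  by (simp add: psi_cochains_def C_plus odd2_plus)

lemma psi_diff: "l \<in> psi_cochains \<Longrightarrow> l' \<in> psi_cochains \<Longrightarrow> l - l' \<in> psi_cochains"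
  by (simp add: psi_cochains_def C_diff odd2_diff)

lemma lam_pull: "g \<in> G_MW M W \<Longrightarrow> l \<in> lam_cochains \<Longrightarrow> pull g l \<in> lam_cochains"
  by (simp add: lam_cochains_def C_pull odd2_pull G_MW_GL)

lemma psi_pull: "g \<in> G_MW M W \<Longrightarrow> l \<in> psi_cochains \<Longrightarrow> pull g l \<in> psi_cochains"
  by (simp add: psi_cochains_def C_pull odd2_pull G_MW_GL)

lemma lam_odd2: "l \<in> lam_cochains \<Longrightarrow> l \<in> odd2" and lam_C: "l \<in> lam_cochains \<Longrightarrow> l \<in> C M W 1 1"
  and psi_odd2: "p \<in> psi_cochains \<Longrightarrow> p \<in> odd2" and psi_C: "p \<in> psi_cochains \<Longrightarrow> p \<in> C M W 0 2"
  by (simp_all add: lam_cochains_def psi_cochains_def)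

lemma lam_wt: "l \<in> lam_cochains \<Longrightarrow> wt 0 l" and psi_wt: "p \<in> psi_cochains \<Longrightarrow> wt (-1) p"
  and rest_wt: "\<beta> \<in> rest M W \<Longrightarrow> wt (-1) \<beta>"
  using rest_C by (auto simp: lam_cochains_def psi_cochains_def C_iff)

lemma br_rest_psi:
  assumes "\<phi> \<in> odd2" "wt 0 \<phi>" "\<beta> \<in> rest M W"
  shows "bracket V \<phi> \<beta> \<in> psi_cochains"
  unfolding psi_cochains_def
proof
  have "wt (0 + (-1)) (bracket V \<phi> \<beta>)"
    using assms by (intro wt_br rest_wt odd2_ml C_ml[OF rest_C])
  then show "bracket V \<phi> \<beta> \<in> C M W 0 2"
    using assms by (intro C_0I) (simp_all add: odd2_br_rest odd2_Hom)
qed (simp add: assms odd2_br_rest)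

text \<open>The weight is -2, and no word has -1 or -2 letters from \<open>M\<close>.\<close>

lemma br_psi_psi:
  assumes "p \<in> psi_cochains"
  shows "bracket V p p = 0"
proof (rule zero_on_words)
  show "slot_additive (bracket V p p)"
    by (rule V.ml_additive, rule V.Hom_ml, rule V.br_Hom[where k = 2 and l = 2 and n = 3])
      (simp_all add: odd2_Hom psi_odd2 assms)
  have "wt (-1 + -1) (bracket V p p)"
    using assms by (intro wt_br psi_wt odd2_ml psi_odd2)
  from wtD[OF this] show "bracket V p p (map incl xs) = 0" for xs
    by (simp add: prod_eq_iff)
qed

lemma br_rest_apply:
  "\<phi> \<in> odd2 \<Longrightarrow> \<beta> \<in> rest M W \<Longrightarrow>
     bracket V \<phi> \<beta> [x, y] = \<phi> [\<beta> [x], y] + \<phi> [x, \<beta> [y]] - \<beta> [\<phi> [x, y]]"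
  using C_Hom[OF rest_C, of \<beta>] by (intro V.br_2_1) (simp_all add: odd2_def rest_iff)

end

section \<open>The equations for an extension and their behaviour under exponentials\<close>

locale ext_data = gpair M W
  for M :: "('k::field, 'm::ab_group_add) graded" and W :: "('k, 'w::ab_group_add) graded" +
  fixes \<delta>W :: "'w cochain" and \<mu>M :: "'m cochain" and \<delta> \<mu> :: "('m \<times> 'w) cochain"
  assumes codiff_W: "codifferential W \<delta>W" and codiff_M: "codifferential M \<mu>M"
    and \<delta>_def: "\<delta> = ext_W \<delta>W" and \<mu>_def: "\<mu> = ext_M \<mu>M"
begin

lemma \<delta>_odd2: "\<delta> \<in> odd2"
  using codiff_W W.odd_iff_parity[of \<delta>W] W.Hom_ml[of \<delta>W 2]
  by (auto simp: codifferential_def \<delta>_def odd2_def ext_W_Hom ext_parity fun_eq_iff ext_W_apply)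

lemma \<mu>_odd2: "\<mu> \<in> odd2"
  using codiff_M M.odd_iff_parity[of \<mu>M] M.Hom_ml[of \<mu>M 2]
  by (auto simp: codifferential_def \<mu>_def odd2_def ext_M_Hom ext_parity fun_eq_iff ext_M_apply)

lemma \<delta>_wt: "wt 0 \<delta>" and \<mu>_wt: "wt 1 \<mu>"
  using codiff_W codiff_M wt_ext_M[of \<mu>M 2]
  by (simp_all add: \<delta>_def \<mu>_def codifferential_def wt_ext_W W.Hom_ml[of \<delta>W 2])

lemma br_\<mu>_\<mu>: "bracket V \<mu> \<mu> = 0"
  using codiff_M by (simp add: \<mu>_def ext_M_bracket codifferential_def fun_eq_iff ext_M_apply zero_prod_def)

text \<open>Each cochain takes values in the summand on which the other vanishes, so both insertions
  are zero.\<close>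

lemma br_\<mu>_\<delta>: "bracket V \<mu> \<delta> = 0"
proof -
  have "multilinear W \<delta>W" "multilinear M \<mu>M"
    using codiff_W codiff_M by (simp_all add: codifferential_def Hom_def)
  then have "comp_deg V 1 \<delta> \<mu> = 0" "comp_deg V 1 \<mu> \<delta> = 0"
    by (simp_all add: comp_deg_def \<delta>_def \<mu>_def ext_W_apply ext_M_apply fun_eq_iff W.ml_zero M.ml_zero
        flip: zero_prod_def)
  then show ?thesis
    using \<delta>_odd2 \<mu>_odd2 by (simp add: V.br_odd_odd odd2_ml odd2_parity)
qed

text \<open>Weight 0 still allows values in \<open>W\<close> on words without letters from
  \<open>M\<close>; the explicit formula excludes them, since \<open>\<mu>\<close> and
  \<open>\<beta>\<close> both take values in \<open>M\<close>.\<close>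

lemma br_\<mu>_rest_lam:
  assumes "\<beta> \<in> rest M W"
  shows "bracket V \<mu> \<beta> \<in> lam_cochains"
proof -
  have o: "bracket V \<mu> \<beta> \<in> odd2" using assms \<mu>_odd2 by (rule odd2_br_rest[rotated])
  have "wt (1 + (-1)) (bracket V \<mu> \<beta>)"
    using assms by (intro wt_br rest_wt \<mu>_wt odd2_ml C_ml[OF rest_C] \<mu>_odd2)
  moreover have "snd (bracket V \<mu> \<beta> vs) = 0" for vs
  proof (cases "length vs = 2")
    case True
    then obtain x y where "vs = [x, y]" by (metis (no_types, opaque_lifting) One_nat_def Suc_1 Suc_length_conv length_0_conv)
    then show ?thesis
      using assms \<mu>_odd2 by (simp add: br_rest_apply snd_C[OF rest_C]) (simp add: \<mu>_def ext_M_apply)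
  next
    case False
    then show ?thesis using V.Hom_length[OF odd2_Hom[OF o]] by simp
  qed
  ultimately show ?thesis using odd2_Hom[OF o] o by (simp add: lam_cochains_def C_iff numeral_2_eq_2)
qed

lemma alpha_odd2: "l \<in> lam_cochains \<Longrightarrow> \<delta> + l \<in> odd2" and alpha_wt: "l \<in> lam_cochains \<Longrightarrow> wt 0 (\<delta> + l)"
  by (simp_all add: odd2_plus \<delta>_odd2 lam_odd2 wt_plus \<delta>_wt lam_wt)

lemma d_odd2: "l \<in> lam_cochains \<Longrightarrow> p \<in> psi_cochains \<Longrightarrow> \<delta> + \<mu> + l + p \<in> odd2"
  by (simp add: odd2_plus \<delta>_odd2 \<mu>_odd2 lam_odd2 psi_odd2)

text \<open>With \<open>\<delta> + l\<close> treated as one cochain of weight 0, the brackets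
  \<open>[\<mu>, \<mu>]\<close>, \<open>[\<psi>, \<psi>]\<close> and
  \<open>[\<mu>, \<delta>]\<close> vanish. What remains of \<open>[d, d]\<close> falls into the
  weights 1, 0 and -1, which are independent by \<open>wt_unique\<close>.\<close>

lemma is_extension_iff:
  "is_extension M W \<delta> \<mu> l p \<longleftrightarrow> l \<in> lam_cochains \<and> p \<in> psi_cochains \<and> bracket V \<mu> l = 0 \<and>
     bracket V (\<delta> + l) (\<delta> + l) + (bracket V \<mu> p + bracket V \<mu> p) = 0 \<and> bracket V (\<delta> + l) p = 0"
proof -
  have "bracket V (\<delta> + \<mu> + l + p) (\<delta> + \<mu> + l + p) = 0 \<longleftrightarrow> bracket V \<mu> l = 0 \<and>
     bracket V (\<delta> + l) (\<delta> + l) + (bracket V \<mu> p + bracket V \<mu> p) = 0 \<and> bracket V (\<delta> + l) p = 0"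
    if l: "l \<in> lam_cochains" and p: "p \<in> psi_cochains"
  proof -
    let ?a = "\<delta> + l"
    let ?x = "bracket V \<mu> l + bracket V \<mu> l"
      and ?y = "bracket V ?a ?a + (bracket V \<mu> p + bracket V \<mu> p)"
      and ?z = "bracket V ?a p + bracket V ?a p"
    have o: "?a \<in> odd2" "\<mu> \<in> odd2" "p \<in> odd2" "l \<in> odd2" "?a + \<mu> \<in> odd2"
      using l p by (simp_all add: alpha_odd2 \<mu>_odd2 psi_odd2 lam_odd2 odd2_plus)
    have "bracket V ?a \<mu> = bracket V \<mu> l"
      using o br_odd2_commute[of ?a \<mu>] V.br_plus_right[of \<mu> \<delta> l] br_\<mu>_\<delta>
      by (simp add: odd2_ml \<delta>_odd2)
    moreover have "bracket V (?a + \<mu> + p) (?a + \<mu> + p) =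
      bracket V ?a ?a + (bracket V ?a \<mu> + bracket V ?a \<mu>) + bracket V \<mu> \<mu> +
      ((bracket V ?a p + bracket V \<mu> p) + (bracket V ?a p + bracket V \<mu> p)) + bracket V p p"
      using o by (simp add: br_odd2_square V.br_plus_left[of ?a \<mu> p] odd2_ml)
    ultimately have sum: "bracket V (\<delta> + \<mu> + l + p) (\<delta> + \<mu> + l + p) = ?x + ?y + ?z"
      using br_\<mu>_\<mu> br_psi_psi[OF p] by (simp add: algebra_simps)
    have wt: "wt (0 + 0) (bracket V ?a ?a)" "wt (1 + 0) (bracket V \<mu> l)" "wt (1 + (-1)) (bracket V \<mu> p)"
      "wt (0 + (-1)) (bracket V ?a p)"
      using wt_br[OF alpha_wt[OF l] alpha_wt[OF l]] wt_br[OF \<mu>_wt lam_wt[OF l]]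
        wt_br[OF \<mu>_wt psi_wt[OF p]] wt_br[OF alpha_wt[OF l] psi_wt[OF p]] o
      by (simp_all add: odd2_ml)
    have "multilinear V (bracket V a b)" if "a \<in> odd2" "b \<in> odd2" for a b
      using V.br_Hom[OF odd2_Hom[OF that(1)] odd2_Hom[OF that(2)], of 3] by (simp add: V.Hom_ml)
    then have add: "slot_additive ?x" "slot_additive ?y" "slot_additive ?z"
      using o by (simp_all add: V.ml_additive V.ml_plus)
    have wt': "wt 1 ?x" "wt 0 ?y" "wt (-1) ?z"
      using wt by (simp_all add: wt_plus)
    \<comment> \<open>The mixed brackets of odd cochains occur twice, so the outer two equations
      come out doubled.\<close>
    have dz: "f + f = 0 \<longleftrightarrow> f = 0" for f :: "('m \<times> 'w) cochain"
      using V.double_inj_fun[of f 0] by auto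
    have "?x + ?y + ?z = 0 \<longleftrightarrow> ?x = 0 \<and> ?y = 0 \<and> ?z = 0"
      using wt_unique[OF wt' _ add] by (intro iffI) (assumption | elim conjE, simp only: add_0)+
    also have "\<dots> \<longleftrightarrow> bracket V \<mu> l = 0 \<and> ?y = 0 \<and> bracket V ?a p = 0"
      by (simp only: dz)
    finally show ?thesis using sum by simp
  qed
  then show ?thesis
    using d_odd2 by (auto simp: is_extension_def lam_cochains_iff psi_cochains_iff codifferential_V_iff)
qed

text \<open>The differences have weights 0 and -1; the zero cochain fills the slot of weight
  1.\<close>

lemma ext_components:
  assumes "\<delta> + \<mu> + l + p = \<delta> + \<mu> + l' + p'"
    "l \<in> lam_cochains" "l' \<in> lam_cochains" "p \<in> psi_cochains" "p' \<in> psi_cochains"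
  shows "l = l'" "p = p'"
proof -
  have "0 + (l - l') + (p - p') = 0" using assms(1) by (simp add: algebra_simps)
  moreover have "slot_additive (l - l')" "slot_additive (p - p')" "slot_additive (0 :: ('m \<times> 'w) cochain)"
    using assms by (simp_all add: V.ml_additive odd2_ml odd2_diff odd2_zero lam_odd2 psi_odd2)
  ultimately have "l - l' = 0 \<and> p - p' = 0"
    using wt_unique[of 0 "l - l'" "p - p'"] assms by (simp add: wt_zero wt_diff lam_wt psi_wt)
  then show "l = l'" "p = p'" by simp_all
qed

text \<open>Both sides are bilinear and can be compared on pairs \<open>[x, y]\<close>. Expanding
  the left side leaves few terms: \<open>\<delta>\<close> and \<open>\<psi>\<close> vanish as soon
  as one argument is in \<open>M\<close>, \<open>\<lambda>\<close> when both are, and only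
  \<open>\<mu>\<close> yields a term quadratic in \<open>\<beta>\<close>.\<close>

lemma pull_expc:
  assumes l: "l \<in> lam_cochains" and p: "p \<in> psi_cochains" and \<beta>: "\<beta> \<in> rest M W"
  shows "pull (expc \<beta>) (\<delta> + \<mu> + l + p) = \<delta> + \<mu> + (l + bracket V \<mu> \<beta>) +
    (p + bracket V (\<delta> + l + scale_cochain V (1/2) (bracket V \<mu> \<beta>)) \<beta>)" (is "?L = ?R")
proof
  fix vs
  let ?\<kappa> = "bracket V \<mu> \<beta>"
  let ?\<phi> = "\<delta> + l + scale_cochain V (1/2) ?\<kappa>"
  have o: "?\<kappa> \<in> odd2" "?\<phi> \<in> odd2"
    using l \<beta> \<mu>_odd2 by (simp_all add: odd2_br_rest odd2_plus odd2_scale \<delta>_odd2 lam_odd2)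
  have L: "?L \<in> odd2" using l p \<beta> by (intro odd2_pull expc_GL d_odd2)
  have R: "?R \<in> odd2" using o l p \<beta> by (simp add: odd2_plus \<delta>_odd2 \<mu>_odd2 lam_odd2 psi_odd2 odd2_br_rest)
  show "?L vs = ?R vs"
  proof (cases "length vs = 2")
    case False
    then show ?thesis using V.Hom_length[OF odd2_Hom[OF L]] V.Hom_length[OF odd2_Hom[OF R]] by metis
  next
    case True
    then obtain x y where vs: "vs = [x, y]" by (metis (no_types, opaque_lifting) One_nat_def Suc_1 Suc_length_conv length_0_conv)
    let ?b = "\<lambda>v. \<beta> [v]"
    have sb: "snd (?b v) = 0" for v using snd_C[OF rest_C[OF \<beta>]] .
    have add: "f [a + b, c] = f [a, c] + f [b, c]" "f [a, b + c] = f [a, b] + f [a, c]" if "f \<in> odd2" for f a b c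
      using V.ml_add[OF odd2_ml[OF that], of "[]" a b "[c]"] V.ml_add[OF odd2_ml[OF that], of "[a]" b c "[]"] by simp_all
    have \<delta>: "\<delta> [u, v] = 0" "\<delta> [v, u] = 0" if "snd u = 0" for u v
      using that codiff_W W.ml_zero[of \<delta>W "[]" "[snd v]"] W.ml_zero[of \<delta>W "[snd v]" "[]"]
      by (simp_all add: \<delta>_def ext_W_apply codifferential_def Hom_def zero_prod_def)
    have bz: "?b (\<mu> ws) = 0" "?b (l ws) = 0" "?b (p ws) = 0" "?b (?b v) = 0" for ws v
      using C_01[OF rest_C[OF \<beta>]] snd_C[OF lam_C[OF l]] snd_C[OF psi_C[OF p]] sb
      by (simp_all add: \<mu>_def ext_M_apply)
    have z: "\<mu> [0, v] = 0" "\<mu> [v, 0] = 0" for v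
      using V.ml_zero[OF odd2_ml[OF \<mu>_odd2], of "[]" "[v]"] V.ml_zero[OF odd2_ml[OF \<mu>_odd2], of "[v]" "[]"] by simp_all
    have b0: "?b 0 = 0" using rest_add[OF \<beta>, of 0 0] by simp
    have \<kappa>: "?\<kappa> [u, v] = \<mu> [?b u, v] + \<mu> [u, ?b v]" for u v
      using br_rest_apply[OF \<mu>_odd2 \<beta>] by (simp add: bz)
    \<comment> \<open>The origin of 1/2: since \<open>\<beta>\<close> kills its own values, each of
      the two evaluations of \<open>[\<mu>, \<beta>]\<close> reduces to
      \<open>\<mu> [\<beta> x, \<beta> y]\<close>.\<close>
    have sc: "scale_cochain V (1/2) ?\<kappa> [?b x, y] + scale_cochain V (1/2) ?\<kappa> [x, ?b y] = \<mu> [?b x, ?b y]"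
      by (simp add: scale_cochain_def \<kappa> bz z V.half_add_half)
    have "?b (scale_cochain V (1/2) ?\<kappa> [x, y]) = 0"
      using C_01[OF rest_C[OF \<beta>]] snd_C[OF lam_C[OF br_\<mu>_rest_lam[OF \<beta>]]] by (simp add: scale_cochain_def smul_V)
    then have br: "bracket V ?\<phi> \<beta> [x, y] = l [?b x, y] + l [x, ?b y] + \<mu> [?b x, ?b y] - ?b (\<delta> [x, y])"
      unfolding br_rest_apply[OF o(2) \<beta>] using sc by (simp add: rest_add[OF \<beta>] bz \<delta> sb algebra_simps)
    have d: "(\<delta> + \<mu> + l + p) [expc \<beta> x, expc \<beta> y] = \<delta> [x, y] +
      (\<mu> [x, y] + \<mu> [?b x, y] + \<mu> [x, ?b y] + \<mu> [?b x, ?b y]) + (l [x, y] + l [?b x, y] + l [x, ?b y]) + p [x, y]"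
      using C_11[OF lam_C[OF l]] C_02[OF psi_C[OF p]]
      by (simp add: expc_def add \<delta>_odd2 \<mu>_odd2 lam_odd2[OF l] psi_odd2[OF p] \<delta> sb algebra_simps)
    have "?L vs = expc (- \<beta>) ((\<delta> + \<mu> + l + p) [expc \<beta> x, expc \<beta> y])"
      by (simp add: vs pull_def inv_expc[OF \<beta>])
    \<comment> \<open>The inverse map is \<open>expc (- \<beta>)\<close>; among the components only
      \<open>\<delta>\<close> has values in \<open>W\<close>, so only it contributes a
      correction.\<close>
    also have "\<dots> = (\<delta> + \<mu> + l + p) [expc \<beta> x, expc \<beta> y] - ?b (\<delta> [x, y])"
      unfolding d by (simp add: expc_def rest_add[OF \<beta>] bz)
    also have "\<dots> = ?R vs"
      unfolding d vs unfolding plus_fun_apply br \<kappa> by (simp add: algebra_simps)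
    finally show ?thesis .
  qed
qed

end

section \<open>Cosets and group laws for block-diagonal maps\<close>

lemma coset_eq_iff:
  fixes S :: "'a::ab_group_add set"
  assumes "0 \<in> S" "\<And>x y. x \<in> S \<Longrightarrow> y \<in> S \<Longrightarrow> x - y \<in> S"
  shows "a +o S = b +o S \<longleftrightarrow> a - b \<in> S"
proof
  assume "a +o S = b +o S"
  then have "a + 0 \<in> b +o S" using assms(1) by blast
  then show "a - b \<in> S" by (simp add: set_minus_plus)
next
  have neg: "- x \<in> S" if "x \<in> S" for x using assms(2)[OF assms(1) that] by simp
  have plus: "x + y \<in> S" if "x \<in> S" "y \<in> S" for x y using assms(2)[OF that(1) neg[OF that(2)]] by simp
  assume ab: "a - b \<in> S"
  show "a +o S = b +o S"
  proof (intro set_eqI iffI)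
    fix x assume "x \<in> a +o S"
    then have "x - a \<in> S" by (simp add: set_minus_plus)
    then have "x - b \<in> S" using plus[OF _ ab] by fastforce
    then show "x \<in> b +o S" by (simp add: set_minus_plus)
  next
    fix x assume "x \<in> b +o S"
    then have "x - b \<in> S" by (simp add: set_minus_plus)
    then have "x - a \<in> S" using assms(2)[OF _ ab] by fastforce
    then show "x \<in> a +o S" by (simp add: set_minus_plus)
  qed
qed

context gpair
begin

lemma G_MW_id: "id \<in> G_MW M W"
  unfolding G_MW_def using M.GL_id W.GL_id by (force simp: map_prod.id[symmetric])

lemma G_MW_comp: "g \<in> G_MW M W \<Longrightarrow> h \<in> G_MW M W \<Longrightarrow> g \<circ> h \<in> G_MW M W"
  unfolding G_MW_def using M.GL_comp W.GL_comp by (force simp: map_prod_compose[symmetric])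

lemma G_MW_inv: "g \<in> G_MW M W \<Longrightarrow> inv g \<in> G_MW M W"
proof -
  assume "g \<in> G_MW M W"
  then obtain f h where "g = map_prod f h" "f \<in> GL M" "h \<in> GL W" by (auto simp: G_MW_def)
  moreover from this have "inv g = map_prod (inv f) (inv h)"
    by (simp add: inv_map_prod M.GL_bij W.GL_bij)
  ultimately show ?thesis unfolding G_MW_def using M.GL_inv W.GL_inv by blast
qed

lemma G_MW_bij: "g \<in> G_MW M W \<Longrightarrow> bij g"
  using G_MW_GL V.GL_bij by blast

end

context ext_data
begin

section \<open>The group action on extensions\<close>

abbreviation Gdm where "Gdm \<equiv> G_dm M W \<delta> \<mu>"
abbreviation Ggen where "Ggen \<equiv> G_gen M W \<delta> \<mu>"

lemma GdmD:
  assumes "g \<in> Gdm"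
  shows "g \<in> G_MW M W" "g \<in> GL V" "bij g" "pull g \<delta> = \<delta>" "pull g \<mu> = \<mu>"
  using assms by (auto simp: G_dm_def G_MW_GL G_MW_bij)

lemma Gdm_id: "id \<in> Gdm"
  by (simp add: G_dm_def G_MW_id V.pull_id)

lemma Gdm_comp: "g \<in> Gdm \<Longrightarrow> h \<in> Gdm \<Longrightarrow> g \<circ> h \<in> Gdm"
  by (simp add: G_dm_def G_MW_comp V.pull_pull[symmetric] G_MW_bij)

lemma Gdm_inv:
  assumes "g \<in> Gdm"
  shows "inv g \<in> Gdm"
  using V.pull_inv_pull[OF GdmD(3)[OF assms], of \<delta>] V.pull_inv_pull[OF GdmD(3)[OF assms], of \<mu>] GdmD[OF assms]
  by (simp add: G_dm_def G_MW_inv)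

lemma GgenI: "g \<in> Gdm \<Longrightarrow> \<beta> \<in> rest M W \<Longrightarrow> g \<circ> expc \<beta> \<in> Ggen"
  by (auto simp: G_gen_def)

lemma GgenE:
  assumes "h \<in> Ggen"
  obtains g \<beta> where "g \<in> Gdm" "\<beta> \<in> rest M W" "h = g \<circ> expc \<beta>"
  using assms by (auto simp: G_gen_def)

lemma Ggen_GL: "h \<in> Ggen \<Longrightarrow> h \<in> GL V"
  by (auto elim!: GgenE intro: V.GL_comp GdmD expc_GL)

lemma Ggen_bij: "h \<in> Ggen \<Longrightarrow> bij h"
  using Ggen_GL V.GL_bij by blast

lemma Ggen_id: "id \<in> Ggen"
  using GgenI[OF Gdm_id rest_zero] by (simp add: expc_zero)

lemma Ggen_comp:
  assumes "h \<in> Ggen" "k \<in> Ggen"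
  shows "h \<circ> k \<in> Ggen"
proof -
  obtain g \<beta> where h: "g \<in> Gdm" "\<beta> \<in> rest M W" "h = g \<circ> expc \<beta>" using assms(1) by (rule GgenE)
  obtain f \<gamma> where k: "f \<in> Gdm" "\<gamma> \<in> rest M W" "k = f \<circ> expc \<gamma>" using assms(2) by (rule GgenE)
  have r: "pull f \<beta> \<in> rest M W" using h k GdmD rest_pull by blast
  \<comment> \<open>The inner exponential is moved to the right of \<open>f\<close>, where the two
    exponents add.\<close>
  have "h \<circ> k = g \<circ> (expc \<beta> \<circ> f) \<circ> expc \<gamma>" by (simp add: h k comp_assoc)
  also have "\<dots> = (g \<circ> f) \<circ> expc (pull f \<beta> + \<gamma>)"
    using k by (simp add: expc_conj[OF GdmD(2), symmetric] comp_assoc expc_comp[OF r])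
  finally show ?thesis using h k r by (simp add: GgenI Gdm_comp rest_plus)
qed

lemma Ggen_inv:
  assumes "h \<in> Ggen"
  shows "inv h \<in> Ggen"
proof -
  obtain g \<beta> where h: "g \<in> Gdm" "\<beta> \<in> rest M W" "h = g \<circ> expc \<beta>" using assms by (rule GgenE)
  \<comment> \<open>Inverting reverses the factors. Each factor is padded to an element of
    \<open>G_gen\<close>, and closure under composition restores the order.\<close>
  have "inv h = (id \<circ> expc (- \<beta>)) \<circ> (inv g \<circ> expc 0)"
    using h by (simp add: o_inv_distrib bij_expc GdmD inv_expc expc_zero)
  then show ?thesis
    using h by (metis Ggen_comp GgenI Gdm_id Gdm_inv rest_uminus rest_zero)
qed

lemma gen_equiv_refl: "gen_equiv M W \<delta> \<mu> d d"
  unfolding gen_equiv_def using Ggen_id V.pull_id by metis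

lemma gen_equiv_sym: "gen_equiv M W \<delta> \<mu> d d' \<Longrightarrow> gen_equiv M W \<delta> \<mu> d' d"
  unfolding gen_equiv_def using Ggen_inv Ggen_bij V.pull_inv_pull by metis

lemma gen_equiv_trans: "gen_equiv M W \<delta> \<mu> d d' \<Longrightarrow> gen_equiv M W \<delta> \<mu> d' d'' \<Longrightarrow> gen_equiv M W \<delta> \<mu> d d''"
  unfolding gen_equiv_def using Ggen_comp Ggen_bij V.pull_pull by metis

lemma pull_gen:
  assumes g: "g \<in> Gdm" and \<beta>: "\<beta> \<in> rest M W" and l: "l \<in> lam_cochains" and p: "p \<in> psi_cochains"
  shows "pull (g \<circ> expc \<beta>) (\<delta> + \<mu> + l + p) = \<delta> + \<mu> + (pull g l + bracket V \<mu> \<beta>) +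
    (pull g p + bracket V (\<delta> + pull g l + scale_cochain V (1/2) (bracket V \<mu> \<beta>)) \<beta>)"
proof -
  have "pull (g \<circ> expc \<beta>) (\<delta> + \<mu> + l + p) = pull (expc \<beta>) (pull g (\<delta> + \<mu> + l + p))"
    using GdmD[OF g] bij_expc[OF \<beta>] by (simp add: V.pull_pull)
  also have "pull g (\<delta> + \<mu> + l + p) = \<delta> + \<mu> + pull g l + pull g p"
    using GdmD[OF g] by (simp add: V.pull_plus)
  also note pull_expc[OF lam_pull[OF GdmD(1)[OF g] l] psi_pull[OF GdmD(1)[OF g] p] \<beta>]
  finally show ?thesis .
qed

lemma pull_gen_cochains:
  assumes g: "g \<in> Gdm" and \<beta>: "\<beta> \<in> rest M W" and l: "l \<in> lam_cochains" and p: "p \<in> psi_cochains"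
  shows "pull g l + bracket V \<mu> \<beta> \<in> lam_cochains"
    "pull g p + bracket V (\<delta> + pull g l + scale_cochain V (1/2) (bracket V \<mu> \<beta>)) \<beta> \<in> psi_cochains"
proof -
  have "scale_cochain V (1/2) (bracket V \<mu> \<beta>) \<in> lam_cochains"
    using br_\<mu>_rest_lam[OF \<beta>] by (simp add: lam_cochains_def C_scale odd2_scale)
  then have "pull g l + scale_cochain V (1/2) (bracket V \<mu> \<beta>) \<in> lam_cochains"
    using lam_pull[OF GdmD(1)[OF g] l] by (simp add: lam_plus)
  from alpha_odd2[OF this] alpha_wt[OF this]
  show "pull g p + bracket V (\<delta> + pull g l + scale_cochain V (1/2) (bracket V \<mu> \<beta>)) \<beta> \<in> psi_cochains"
    using br_rest_psi[OF _ _ \<beta>] psi_pull[OF GdmD(1)[OF g] p] by (simp add: psi_plus add.assoc)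
  show "pull g l + bracket V \<mu> \<beta> \<in> lam_cochains"
    using lam_pull[OF GdmD(1)[OF g] l] br_\<mu>_rest_lam[OF \<beta>] by (rule lam_plus)
qed

lemma extension_codifferential:
  "l \<in> lam_cochains \<Longrightarrow> p \<in> psi_cochains \<Longrightarrow>
     is_extension M W \<delta> \<mu> l p \<longleftrightarrow> bracket V (\<delta> + \<mu> + l + p) (\<delta> + \<mu> + l + p) = 0"
  using d_odd2 by (auto simp: is_extension_def codifferential_V_iff lam_cochains_iff psi_cochains_iff)

text \<open>The transformed cochains inherit the extension equations from the invariance of
  \<open>[d, d] = 0\<close>; they need not be verified one by one.\<close>

lemma pull_extension:
  assumes "is_extension M W \<delta> \<mu> l p" "h \<in> GL V" "pull h (\<delta> + \<mu> + l + p) = \<delta> + \<mu> + l' + p'"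
    "l' \<in> lam_cochains" "p' \<in> psi_cochains"
  shows "is_extension M W \<delta> \<mu> l' p'"
  using assms is_extension_iff[of l p]
  by (simp add: extension_codifferential V.br_pull V.pull_zero flip: assms(3))

section \<open>The Maurer-Cartan equation\<close>

lemma B_11: "B M W \<mu> 1 1 = bracket V \<mu> ` C M W 0 1"
  by (simp add: B_def)

lemma B_0: "B M W \<mu> 0 n = {0}"
  by (simp add: B_def)

lemma elt_plus_singleton: "a +o {b} = {a + b}"
  by (auto simp: elt_set_plus_def)

lemma image_br_group:
  assumes \<phi>: "multilinear V \<phi>" and S: "0 \<in> S" "\<And>x y. x \<in> S \<Longrightarrow> y \<in> S \<Longrightarrow> x - y \<in> S" "\<And>x. x \<in> S \<Longrightarrow> multilinear V x"
  shows "0 \<in> bracket V \<phi> ` S" "x \<in> bracket V \<phi> ` S \<Longrightarrow> y \<in> bracket V \<phi> ` S \<Longrightarrow> x - y \<in> bracket V \<phi> ` S"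
proof -
  show "0 \<in> bracket V \<phi> ` S" using V.br_zero_right[OF \<phi>] S(1) by (metis image_eqI)
  assume "x \<in> bracket V \<phi> ` S" "y \<in> bracket V \<phi> ` S"
  then obtain a b where "a \<in> S" "b \<in> S" "x = bracket V \<phi> a" "y = bracket V \<phi> b" by blast
  then show "x - y \<in> bracket V \<phi> ` S"
    using S V.br_diff_right[OF \<phi>, of a b] by (metis image_eqI)
qed

lemma \<mu>_ml: "multilinear V \<mu>"
  using \<mu>_odd2 by (rule odd2_ml)

lemma B_group: "0 \<in> B M W \<mu> 1 1" "x \<in> B M W \<mu> 1 1 \<Longrightarrow> y \<in> B M W \<mu> 1 1 \<Longrightarrow> x - y \<in> B M W \<mu> 1 1"
proof -
  note * = image_br_group[OF \<mu>_ml, of "C M W 0 1", OF C_zero C_diff C_ml]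
  show "0 \<in> B M W \<mu> 1 1" unfolding B_11 by (rule *(1))
  show "x \<in> B M W \<mu> 1 1 \<Longrightarrow> y \<in> B M W \<mu> 1 1 \<Longrightarrow> x - y \<in> B M W \<mu> 1 1"
    unfolding B_11 by (rule *(2))
qed

lemma B_coset_iff: "a +o B M W \<mu> 1 1 = b +o B M W \<mu> 1 1 \<longleftrightarrow> a - b \<in> B M W \<mu> 1 1"
  by (rule coset_eq_iff[OF B_group])

lemma MC_iff:
  assumes l: "l \<in> lam_cochains"
  shows "MC M W \<mu> (\<delta> + l) \<longleftrightarrow>
    (\<exists>q\<in>C M W 0 2. bracket V (\<delta> + l) q = 0 \<and> bracket V \<mu> q = bracket V (\<delta> + l) (\<delta> + l))"
proof -
  let ?S = "{q \<in> C M W 0 2. bracket V (\<delta> + l) q = 0}"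
  have a: "multilinear V (\<delta> + l)" using alpha_odd2[OF l] by (rule odd2_ml)
  have S: "0 \<in> ?S" "\<And>x y. x \<in> ?S \<Longrightarrow> y \<in> ?S \<Longrightarrow> x - y \<in> ?S" "\<And>x. x \<in> ?S \<Longrightarrow> multilinear V x"
    using C_ml[of _ 0 2] by (simp_all add: C_zero C_diff V.br_zero_right V.br_diff_right a)
  let ?x = "bracket V (\<delta> + l) (\<delta> + l)"
  have "?x +o (bracket V \<mu> ` ?S) = 0 +o (bracket V \<mu> ` ?S) \<longleftrightarrow> ?x - 0 \<in> bracket V \<mu> ` ?S"
    by (rule coset_eq_iff[OF image_br_group[OF \<mu>_ml S]])
  then have "MC M W \<mu> (\<delta> + l) \<longleftrightarrow> ?x \<in> bracket V \<mu> ` ?S"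
    by (simp only: MC_def Let_def diff_zero)
  then show ?thesis by (simp add: image_iff Bex_def eq_commute[of ?x])
qed

lemma MC_cochains_iff:
  "l \<in> MC_cochains M W \<delta> \<mu> \<longleftrightarrow> l \<in> lam_cochains \<and> bracket V \<mu> l = 0 \<and> MC M W \<mu> (\<delta> + l)"
  by (auto simp: MC_cochains_def Z_def lam_cochains_iff)

text \<open>The condition supplies \<open>q\<close> with \<open>[\<alpha>, q] = 0\<close> and
  \<open>[\<mu>, q] = [\<alpha>, \<alpha>]\<close> for
  \<open>\<alpha> = \<delta> + \<lambda>\<close>, but of unknown parity. As \<open>\<alpha>\<close>
  and \<open>\<mu>\<close> are odd and both values are even, the odd part of \<open>q\<close>
  satisfies the same equations.\<close>

lemma MC_imp_extension:
  assumes "l \<in> MC_cochains M W \<delta> \<mu>"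
  shows "\<exists>p. is_extension M W \<delta> \<mu> l p"
proof -
  have l: "l \<in> lam_cochains" "bracket V \<mu> l = 0" using assms by (simp_all add: MC_cochains_iff)
  let ?a = "\<delta> + l"
  have a: "?a \<in> odd2" by (rule alpha_odd2[OF l(1)])
  obtain q where q: "q \<in> C M W 0 2" "bracket V ?a q = 0" "bracket V \<mu> q = bracket V ?a ?a"
    using assms MC_iff[OF l(1)] by (auto simp: MC_cochains_iff)
  let ?q = "hpart V 1 q"
  \<comment> \<open>Parity turns \<open>[\<alpha>, \<alpha>]\<close> into the bracket of two
    negatives, so this bracket is even.\<close>
  have "bracket V (- ?a) (- ?a) = bracket V ?a ?a"
    using odd2_ml[OF a] by (simp only: V.br_uminus_left V.br_uminus_right V.ml_uminus minus_minus)
  then have even: "V.parity (bracket V ?a ?a) = bracket V ?a ?a"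
    by (simp add: V.parity_br odd2_parity[OF a] del: minus_add_distrib)
  have aq: "bracket V ?a ?q = 0"
    using V.br_hpart_odd[OF odd2_ml[OF a] C_ml[OF q(1)] odd2_parity[OF a]] by (simp add: q V.parity_zero)
  have \<mu>q: "bracket V \<mu> ?q = bracket V ?a ?a"
    using V.br_hpart_odd[OF \<mu>_ml C_ml[OF q(1)] odd2_parity[OF \<mu>_odd2]] even by (simp add: q)
  have qC: "?q \<in> C M W 0 2" using q(1) by (rule C_hpart)
  have qpsi: "?q \<in> psi_cochains"
    using qC C_Hom[OF qC] V.parity_hpart(2)[of q] by (simp add: psi_cochains_def odd2_def numeral_2_eq_2)
  \<comment> \<open>The weight 0 equation reads
    \<open>[\<alpha>, \<alpha>] + 2 [\<mu>, p] = 0\<close>, which forces the factor -1/2.\<close>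
  define p where "p = scale_cochain V (1/2) (0 - ?q)"
  have p: "p \<in> psi_cochains"
    using psi_diff[OF _ qpsi, of 0] unfolding p_def
    by (simp add: psi_cochains_def C_zero odd2_zero C_scale odd2_scale)
  have "p + p = 0 - ?q"
    by (simp only: p_def scale_cochain_def fun_eq_iff plus_fun_apply V.half_add_half simp_thms)
  then have pp: "p + p = - ?q" by simp
  have "bracket V \<phi> p + bracket V \<phi> p = - bracket V \<phi> ?q" if "\<phi> \<in> odd2" for \<phi>
    using that V.br_plus_right[of \<phi> p p] V.br_uminus_right[of \<phi> ?q] p qpsi pp
    by (simp add: odd2_ml psi_odd2)
  from this[OF a] this[OF \<mu>_odd2] have "bracket V ?a p + bracket V ?a p = 0 + 0"
      "bracket V ?a ?a + (bracket V \<mu> p + bracket V \<mu> p) = 0"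
    unfolding aq \<mu>q by simp_all
  then have "is_extension M W \<delta> \<mu> l p"
    using l p V.double_inj_fun[of "bracket V ?a p" 0] by (simp add: is_extension_iff)
  then show ?thesis by blast
qed

lemma extension_imp_MC:
  assumes "is_extension M W \<delta> \<mu> l p"
  shows "l \<in> MC_cochains M W \<delta> \<mu>"
proof -
  have *: "l \<in> lam_cochains" "p \<in> psi_cochains" "bracket V \<mu> l = 0" "bracket V (\<delta> + l) p = 0"
     "bracket V (\<delta> + l) (\<delta> + l) + (bracket V \<mu> p + bracket V \<mu> p) = 0"
    using assms by (simp_all add: is_extension_iff)
  have br: "bracket V \<phi> (- (p + p)) = - (bracket V \<phi> p + bracket V \<phi> p)" if "\<phi> \<in> odd2" for \<phi>
    using *(2) odd2_ml[OF that]
    by (simp only: V.br_uminus_right V.br_plus_right V.ml_plus odd2_ml psi_odd2)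
  \<comment> \<open>Conversely, -2 times the given cochain is a witness for the Maurer-Cartan
    condition.\<close>
  have "- (p + p) \<in> C M W 0 2" using *(2) by (intro C_uminus C_plus psi_C)
  moreover have "bracket V (\<delta> + l) (- (p + p)) = 0" using br[OF alpha_odd2[OF *(1)]] *(4) by simp
  moreover have "bracket V \<mu> (- (p + p)) = bracket V (\<delta> + l) (\<delta> + l)"
    using br[OF \<mu>_odd2] *(5) by (metis eq_neg_iff_add_eq_0)
  ultimately show ?thesis
    using *(1,3) MC_iff[OF *(1)] unfolding MC_cochains_iff by blast
qed

text \<open>\<open>B M W \<mu> 1 1\<close> contains coboundaries of cochains of any parity. An odd
  coboundary already comes from the even part, which is an exponent the group can use.\<close>

lemma odd_coboundary:
  assumes "x \<in> B M W \<mu> 1 1" "x \<in> odd2"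
  shows "\<exists>\<beta>\<in>rest M W. x = bracket V \<mu> \<beta>"
proof -
  obtain \<beta> where \<beta>: "\<beta> \<in> C M W 0 1" "x = bracket V \<mu> \<beta>" using assms(1) unfolding B_11 by blast
  then have "bracket V \<mu> (hpart V 0 \<beta>) = x"
    using V.br_hpart_even[OF \<mu>_ml C_ml[OF \<beta>(1)] odd2_parity[OF \<mu>_odd2]] odd2_parity[OF assms(2)] by simp
  moreover have "hpart V 0 \<beta> \<in> rest M W"
    using C_hpart[OF \<beta>(1)] V.parity_hpart(1) by (simp add: rest_iff)
  ultimately show ?thesis by blast
qed

lemma pull_B: "g \<in> Gdm \<Longrightarrow> x \<in> B M W \<mu> 1 1 \<Longrightarrow> pull g x \<in> B M W \<mu> 1 1"
  unfolding B_11 using C_pull GdmD by (auto simp: V.br_pull[symmetric])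

text \<open>Pull-back along \<open>g\<close> preserves coboundaries because \<open>g\<close> fixes
  \<open>\<mu>\<close>, so the union runs over equal cosets; it is not empty since the coset
  contains \<open>l\<close>.\<close>

lemma actH_coset:
  assumes g: "g \<in> Gdm"
  shows "actH M W \<mu> 1 1 g (l +o B M W \<mu> 1 1) = pull g l +o B M W \<mu> 1 1"
proof -
  have "pull g x +o B M W \<mu> 1 1 = pull g l +o B M W \<mu> 1 1" if "x \<in> l +o B M W \<mu> 1 1" for x
    unfolding B_coset_iff using that pull_B[OF g, of "x - l"]
    by (simp add: V.pull_diff[OF GdmD(2)[OF g], symmetric] set_minus_plus)
  moreover have "l +o B M W \<mu> 1 1 \<noteq> {}"
    using B_group(1) by (auto simp: elt_set_plus_def)
  ultimately show ?thesis unfolding actH_def by blast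
qed

end

section \<open>Extensions with a fixed \<open>\<lambda>\<close>\<close>

text \<open>A base point is fixed: extensions with the same \<open>\<lambda>\<close> differ from it
  by a cochain \<open>\<tau>\<close>, and they are parametrized by these differences.\<close>

locale ext_base = ext_data M W \<delta>W \<mu>M \<delta> \<mu>
  for M :: "('k::field, 'm::ab_group_add) graded" and W :: "('k, 'w::ab_group_add) graded"
    and \<delta>W \<mu>M \<delta> \<mu> +
  fixes l p :: "('m \<times> 'w) cochain"
  assumes base: "is_extension M W \<delta> \<mu> l p"
begin

lemma l_lam: "l \<in> lam_cochains" and p_psi: "p \<in> psi_cochains"
  using base by (simp_all add: is_extension_iff)

abbreviation D where "D \<tau> \<equiv> \<delta> + \<mu> + l + p + \<tau>"
abbreviation al where "al \<equiv> \<delta> + l"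
abbreviation T where "T \<equiv> Z02 M W \<mu> al"
abbreviation cls where "cls \<equiv> cls02 M W \<mu> al"

lemma al_ml: "multilinear V al"
  using alpha_odd2[OF l_lam] by (rule odd2_ml)

text \<open>There are no coboundaries in the column \<open>k = 0\<close>, so classes in
  \<open>H M W \<mu> 0 n\<close> are singletons and the condition on classes is an equation of
  cochains.\<close>

lemma T_iff: "\<tau> \<in> T \<longleftrightarrow> \<tau> \<in> psi_cochains \<and> bracket V \<mu> \<tau> = 0 \<and> bracket V al \<tau> = 0"
  by (auto simp: Z02_def Z_def psi_cochains_iff Dbar_def B_0 elt_plus_singleton)

text \<open>The equations are affine in \<open>\<psi>\<close>; subtracting those of the base point
  leaves the homogeneous equations for \<open>\<tau>\<close>.\<close>

lemma T_iff_extension: "\<tau> \<in> psi_cochains \<Longrightarrow> \<tau> \<in> T \<longleftrightarrow> is_extension M W \<delta> \<mu> l (p + \<tau>)"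
proof -
  assume \<tau>: "\<tau> \<in> psi_cochains"
  have b: "bracket V al al + (bracket V \<mu> p + bracket V \<mu> p) = 0" "bracket V al p = 0" "bracket V \<mu> l = 0"
    using base by (simp_all add: is_extension_iff)
  have "bracket V \<phi> (p + \<tau>) = bracket V \<phi> p + bracket V \<phi> \<tau>" if "\<phi> \<in> odd2" for \<phi>
    using that \<tau> p_psi by (simp add: V.br_plus_right odd2_ml psi_odd2)
  from this[OF alpha_odd2[OF l_lam]] this[OF \<mu>_odd2]
  have "is_extension M W \<delta> \<mu> l (p + \<tau>) \<longleftrightarrow>
    (bracket V al al + (bracket V \<mu> p + bracket V \<mu> p)) + (bracket V \<mu> \<tau> + bracket V \<mu> \<tau>) = 0 \<and> bracket V al \<tau> = 0"
    by (simp add: is_extension_iff l_lam psi_plus[OF \<tau> p_psi] b algebra_simps)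
  also have "\<dots> \<longleftrightarrow> bracket V \<mu> \<tau> = 0 \<and> bracket V al \<tau> = 0"
    using V.double_inj_fun[of "bracket V \<mu> \<tau>" 0] unfolding b(1) by auto
  finally show ?thesis by (simp add: T_iff \<tau>)
qed

lemma T_psi: "\<tau> \<in> T \<Longrightarrow> \<tau> \<in> psi_cochains"
  by (simp add: T_iff)

text \<open>A class of the second cohomology is a coset of cosets; the inner ones being singletons,
  it is a set of singletons.\<close>

lemma cls_eq: "cls \<tau> = (\<lambda>\<beta>. {\<tau> + bracket V al \<beta>}) ` Z M W \<mu> 0 1"
proof -
  have "H M W \<mu> 0 1 = (\<lambda>\<beta>. {\<beta>}) ` Z M W \<mu> 0 1"
    by (auto simp: H_def B_0 elt_plus_singleton)
  then show ?thesis
    by (auto simp: cls02_def B_0 elt_plus_singleton Dbar_def elt_set_plus_def set_plus_def image_image)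
qed

lemma cls_eq_iff: "cls \<tau> = cls \<tau>' \<longleftrightarrow> (\<exists>\<beta>\<in>Z M W \<mu> 0 1. \<tau>' = \<tau> + bracket V al \<beta>)"
proof
  assume eq: "cls \<tau> = cls \<tau>'"
  have "0 \<in> Z M W \<mu> 0 1" by (simp add: Z_def C_zero V.br_zero_right \<mu>_ml)
  then have "{\<tau>'} \<in> cls \<tau>'" unfolding cls_eq by (rule rev_image_eqI) (simp add: V.br_zero_right al_ml)
  then show "\<exists>\<beta>\<in>Z M W \<mu> 0 1. \<tau>' = \<tau> + bracket V al \<beta>"
    unfolding eq[symmetric] unfolding cls_eq by auto
next
  assume "\<exists>\<beta>\<in>Z M W \<mu> 0 1. \<tau>' = \<tau> + bracket V al \<beta>"
  then obtain \<beta> where \<beta>: "\<beta> \<in> Z M W \<mu> 0 1" "\<tau>' = \<tau> + bracket V al \<beta>" by blast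
  have "\<gamma> + \<beta> \<in> Z M W \<mu> 0 1" "\<gamma> - \<beta> \<in> Z M W \<mu> 0 1" "multilinear V \<gamma>" if "\<gamma> \<in> Z M W \<mu> 0 1" for \<gamma>
    using that \<beta>(1) C_ml[of _ 0 1]
    by (simp_all add: Z_def C_plus C_diff V.br_plus_right V.br_diff_right \<mu>_ml del: One_nat_def)
  note Z = this and \<beta>ml = this(3)[OF \<beta>(1)]
  have 1: "\<tau>' + bracket V al \<gamma> = \<tau> + bracket V al (\<gamma> + \<beta>)" if "\<gamma> \<in> Z M W \<mu> 0 1" for \<gamma>
    using Z(3)[OF that] \<beta>ml by (simp add: \<beta>(2) V.br_plus_right al_ml add_ac)
  have 2: "\<tau> + bracket V al \<gamma> = \<tau>' + bracket V al (\<gamma> - \<beta>)" if "\<gamma> \<in> Z M W \<mu> 0 1" for \<gamma>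
    using Z(3)[OF that] \<beta>ml by (simp add: \<beta>(2) V.br_diff_right al_ml)
  show "cls \<tau> = cls \<tau>'"
    unfolding cls_eq
  proof (intro subset_antisym image_subsetI)
    fix \<gamma> assume \<gamma>: "\<gamma> \<in> Z M W \<mu> 0 1"
    show "{\<tau> + bracket V al \<gamma>} \<in> (\<lambda>\<gamma>. {\<tau>' + bracket V al \<gamma>}) ` Z M W \<mu> 0 1"
      unfolding 2[OF \<gamma>] by (rule imageI) (rule Z(2)[OF \<gamma>])
    show "{\<tau>' + bracket V al \<gamma>} \<in> (\<lambda>\<gamma>. {\<tau> + bracket V al \<gamma>}) ` Z M W \<mu> 0 1"
      unfolding 1[OF \<gamma>] by (rule imageI) (rule Z(1)[OF \<gamma>])
  qed
qed

text \<open>The cocycle relating two representatives may have any parity. Its even part has the same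
  bracket with \<open>\<delta> + \<lambda>\<close>, as that bracket is odd, and it remains a cocycle
  because 0 counts as odd.\<close>

lemma cls_eq_even:
  assumes "cls \<tau> = cls \<tau>'" "\<tau> \<in> T" "\<tau>' \<in> T"
  obtains \<beta> where "\<beta> \<in> rest M W" "bracket V \<mu> \<beta> = 0" "\<tau>' = \<tau> + bracket V al \<beta>"
proof -
  obtain \<beta> where \<beta>: "\<beta> \<in> C M W 0 1" "bracket V \<mu> \<beta> = 0" "\<tau>' = \<tau> + bracket V al \<beta>"
    using assms(1) by (auto simp: cls_eq_iff Z_def)
  have "bracket V al \<beta> = \<tau>' - \<tau>" using \<beta>(3) by simp
  then have "bracket V al \<beta> \<in> odd2" using assms T_psi psi_diff psi_odd2 by metis
  then have "bracket V al (hpart V 0 \<beta>) = bracket V al \<beta>"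
    using V.br_hpart_even[OF al_ml C_ml[OF \<beta>(1)] odd2_parity[OF alpha_odd2[OF l_lam]]] odd2_parity by blast
  moreover have "bracket V \<mu> (hpart V 0 \<beta>) = 0"
    using V.br_hpart_even[OF \<mu>_ml C_ml[OF \<beta>(1)] odd2_parity[OF \<mu>_odd2]] \<beta>(2) by (simp add: V.parity_zero)
  moreover have "hpart V 0 \<beta> \<in> rest M W"
    using C_hpart[OF \<beta>(1)] V.parity_hpart(1) by (simp add: rest_iff)
  ultimately show thesis using that \<beta>(3) by metis
qed

lemma cls_eqI: "\<beta> \<in> rest M W \<Longrightarrow> bracket V \<mu> \<beta> = 0 \<Longrightarrow> cls \<tau> = cls (\<tau> + bracket V al \<beta>)"
  unfolding cls_eq_iff using rest_C[of \<beta>] by (intro bexI[of _ \<beta>]) (simp_all add: Z_def)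

lemma pull_D_expc:
  assumes \<tau>: "\<tau> \<in> T" and \<beta>: "\<beta> \<in> rest M W" "bracket V \<mu> \<beta> = 0"
  shows "pull (expc \<beta>) (D \<tau>) = D (\<tau> + bracket V al \<beta>)"
proof -
  have "scale_cochain V (1/2) (0 :: ('m \<times> 'w) cochain) = 0"
    by (simp add: scale_cochain_def fun_eq_iff)
  then show ?thesis
    using pull_expc[OF l_lam psi_plus[OF p_psi T_psi[OF \<tau>]] \<beta>(1)] \<beta>(2) by (simp add: add.assoc)
qed

lemma cls_eq_imp_equiv:
  assumes "cls \<tau> = cls \<tau>'" "\<tau> \<in> T" "\<tau>' \<in> T"
  shows "gen_equiv M W \<delta> \<mu> (D \<tau>) (D \<tau>')"
proof -
  obtain \<beta> where \<beta>: "\<beta> \<in> rest M W" "bracket V \<mu> \<beta> = 0" "\<tau>' = \<tau> + bracket V al \<beta>"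
    using assms by (rule cls_eq_even)
  have "expc \<beta> \<in> Ggen" using GgenI[OF Gdm_id \<beta>(1)] by simp
  then show ?thesis unfolding gen_equiv_def using pull_D_expc[OF assms(2) \<beta>(1,2)] \<beta>(3) by metis
qed

text \<open>Here +1/2 becomes the -1/2 of the action: for a stabilizing element
  \<open>pull g l\<close> is \<open>l - [\<mu>, \<beta>]\<close>, and subtracting all while adding
  half leaves minus one half.\<close>

lemma half_shift: "\<delta> + (x - y) + scale_cochain V (1/2) y = \<delta> + x - scale_cochain V (1/2) y"
proof -
  have "y vs = smul V (1/2) (y vs) + smul V (1/2) (y vs)" for vs by (simp add: V.half_add_half)
  then have "scale_cochain V (1/2) y + scale_cochain V (1/2) y = y"
    by (simp add: scale_cochain_def fun_eq_iff)
  then show ?thesis by (simp add: algebra_simps)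
qed

text \<open>The action of \<open>h\<close> on \<open>\<tau>\<close> read off from the pull-back of
  whole codifferentials. Its properties then follow from group laws rather than from the explicit
  formula.\<close>

definition shift where "shift h \<tau> = pull h (D \<tau>) - D 0"

lemma D_shift: "D (shift h \<tau>) = pull h (D \<tau>)"
  by (simp add: shift_def)

lemma shift_formula:
  assumes g: "g \<in> Gdm" and \<beta>: "\<beta> \<in> rest M W" and l: "l = pull g l + bracket V \<mu> \<beta>" and \<tau>: "\<tau> \<in> T"
  shows "pull g p - p + pull g \<tau> + bracket V (al - scale_cochain V (1/2) (bracket V \<mu> \<beta>)) \<beta> = shift (g \<circ> expc \<beta>) \<tau>"
proof -
  have l': "pull g l = l - bracket V \<mu> \<beta>" using l by (metis add_diff_cancel_right')
  have "pull (g \<circ> expc \<beta>) (D \<tau>) = \<delta> + \<mu> + l +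
      (pull g (p + \<tau>) + bracket V (al - scale_cochain V (1/2) (bracket V \<mu> \<beta>)) \<beta>)"
    using pull_gen[OF g \<beta> l_lam psi_plus[OF p_psi T_psi[OF \<tau>]]]
    unfolding l[symmetric] l' half_shift by (simp add: add.assoc)
  then show ?thesis
    by (simp add: shift_def V.pull_plus[OF GdmD(2)[OF g]] algebra_simps)
qed

lemma shift_T:
  assumes g: "g \<in> Gdm" and \<beta>: "\<beta> \<in> rest M W" and l: "l = pull g l + bracket V \<mu> \<beta>" and \<tau>: "\<tau> \<in> T"
  shows "shift (g \<circ> expc \<beta>) \<tau> \<in> T"
proof -
  let ?h = "g \<circ> expc \<beta>"
  let ?q = "pull g (p + \<tau>) + bracket V (\<delta> + pull g l + scale_cochain V (1/2) (bracket V \<mu> \<beta>)) \<beta>"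
  have pt: "p + \<tau> \<in> psi_cochains" using psi_plus[OF p_psi T_psi[OF \<tau>]] .
  have q: "?q \<in> psi_cochains" using pull_gen_cochains(2)[OF g \<beta> l_lam pt] .
  have eq: "pull ?h (\<delta> + \<mu> + l + (p + \<tau>)) = \<delta> + \<mu> + l + ?q"
    using pull_gen[OF g \<beta> l_lam pt] l by simp
  have "shift ?h \<tau> = ?q - p"
    using eq by (simp add: shift_def algebra_simps)
  then have s: "shift ?h \<tau> \<in> psi_cochains" "p + shift ?h \<tau> = ?q" using q p_psi by (simp_all add: psi_diff)
  have "is_extension M W \<delta> \<mu> l (p + \<tau>)" using T_iff_extension[OF T_psi] \<tau> by blast
  then have "is_extension M W \<delta> \<mu> l ?q"
    using Ggen_GL[OF GgenI[OF g \<beta>]] eq l_lam q by (rule pull_extension)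
  then show ?thesis using T_iff_extension[OF s(1)] s(2) by simp
qed

text \<open>Comparing the components of weight 0: an equivalence between two extensions with the
  same \<open>\<lambda>\<close> must fix it.\<close>

lemma stabilizer:
  assumes g: "g \<in> Gdm" and \<beta>: "\<beta> \<in> rest M W" and \<tau>: "\<tau> \<in> T" "\<tau>' \<in> T"
    and eq: "pull (g \<circ> expc \<beta>) (D \<tau>) = D \<tau>'"
  shows "l = pull g l + bracket V \<mu> \<beta>"
proof -
  have pt: "p + \<tau> \<in> psi_cochains" "p + \<tau>' \<in> psi_cochains" using psi_plus[OF p_psi T_psi] \<tau> by blast+
  note c = pull_gen_cochains[OF g \<beta> l_lam pt(1)]
  have "\<delta> + \<mu> + l + (p + \<tau>') = pull (g \<circ> expc \<beta>) (\<delta> + \<mu> + l + (p + \<tau>))"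
    using eq by (simp only: add.assoc)
  then show ?thesis
    unfolding pull_gen[OF g \<beta> l_lam pt(1)] by (rule ext_components(1)[OF _ l_lam c(1) pt(2) c(2)])
qed

text \<open>Adding a coboundary is the action of some \<open>expc \<gamma>\<close>. Conjugated past
  \<open>h\<close> it becomes \<open>expc (pull g \<gamma>)\<close>, because exponentials commute,
  and \<open>pull g \<gamma>\<close> is again a cocycle since \<open>g\<close> fixes
  \<open>\<mu>\<close>. So the result changes by a coboundary.\<close>

lemma shift_cls:
  assumes g: "g \<in> Gdm" and \<beta>: "\<beta> \<in> rest M W" and l: "l = pull g l + bracket V \<mu> \<beta>"
    and \<tau>: "\<tau> \<in> T" "\<sigma> \<in> T" and eq: "cls \<tau> = cls \<sigma>"
  shows "cls (shift (g \<circ> expc \<beta>) \<tau>) = cls (shift (g \<circ> expc \<beta>) \<sigma>)"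
proof -
  let ?h = "g \<circ> expc \<beta>"
  obtain \<gamma> where \<gamma>: "\<gamma> \<in> rest M W" "bracket V \<mu> \<gamma> = 0" "\<sigma> = \<tau> + bracket V al \<gamma>"
    using eq \<tau> by (rule cls_eq_even)
  let ?\<gamma> = "pull g \<gamma>"
  have r: "?\<gamma> \<in> rest M W" using rest_pull[OF GdmD(1)[OF g] \<gamma>(1)] .
  have z: "bracket V \<mu> ?\<gamma> = 0"
    using V.br_pull[OF GdmD(2)[OF g], of \<mu> \<gamma>] \<gamma>(2) GdmD(5)[OF g] by (simp add: V.pull_zero[OF GdmD(2)[OF g]])
  have "expc \<gamma> \<circ> ?h = g \<circ> (expc ?\<gamma> \<circ> expc \<beta>)"
    by (simp add: comp_assoc[symmetric] expc_conj[OF GdmD(2)[OF g]])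
  also have "\<dots> = ?h \<circ> expc ?\<gamma>"
    using expc_comp[OF r \<beta>] expc_comp[OF \<beta> r] by (simp add: comp_assoc add.commute)
  finally have comm: "expc \<gamma> \<circ> ?h = ?h \<circ> expc ?\<gamma>" .
  have bij: "bij ?h" using Ggen_bij[OF GgenI[OF g \<beta>]] .
  have "D (shift ?h \<sigma>) = pull ?h (pull (expc \<gamma>) (D \<tau>))"
    using pull_D_expc[OF \<tau>(1) \<gamma>(1,2)] \<gamma>(3) by (simp add: D_shift)
  also have "\<dots> = pull (expc ?\<gamma>) (pull ?h (D \<tau>))"
    using V.pull_pull[OF bij_expc[OF \<gamma>(1)] bij] V.pull_pull[OF bij bij_expc[OF r]] comm by simp
  also have "\<dots> = pull (expc ?\<gamma>) (D (shift ?h \<tau>))" by (simp only: D_shift)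
  also have "\<dots> = D (shift ?h \<tau> + bracket V al ?\<gamma>)"
    using pull_D_expc[OF shift_T[OF g \<beta> l \<tau>(1)] r z] .
  finally have "shift ?h \<sigma> = shift ?h \<tau> + bracket V al ?\<gamma>" by simp
  then show ?thesis using cls_eqI[OF r z] by simp
qed

lemma act02_cls:
  assumes g: "g \<in> Gdm" and \<beta>: "\<beta> \<in> rest M W" and l: "l = pull g l + bracket V \<mu> \<beta>" and \<tau>: "\<tau> \<in> T"
  shows "act02 M W \<delta> \<mu> l p (g \<circ> expc \<beta>) (cls \<tau>) = cls (shift (g \<circ> expc \<beta>) \<tau>)"
proof -
  let ?h = "g \<circ> expc \<beta>"
  let ?E = "\<lambda>g \<beta> \<tau>. pull g p - p + pull g \<tau> + bracket V (al - scale_cochain V (1/2) (bracket V \<mu> \<beta>)) \<beta>"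
  let ?F = "{cls (?E g' \<gamma> \<sigma>) | g' \<gamma> \<sigma>. g' \<in> Gdm \<and> \<gamma> \<in> rest M W \<and> ?h = g' \<circ> expc \<gamma> \<and> \<sigma> \<in> T \<and> cls \<sigma> = cls \<tau>}"
  have "cls (?E g' \<gamma> \<sigma>) = cls (shift ?h \<tau>)"
    if *: "g' \<in> Gdm" "\<gamma> \<in> rest M W" "?h = g' \<circ> expc \<gamma>" "\<sigma> \<in> T" "cls \<sigma> = cls \<tau>" for g' \<gamma> \<sigma>
  proof -
    \<comment> \<open>Uniqueness of the factors of \<open>h\<close> is bypassed: the pull-back
      depends on \<open>h\<close> alone, so any factorization satisfies the stabilizer equation and
      leads to the same \<open>shift\<close>.\<close>
    have "l = pull g' l + bracket V \<mu> \<gamma>"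
      by (rule stabilizer[OF *(1,2) \<tau> shift_T[OF g \<beta> l \<tau>]]) (simp only: D_shift *(3))
    from shift_formula[OF *(1,2) this *(4)] show ?thesis
      using shift_cls[OF g \<beta> l *(4) \<tau> *(5)] *(3) by simp
  qed
  then have "?F = {cls (shift ?h \<tau>)}" using g \<beta> \<tau> by blast
  then show ?thesis unfolding act02_def Let_def by simp
qed

lemma act02_orbit:
  assumes \<tau>: "\<tau> \<in> T"
  shows "(\<lambda>h. act02 M W \<delta> \<mu> l p h (cls \<tau>)) ` G_dml M W \<delta> \<mu> l = cls ` {\<tau>' \<in> T. gen_equiv M W \<delta> \<mu> (D \<tau>) (D \<tau>')}"
proof (intro subset_antisym subsetI)
  fix x assume "x \<in> (\<lambda>h. act02 M W \<delta> \<mu> l p h (cls \<tau>)) ` G_dml M W \<delta> \<mu> l"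
  then obtain g \<beta> where *: "g \<in> Gdm" "\<beta> \<in> rest M W" "l = pull g l + bracket V \<mu> \<beta>"
      "x = act02 M W \<delta> \<mu> l p (g \<circ> expc \<beta>) (cls \<tau>)"
    unfolding G_dml_def by blast
  moreover have "gen_equiv M W \<delta> \<mu> (D \<tau>) (D (shift (g \<circ> expc \<beta>) \<tau>))"
    unfolding gen_equiv_def D_shift using GgenI[OF *(1,2)] by blast
  ultimately show "x \<in> cls ` {\<tau>' \<in> T. gen_equiv M W \<delta> \<mu> (D \<tau>) (D \<tau>')}"
    using act02_cls[OF *(1-3) \<tau>] shift_T[OF *(1-3) \<tau>] by blast
next
  fix x assume "x \<in> cls ` {\<tau>' \<in> T. gen_equiv M W \<delta> \<mu> (D \<tau>) (D \<tau>')}"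
  then obtain \<tau>' h where *: "\<tau>' \<in> T" "x = cls \<tau>'" "h \<in> Ggen" "D \<tau>' = pull h (D \<tau>)"
    unfolding gen_equiv_def by blast
  obtain g \<beta> where h: "g \<in> Gdm" "\<beta> \<in> rest M W" "h = g \<circ> expc \<beta>" using *(3) by (rule GgenE)
  \<comment> \<open>The element \<open>h\<close> was an arbitrary equivalence; sharing
    \<open>\<lambda>\<close> at both ends forces it into the stabilizer.\<close>
  have l: "l = pull g l + bracket V \<mu> \<beta>" using stabilizer[OF h(1,2) \<tau> *(1)] *(4) h(3) by simp
  then have "h \<in> G_dml M W \<delta> \<mu> l" unfolding G_dml_def using h by blast
  moreover have "\<tau>' = shift h \<tau>" using *(4) unfolding D_shift[symmetric] by simp
  ultimately show "x \<in> (\<lambda>h. act02 M W \<delta> \<mu> l p h (cls \<tau>)) ` G_dml M W \<delta> \<mu> l"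
    using act02_cls[OF h(1,2) l \<tau>] *(2) h(3) by auto
qed

lemma orbits02_eq: "orbits02 M W \<delta> \<mu> l p = (\<lambda>\<tau>. cls ` {\<tau>' \<in> T. gen_equiv M W \<delta> \<mu> (D \<tau>) (D \<tau>')}) ` T"
  unfolding orbits02_def H02_def image_image using act02_orbit by simp

text \<open>Membership only concerns classes, so the equivalent cochain may be another
  representative; cohomologous representatives give equivalent extensions.\<close>

lemma cls_mem_orbit_iff:
  assumes "\<tau> \<in> T" "\<sigma> \<in> T"
  shows "cls \<sigma> \<in> cls ` {\<tau>' \<in> T. gen_equiv M W \<delta> \<mu> (D \<tau>) (D \<tau>')} \<longleftrightarrow> gen_equiv M W \<delta> \<mu> (D \<tau>) (D \<sigma>)"
proof
  assume "cls \<sigma> \<in> cls ` {\<tau>' \<in> T. gen_equiv M W \<delta> \<mu> (D \<tau>) (D \<tau>')}"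
  then obtain \<tau>' where "\<tau>' \<in> T" "gen_equiv M W \<delta> \<mu> (D \<tau>) (D \<tau>')" "cls \<tau>' = cls \<sigma>" by auto
  then show "gen_equiv M W \<delta> \<mu> (D \<tau>) (D \<sigma>)"
    using cls_eq_imp_equiv[of \<tau>' \<sigma>] gen_equiv_trans assms(2) by blast
qed (use assms in blast)

lemma orbit_mem_equiv:
  assumes "\<O> \<in> orbits02 M W \<delta> \<mu> l p" "\<sigma> \<in> T" "cls \<sigma> \<in> \<O>"
  shows "\<O> = cls ` {\<tau>' \<in> T. gen_equiv M W \<delta> \<mu> (D \<sigma>) (D \<tau>')}"
proof -
  obtain \<tau> where \<tau>: "\<tau> \<in> T" "\<O> = cls ` {\<tau>' \<in> T. gen_equiv M W \<delta> \<mu> (D \<tau>) (D \<tau>')}"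
    using assms(1) by (auto simp: orbits02_eq)
  then have "gen_equiv M W \<delta> \<mu> (D \<tau>) (D \<sigma>)" using assms cls_mem_orbit_iff by blast
  then show ?thesis using \<tau>(2) gen_equiv_trans gen_equiv_sym by blast
qed

lemma D_extension: "\<tau> \<in> T \<Longrightarrow> D \<tau> \<in> extensions M W \<delta> \<mu>"
  using T_iff_extension[OF T_psi] unfolding extensions_def by (force simp: add.assoc)

end

section \<open>Passing between \<open>\<lambda>\<close>-classes, and the classification\<close>

context ext_data
begin

lemma gen_equiv_lam_class:
  assumes l: "l \<in> lam_cochains" "p \<in> psi_cochains" and l': "l' \<in> lam_cochains" "p' \<in> psi_cochains"
    and eq: "gen_equiv M W \<delta> \<mu> (\<delta> + \<mu> + l + p) (\<delta> + \<mu> + l' + p')"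
  obtains g where "g \<in> Gdm" "l' +o B M W \<mu> 1 1 = actH M W \<mu> 1 1 g (l +o B M W \<mu> 1 1)"
proof -
  obtain g \<beta> where g: "g \<in> Gdm" "\<beta> \<in> rest M W"
     "\<delta> + \<mu> + l' + p' = pull (g \<circ> expc \<beta>) (\<delta> + \<mu> + l + p)"
    using eq unfolding gen_equiv_def by (metis GgenE)
  note c = pull_gen_cochains[OF g(1,2) l]
  have "l' = pull g l + bracket V \<mu> \<beta>"
    using g(3) unfolding pull_gen[OF g(1,2) l] by (rule ext_components(1)[OF _ l'(1) c(1) l'(2) c(2)])
  then have "l' - pull g l \<in> B M W \<mu> 1 1"
    unfolding B_11 using rest_C[OF g(2)] by simp
  then show thesis using that[OF g(1)] unfolding actH_coset[OF g(1)] B_coset_iff by blast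
qed

text \<open>Equality of classes gives \<open>l'\<close> only up to a coboundary. The coboundary is
  odd, hence of the form \<open>[\<mu>, \<beta>]\<close> with \<open>\<beta>\<close> even, and
  \<open>g \<circ> expc \<beta>\<close> carries \<open>l\<close> to \<open>l'\<close> exactly. The
  discrepancy left between the last components is \<open>\<tau>\<close>.\<close>

lemma lam_class_gen_equiv:
  assumes d: "is_extension M W \<delta> \<mu> l p" and l': "is_extension M W \<delta> \<mu> l' p'" and g: "g \<in> Gdm"
    and cls: "l' +o B M W \<mu> 1 1 = actH M W \<mu> 1 1 g (l +o B M W \<mu> 1 1)"
  obtains \<tau> where "\<tau> \<in> Z02 M W \<mu> (\<delta> + l')" "gen_equiv M W \<delta> \<mu> (\<delta> + \<mu> + l + p) (\<delta> + \<mu> + l' + p' + \<tau>)"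
proof -
  interpret E: ext_base M W \<delta>W \<mu>M \<delta> \<mu> l' p' by unfold_locales (rule l')
  have l: "l \<in> lam_cochains" "p \<in> psi_cochains" using d by (simp_all add: is_extension_iff)
  have "l' - pull g l \<in> B M W \<mu> 1 1" using cls unfolding actH_coset[OF g] B_coset_iff .
  moreover have "l' - pull g l \<in> odd2"
    using lam_pull[OF GdmD(1)[OF g] l(1)] E.l_lam by (simp add: odd2_diff lam_odd2)
  ultimately obtain \<beta> where \<beta>: "\<beta> \<in> rest M W" "l' - pull g l = bracket V \<mu> \<beta>"
    using odd_coboundary by blast
  let ?h = "g \<circ> expc \<beta>"
  let ?q = "pull g p + bracket V (\<delta> + pull g l + scale_cochain V (1/2) (bracket V \<mu> \<beta>)) \<beta>"
  have "pull g l + bracket V \<mu> \<beta> = l'" using \<beta>(2) by (simp add: algebra_simps)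
  then have eq: "pull ?h (\<delta> + \<mu> + l + p) = \<delta> + \<mu> + l' + ?q"
    using pull_gen[OF g \<beta>(1) l] by simp
  have q: "?q \<in> psi_cochains" using pull_gen_cochains(2)[OF g \<beta>(1) l] .
  have "is_extension M W \<delta> \<mu> l' ?q"
    using d Ggen_GL[OF GgenI[OF g \<beta>(1)]] eq E.l_lam q by (rule pull_extension)
  moreover have s: "?q - p' \<in> psi_cochains" "p' + (?q - p') = ?q" using q E.p_psi by (simp_all add: psi_diff)
  ultimately have "?q - p' \<in> E.T" using E.T_iff_extension[OF s(1)] by simp
  moreover have "pull ?h (\<delta> + \<mu> + l + p) = \<delta> + \<mu> + l' + p' + (?q - p')" using eq by simp
  ultimately show thesis using that GgenI[OF g \<beta>(1)] unfolding gen_equiv_def by metis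
qed

context
  fixes R :: "('m \<times> 'w) cochain set set" and lam psi :: "('m \<times> 'w) cochain set \<Rightarrow> ('m \<times> 'w) cochain"
  assumes R_classes: "R \<subseteq> MC_classes M W \<delta> \<mu>"
    and R_transversal: "\<And>\<O>. \<O> \<in> MC_orbits M W \<delta> \<mu> \<Longrightarrow> \<exists>!X. X \<in> R \<inter> \<O>"
    and R_choice: "\<And>X. X \<in> R \<Longrightarrow> lam X \<in> X" "\<And>X. X \<in> R \<Longrightarrow> is_extension M W \<delta> \<mu> (lam X) (psi X)"
begin

lemma R_ext_base: "X \<in> R \<Longrightarrow> ext_base M W \<delta>W \<mu>M \<delta> \<mu> (lam X) (psi X)"
  by unfold_locales (rule R_choice)

lemma R_class_eq:
  assumes "X \<in> R"
  shows "X = lam X +o B M W \<mu> 1 1"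
proof -
  obtain l where l: "X = l +o B M W \<mu> 1 1" using assms R_classes by (auto simp: MC_classes_def)
  then have "lam X - l \<in> B M W \<mu> 1 1" using R_choice(1)[OF assms] by (simp only: set_minus_plus)
  then show ?thesis using l B_coset_iff by metis
qed

text \<open>For existence, \<open>d\<close> is moved onto the representative of the orbit of its own
  \<open>\<lambda>\<close>-class. For uniqueness, equivalence preserves this orbit and so determines
  \<open>X\<close>; after that only the orbit of \<open>\<tau>\<close>-classes is in
  question.\<close>

lemma extension_representative:
  assumes "d \<in> extensions M W \<delta> \<mu>"
  shows "\<exists>!(X, \<O>). X \<in> R \<and> \<O> \<in> orbits02 M W \<delta> \<mu> (lam X) (psi X) \<and>
    (\<exists>\<tau>\<in>Z02 M W \<mu> (\<delta> + lam X). cls02 M W \<mu> (\<delta> + lam X) \<tau> \<in> \<O> \<and>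
      gen_equiv M W \<delta> \<mu> d (\<delta> + \<mu> + lam X + psi X + \<tau>))"
proof -
  obtain l q where d: "is_extension M W \<delta> \<mu> l q" "d = \<delta> + \<mu> + l + q"
    using assms by (auto simp: extensions_def)
  have lq: "l \<in> lam_cochains" "q \<in> psi_cochains" using d(1) by (simp_all add: is_extension_iff)
  let ?cl = "l +o B M W \<mu> 1 1"
  let ?start = "(\<lambda>g. actH M W \<mu> 1 1 g ?cl) ` Gdm"
  have "?start \<in> MC_orbits M W \<delta> \<mu>"
    using extension_imp_MC[OF d(1)] unfolding MC_orbits_def MC_classes_def by blast
  then obtain X where X: "X \<in> R" "X \<in> ?start" and X_unique: "\<And>Y. Y \<in> R \<Longrightarrow> Y \<in> ?start \<Longrightarrow> Y = X"
    using R_transversal by (metis IntE IntI)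
  interpret E: ext_base M W \<delta>W \<mu>M \<delta> \<mu> "lam X" "psi X" by (rule R_ext_base[OF X(1)])
  obtain g where g: "g \<in> Gdm" "X = actH M W \<mu> 1 1 g ?cl" using X(2) by blast
  have "lam X +o B M W \<mu> 1 1 = actH M W \<mu> 1 1 g ?cl" using g(2) R_class_eq[OF X(1)] by simp
  then obtain \<tau> where \<tau>: "\<tau> \<in> E.T" "gen_equiv M W \<delta> \<mu> d (E.D \<tau>)"
    using lam_class_gen_equiv[OF d(1) E.base g(1)] unfolding d(2) by blast
  let ?O = "E.cls ` {\<tau>' \<in> E.T. gen_equiv M W \<delta> \<mu> (E.D \<tau>) (E.D \<tau>')}"
  have O: "?O \<in> orbits02 M W \<delta> \<mu> (lam X) (psi X)" unfolding E.orbits02_eq using \<tau>(1) by blast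
  show ?thesis
  proof (rule ex1I[of _ "(X, ?O)"])
    have "E.cls \<tau> \<in> ?O" using \<tau>(1) gen_equiv_refl by blast
    then show "case (X, ?O) of (X, \<O>) \<Rightarrow> X \<in> R \<and> \<O> \<in> orbits02 M W \<delta> \<mu> (lam X) (psi X) \<and>
      (\<exists>\<tau>\<in>Z02 M W \<mu> (\<delta> + lam X). cls02 M W \<mu> (\<delta> + lam X) \<tau> \<in> \<O> \<and>
        gen_equiv M W \<delta> \<mu> d (\<delta> + \<mu> + lam X + psi X + \<tau>))"
      unfolding prod.case using X(1) O \<tau> by blast
  next
    fix z
    assume z: "case z of (X, \<O>) \<Rightarrow> X \<in> R \<and> \<O> \<in> orbits02 M W \<delta> \<mu> (lam X) (psi X) \<and>
      (\<exists>\<tau>\<in>Z02 M W \<mu> (\<delta> + lam X). cls02 M W \<mu> (\<delta> + lam X) \<tau> \<in> \<O> \<and>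
        gen_equiv M W \<delta> \<mu> d (\<delta> + \<mu> + lam X + psi X + \<tau>))"
    obtain Y \<O> where zY: "z = (Y, \<O>)" by (cases z)
    obtain \<sigma> where Y: "Y \<in> R" "\<O> \<in> orbits02 M W \<delta> \<mu> (lam Y) (psi Y)" "\<sigma> \<in> Z02 M W \<mu> (\<delta> + lam Y)"
        "cls02 M W \<mu> (\<delta> + lam Y) \<sigma> \<in> \<O>" "gen_equiv M W \<delta> \<mu> d (\<delta> + \<mu> + lam Y + psi Y + \<sigma>)"
      using z unfolding zY prod.case by blast
    interpret F: ext_base M W \<delta>W \<mu>M \<delta> \<mu> "lam Y" "psi Y" by (rule R_ext_base[OF Y(1)])
    have \<sigma>: "psi Y + \<sigma> \<in> psi_cochains" using psi_plus[OF F.p_psi F.T_psi[OF Y(3)]] .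
    have "gen_equiv M W \<delta> \<mu> (\<delta> + \<mu> + l + q) (\<delta> + \<mu> + lam Y + (psi Y + \<sigma>))"
      using Y(5) d(2) by (simp only: add.assoc)
    then obtain f where f: "f \<in> Gdm" "lam Y +o B M W \<mu> 1 1 = actH M W \<mu> 1 1 f ?cl"
      by (rule gen_equiv_lam_class[OF lq F.l_lam \<sigma>])
    have "Y \<in> ?start" using f R_class_eq[OF Y(1)] by blast
    then have YX: "Y = X" using X_unique Y(1) by blast
    have \<sigma>T: "\<sigma> \<in> E.T" using Y(3) YX by simp
    have "gen_equiv M W \<delta> \<mu> (E.D \<tau>) (E.D \<sigma>)"
      using Y(5) \<tau>(2) gen_equiv_sym gen_equiv_trans unfolding YX by blast
    \<comment> \<open>Both orbits contain the class of \<open>\<sigma>\<close>, and an orbit can be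
      recovered from any of its members.\<close>
    then have "E.cls \<sigma> \<in> ?O" using \<sigma>T by blast
    note E.orbit_mem_equiv[OF O \<sigma>T this]
    also have "E.cls ` {\<tau>' \<in> E.T. gen_equiv M W \<delta> \<mu> (E.D \<sigma>) (E.D \<tau>')} = \<O>"
      by (rule E.orbit_mem_equiv[symmetric, OF _ \<sigma>T]) (use Y(2,4) YX in simp_all)
    finally have "?O = \<O>" .
    then show "z = (X, ?O)" using zY YX by simp
  qed
qed

lemma orbit_equivalent:
  assumes "X \<in> R" "\<O> \<in> orbits02 M W \<delta> \<mu> (lam X) (psi X)"
    "\<tau> \<in> Z02 M W \<mu> (\<delta> + lam X)" "\<tau>' \<in> Z02 M W \<mu> (\<delta> + lam X)"
    "cls02 M W \<mu> (\<delta> + lam X) \<tau> \<in> \<O>" "cls02 M W \<mu> (\<delta> + lam X) \<tau>' \<in> \<O>"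
  shows "gen_equiv M W \<delta> \<mu> (\<delta> + \<mu> + lam X + psi X + \<tau>) (\<delta> + \<mu> + lam X + psi X + \<tau>')"
proof -
  interpret E: ext_base M W \<delta>W \<mu>M \<delta> \<mu> "lam X" "psi X" by (rule R_ext_base[OF assms(1)])
  show ?thesis
    using E.orbit_mem_equiv[OF assms(2,3,5)] E.cls_mem_orbit_iff[OF assms(3,4)] assms(6) by simp
qed

lemma representative_extension:
  assumes "X \<in> R" "\<tau> \<in> Z02 M W \<mu> (\<delta> + lam X)"
  shows "\<delta> + \<mu> + lam X + psi X + \<tau> \<in> extensions M W \<delta> \<mu>"
  by (rule ext_base.D_extension[OF R_ext_base[OF assms(1)] assms(2)])

end

end

theorem theorem7p2:
  fixes M :: "('k::field, 'm::ab_group_add) graded"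
    and W :: "('k, 'w::ab_group_add) graded"
    and \<delta>W :: "'w cochain" and \<mu>M :: "'m cochain"
    and \<delta> \<mu> :: "('m \<times> 'w) cochain"
  assumes char: "CHAR('k) \<noteq> 2" "CHAR('k) \<noteq> 3"
    and spaces: "graded_space M" "graded_space W"
    and codiff: "codifferential W \<delta>W" "codifferential M \<mu>M"
    and ext: "\<delta> = ext_W \<delta>W" "\<mu> = ext_M \<mu>M"
  shows
    "(\<forall>l \<in> MC_cochains M W \<delta> \<mu>. \<exists>\<psi>. is_extension M W \<delta> \<mu> l \<psi>) \<and>
     (\<forall>R lam psi.
        R \<subseteq> MC_classes M W \<delta> \<mu> \<and>
        (\<forall>\<O> \<in> MC_orbits M W \<delta> \<mu>. \<exists>!X. X \<in> R \<inter> \<O>) \<and>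
        (\<forall>X \<in> R. lam X \<in> X \<and> odd_cochain (dsum M W) (lam X) \<and>
                 is_extension M W \<delta> \<mu> (lam X) (psi X)) \<longrightarrow>
        (\<forall>d \<in> extensions M W \<delta> \<mu>. \<exists>!(X, \<O>).
           X \<in> R \<and> \<O> \<in> orbits02 M W \<delta> \<mu> (lam X) (psi X) \<and>
           (\<exists>\<tau> \<in> Z02 M W \<mu> (\<delta> + lam X). cls02 M W \<mu> (\<delta> + lam X) \<tau> \<in> \<O> \<and>
              gen_equiv M W \<delta> \<mu> d (\<delta> + \<mu> + lam X + psi X + \<tau>))) \<and>
        (\<forall>X \<in> R. \<forall>\<O> \<in> orbits02 M W \<delta> \<mu> (lam X) (psi X).
           \<forall>\<tau> \<in> Z02 M W \<mu> (\<delta> + lam X). \<forall>\<tau>' \<in> Z02 M W \<mu> (\<delta> + lam X).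
             cls02 M W \<mu> (\<delta> + lam X) \<tau> \<in> \<O> \<and> cls02 M W \<mu> (\<delta> + lam X) \<tau>' \<in> \<O> \<longrightarrow>
             gen_equiv M W \<delta> \<mu> (\<delta> + \<mu> + lam X + psi X + \<tau>) (\<delta> + \<mu> + lam X + psi X + \<tau>')) \<and>
        (\<forall>X \<in> R. \<forall>\<tau> \<in> Z02 M W \<mu> (\<delta> + lam X).
           \<delta> + \<mu> + lam X + psi X + \<tau> \<in> extensions M W \<delta> \<mu>))"
proof (intro conjI allI impI)
  interpret ext_data M W \<delta>W \<mu>M \<delta> \<mu>
    by unfold_locales (use assms in auto)
  show "\<forall>l\<in>MC_cochains M W \<delta> \<mu>. \<exists>\<psi>. is_extension M W \<delta> \<mu> l \<psi>"
    using MC_imp_extension by blast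
  fix R lam psi
  assume R: "R \<subseteq> MC_classes M W \<delta> \<mu> \<and> (\<forall>\<O> \<in> MC_orbits M W \<delta> \<mu>. \<exists>!X. X \<in> R \<inter> \<O>) \<and>
    (\<forall>X \<in> R. lam X \<in> X \<and> odd_cochain (dsum M W) (lam X) \<and> is_extension M W \<delta> \<mu> (lam X) (psi X))"
  note R1 = R[THEN conjunct1] and R2 = R[THEN conjunct2, THEN conjunct1]
    and R3 = R[THEN conjunct2, THEN conjunct2]
  have orbits: "\<And>\<O>. \<O> \<in> MC_orbits M W \<delta> \<mu> \<Longrightarrow> \<exists>!X. X \<in> R \<inter> \<O>"
    by (rule R2[THEN bspec])
  have lam: "\<And>X. X \<in> R \<Longrightarrow> lam X \<in> X"
    by (rule R3[THEN bspec, THEN conjunct1])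
  have psi: "\<And>X. X \<in> R \<Longrightarrow> is_extension M W \<delta> \<mu> (lam X) (psi X)"
    by (rule R3[THEN bspec, THEN conjunct2, THEN conjunct2])
  note R' = R1 orbits lam psi
  show "\<forall>d \<in> extensions M W \<delta> \<mu>. \<exists>!(X, \<O>).
           X \<in> R \<and> \<O> \<in> orbits02 M W \<delta> \<mu> (lam X) (psi X) \<and>
           (\<exists>\<tau> \<in> Z02 M W \<mu> (\<delta> + lam X). cls02 M W \<mu> (\<delta> + lam X) \<tau> \<in> \<O> \<and>
              gen_equiv M W \<delta> \<mu> d (\<delta> + \<mu> + lam X + psi X + \<tau>))"
    by (rule ballI) (rule extension_representative[OF R'])
  show "\<forall>X \<in> R. \<forall>\<O> \<in> orbits02 M W \<delta> \<mu> (lam X) (psi X).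
           \<forall>\<tau> \<in> Z02 M W \<mu> (\<delta> + lam X). \<forall>\<tau>' \<in> Z02 M W \<mu> (\<delta> + lam X).
             cls02 M W \<mu> (\<delta> + lam X) \<tau> \<in> \<O> \<and> cls02 M W \<mu> (\<delta> + lam X) \<tau>' \<in> \<O> \<longrightarrow>
             gen_equiv M W \<delta> \<mu> (\<delta> + \<mu> + lam X + psi X + \<tau>) (\<delta> + \<mu> + lam X + psi X + \<tau>')"
    by (intro ballI impI, elim conjE) (rule orbit_equivalent[OF R'])
  show "\<forall>X \<in> R. \<forall>\<tau> \<in> Z02 M W \<mu> (\<delta> + lam X).
           \<delta> + \<mu> + lam X + psi X + \<tau> \<in> extensions M W \<delta> \<mu>"
    by (intro ballI) (rule representative_extension[OF R'])
qed

end
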